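(* Let $\epsilon>0$, and let $\lambda\ge\lambda_1$, where $\lambda_1$ is the constant of the Lipschitz estimate for $F_{\lambda,\epsilon}$ recalled in the context. For an arbitrary initial guess $\mathbf{u}^{(0)}\in H$, define the Picard iteration $$\mathbf{u}^{(k+1)}=F_{\lambda,\epsilon}(\mathbf{u}^{(k)}),\qquad k=0,1,2,\dots.$$ Then the sequence $\{\mathbf{u}^{(k)}\}_{k=0}^\infty$ converges in $(H,\|\cdot\|_{\lambda,\epsilon})$ to a unique fixed point $\mathbf{u}_{\lambda,\epsilon}\in H$ satisfying $$F_{\lambda,\epsilon}(\mathbf{u}_{\lambda,\epsilon})=\mathbf{u}_{\lambda,\epsilon}.$$ More precisely, $\mathbf{u}_{\lambda,\epsilon}$ is the unique minimizer of the functional $J^{\lambda,\epsilon}_{\mathbf{u}_{\lambda,\epsilon}}$ over the admissible set $H$. In addition, if $\mu\in(0,1)$ denotes the contraction constant of $F_{\lambda,\epsilon}$, then $$\|\mathbf{u}^{(k)}-\mathbf{u}_{\lambda,\epsilon}\|_{\lambda,\epsilon}\le\mu^k\|\mathbf{u}^{(0)}-\mathbf{u}_{\lambda,\epsilon}\|_{\lambda,\epsilon},\qquad k\ge0.$$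
   Context: Setting. $d\ge1$; $\Omega\subset\mathbb{R}^d$ is a bounded domain with smooth boundary and outward unit normal $\nu$; $T>0$; $p>1$ is real; $q\in L^\infty(\Omega\times(0,T))$ is real-valued; $N\ge0$ is an integer. All unknown functions are complex-valued; $\mathrm{i}$ is the imaginary unit. Time basis. Let $P_n$ be the Legendre polynomials on $(-1,1)$, $P_n(x)=\frac{1}{2^nn!}\frac{d^n}{dx^n}(x^2-1)^n$; $Q_n(t)=\sqrt{\frac{2n+1}{T}}\,P_n(\frac{2t}{T}-1)$; $\Psi_n(t)=e^tQ_n(t)$ for $t\in(0,T)$. For $m,n=0,\dots,N$ and $\boldsymbol{\varphi}=(\varphi_0,\dots,\varphi_N)^\top$ put $$s_{mn}=\int_0^Te^{-2t}\Psi_n'(t)\Psi_m(t)\,dt,\qquad b^N_{mn}(\boldsymbol{\varphi},\mathbf{x})=\int_0^Te^{-2t}q(\mathbf{x},t)\Big|\sum_{l=0}^N\varphi_l(\mathbf{x})\Psi_l(t)\Big|^{p-1}\Psi_n(t)\Psi_m(t)\,dt.$$ Carleman weight and constants $\beta_0,\lambda_0$. Fix $\mathbf{x}_0\in\mathbb{R}^d\setminus\overline\Omega$, $r(\mathbf{x})=|\mathbf{x}-\mathbf{x}_0|$, $R=\max_{\overline\Omega}r$. The constant $\beta_0>0$ is that of the following pointwise Carleman estimate for the Laplacian: for every $\beta\ge\beta_0$, every $\lambda\ge\lambda_0:=2R^\beta$ and every $u\in C^2(\overline\Omega)$, $$r^{\beta+2}e^{2\lambda r^{-\beta}}|\Delta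 u|^2\ge C\big[\mathrm{div}(U)+\lambda^3\beta^4e^{2\lambda r^{-\beta}}r^{-2\beta-2}|u|^2+\lambda\beta e^{2\lambda r^{-\beta}}|\nabla u|^2\big]\quad\text{in }\Omega,$$ for a vector field $U$ (depending on $u$) with $|U|\le Ce^{2\lambda r^{-\beta}}(\lambda^3\beta^3r^{-2\beta-2}|u|^2+\lambda\beta|\nabla u|^2)$, where $C>0$ depends only on $\mathbf{x}_0,\Omega,d$. Fix $\beta>\beta_0$. Admissible set. Fix $s>\frac d2+2$ and a (sufficiently large) constant $M>0$, and let $$H=\{\boldsymbol{\varphi}\in[H^s(\Omega)]^{N+1}:\ \boldsymbol{\varphi}|_{\partial\Omega}=\mathbf{0},\ \|\boldsymbol{\varphi}\|_{[L^\infty(\Omega)]^{N+1}}\le M\}.$$ Functional and map. Let $f_0,\dots,f_N\in L^2(\partial\Omega)$ be given boundary data (arising as $f_m(\mathbf{x})=\int_0^Te^{-2t}f(\mathbf{x},t)\Psi_m(t)\,dt$ from lateral Neumann data $f$). For $\boldsymbol{\varphi}\in H$, $\lambda>\lambda_0$, $\epsilon>0$ define, for $\mathbf{u}=(u_0,\dots,u_N)^\top\in H$, $$J^{\lambda,\epsilon}_{\boldsymbol{\varphi}}(\mathbf{u})=\sum_{m=0}^N\Big[\int_\Omega e^{2\lambda r^{-\beta}}\Big|\mathrm{i}\sum_{n=0}^Ns_{mn}u_n+\Delta u_m+\sum_{n=0}^Nb^N_{mn}(\boldsymbol{\varphi},\mathbf{x})\varphi_n\Big|^2d\mathbf{x}+\lambda^3\int_{\partial\Omega}e^{2\lambda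 r^{-\beta}}|\partial_\nu u_m-f_m|^2d\sigma+\epsilon\|u_m\|^2_{H^s(\Omega)}\Big].$$ This functional has a unique minimizer on $H$, and $F_{\lambda,\epsilon}:H\to H$ is defined by $F_{\lambda,\epsilon}(\boldsymbol{\varphi})=\operatorname{argmin}_{\mathbf{u}\in H}J^{\lambda,\epsilon}_{\boldsymbol{\varphi}}(\mathbf{u})$. Norm. $$\|\mathbf{u}\|_{\lambda,\epsilon}^2=\int_\Omega e^{2\lambda r^{-\beta}}|\mathbf{u}|^2d\mathbf{x}+2\int_{\partial\Omega}e^{2\lambda r^{-\beta}}|\partial_\nu\mathbf{u}|^2d\sigma+\frac{2\epsilon}{\lambda^3}\|\mathbf{u}\|^2_{[H^s(\Omega)]^{N+1}}.$$ The constant $\lambda_1$. It is the constant provided by the following previously established theorem: given $\epsilon>0$ and $\beta>\beta_0$, there exist $\lambda_1$ and $C$, depending only on $\Omega$, $\beta$, $s$, $N$, $p$, $T$, $\|q\|_{L^\infty(\Omega\times(0,T))}$, $\{\Psi_\ell\}_{\ell=0}^N$, $\{s_{mn}\}_{m,n=0}^N$ and $M$, such that for all $\lambda>\lambda_1$, $$\|F_{\lambda,\epsilon}(\boldsymbol{\varphi})-F_{\lambda,\epsilon}(\boldsymbol{\psi})\|_{\lambda,\epsilon}\le\sqrt{\frac{C}{\lambda^3}}\,\|\boldsymbol{\varphi}-\boldsymbol{\psi}\|_{\lambda,\epsilon}\qquad\text{for all }\boldsymbol{\varphi},\boldsymbol{\psi}\in H.$$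
   Formalization: The formal theorem additionally assumes that λ is so large that the recalled Lipschitz constant √(C/λ³) is less than 1; the recalled estimate alone, for λ ≥ λ₁, does not make F a contraction, so μ ∈ (0,1) need not exist. *)

theory Defs
  imports "HOL-Analysis.Analysis"
begin

section \<open>Differential operators, classical regularity, smooth domains\<close>

definition partial_deriv :: "'a::euclidean_space \<Rightarrow> ('a \<Rightarrow> 'b::real_normed_vector) \<Rightarrow> 'a \<Rightarrow> 'b" where
  "partial_deriv b u x = vector_derivative (\<lambda>t. u (x + t *\<^sub>R b)) (at 0)"

definition laplacian :: "('a::euclidean_space \<Rightarrow> complex) \<Rightarrow> 'a \<Rightarrow> complex" where
  "laplacian u x = (\<Sum>b\<in>Basis. partial_deriv b (partial_deriv b u) x)"

definition divergence :: "('a::euclidean_space \<Rightarrow> 'a) \<Rightarrow> 'a \<Rightarrow> real" where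
  "divergence U x = (\<Sum>b\<in>Basis. partial_deriv b U x \<bullet> b)"

definition grad_norm :: "('a::euclidean_space \<Rightarrow> complex) \<Rightarrow> 'a \<Rightarrow> real" where
  "grad_norm u x = L2_set (\<lambda>b. cmod (partial_deriv b u x)) Basis"

text \<open>\<open>Ck_closure k S u\<close>, for open \<open>S\<close>: the function \<open>u\<close> is of class \<open>C^k\<close> on \<open>S\<close> and it and
  its partial derivatives up to order \<open>k\<close> extend continuously to the closure of \<open>S\<close> (\<open>v\<close> is
  the extension of a partial derivative; the values of \<open>u\<close> itself on the boundary are the ones of
  the continuous extension).  For \<open>S = UNIV\<close> this is plain \<open>C^k\<close>.\<close>

primrec Ck_closure :: "nat \<Rightarrow> 'a::euclidean_space set \<Rightarrow> ('a \<Rightarrow> 'b::real_normed_vector) \<Rightarrow> bool" where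
  "Ck_closure 0 S u \<longleftrightarrow> continuous_on (closure S) u"
| "Ck_closure (Suc k) S u \<longleftrightarrow> continuous_on (closure S) u \<and> u differentiable_on S \<and>
     (\<forall>b\<in>Basis. \<exists>v. Ck_closure k S v \<and> (\<forall>x\<in>S. v x = partial_deriv b u x))"

text \<open>Near each boundary point, after a rotation of the axes, the set is the region above the graph
  of a smooth function: \<open>e\<close> is the vertical direction, and \<open>\<gamma>\<close> depends only on the component
  of its argument orthogonal to \<open>e\<close>.\<close>

definition smooth_boundary :: "'a::euclidean_space set \<Rightarrow> bool" where
  "smooth_boundary \<Omega> \<longleftrightarrow> (\<forall>x\<in>frontier \<Omega>. \<exists>\<rho>>0. \<exists>e. \<exists>\<gamma> :: 'a \<Rightarrow> real.
     norm e = 1 \<and> (\<forall>k. Ck_closure k UNIV \<gamma>) \<and> (\<forall>y. \<gamma> (y - (y \<bullet> e) *\<^sub>R e) = \<gamma> y) \<and>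
     \<Omega> \<inter> ball x \<rho> = {y \<in> ball x \<rho>. \<gamma> y < y \<bullet> e})"

definition smooth_bounded_domain :: "'a::euclidean_space set \<Rightarrow> bool" where
  "smooth_bounded_domain \<Omega> \<longleftrightarrow>
     open \<Omega> \<and> connected \<Omega> \<and> \<Omega> \<noteq> {} \<and> bounded \<Omega> \<and> smooth_boundary \<Omega>"

text \<open>The limit says that \<open>\<nu> x\<close> is orthogonal to the boundary at \<open>x\<close> (vacuous in dimension 1,
  where boundary points are isolated).\<close>

definition outward_unit_normal :: "'a::euclidean_space set \<Rightarrow> ('a \<Rightarrow> 'a) \<Rightarrow> bool" where
  "outward_unit_normal \<Omega> \<nu> \<longleftrightarrow> continuous_on (frontier \<Omega>) \<nu> \<and>
     (\<forall>x\<in>frontier \<Omega>. norm (\<nu> x) = 1 \<and>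
        ((\<lambda>y. ((y - x) \<bullet> \<nu> x) / norm (y - x)) \<longlongrightarrow> 0) (at x within frontier \<Omega>) \<and>
        (\<forall>\<^sub>F t in at_right 0. x - t *\<^sub>R \<nu> x \<in> \<Omega> \<and> x + t *\<^sub>R \<nu> x \<notin> closure \<Omega>))"

text \<open>For \<open>u\<close> of class \<open>C^1\<close> up to the boundary, the derivative in direction \<open>\<nu> x\<close>, computed
  from values of \<open>u\<close> in the closure of the domain only.\<close>

definition normal_deriv :: "('a::euclidean_space \<Rightarrow> 'a) \<Rightarrow> ('a \<Rightarrow> complex) \<Rightarrow> 'a \<Rightarrow> complex" where
  "normal_deriv \<nu> u x = - vector_derivative (\<lambda>t. u (x - t *\<^sub>R \<nu> x)) (at 0 within {0..})"


section \<open>Surface measure\<close>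

text \<open>Hausdorff measure of dimension \<open>k\<close>, with the normalisation for which it is the usual
  surface area.  The outer measure is a metric outer measure, hence countably additive on Borel
  sets, so that \<open>measure_of\<close> does not degenerate.  The empty set is singled out because
  \<open>diameter {} ^ 0 = 1\<close>.\<close>

definition hausdorff_premeasure :: "nat \<Rightarrow> real \<Rightarrow> 'a::euclidean_space set \<Rightarrow> ennreal" where
  "hausdorff_premeasure k \<delta> A =
     (INF C \<in> {C :: nat \<Rightarrow> 'a set. A \<subseteq> (\<Union>i. C i) \<and> (\<forall>i. bounded (C i) \<and> diameter (C i) \<le> \<delta>)}.
        \<Sum>i. if C i = {} then 0 else ennreal (unit_ball_vol (real k) * (diameter (C i) / 2) ^ k))"

definition hausdorff_outer :: "nat \<Rightarrow> 'a::euclidean_space set \<Rightarrow> ennreal" where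
  "hausdorff_outer k A = (SUP \<delta>\<in>{0<..}. hausdorff_premeasure k \<delta> A)"

definition hausdorff_measure :: "nat \<Rightarrow> 'a::euclidean_space measure" where
  "hausdorff_measure k = measure_of UNIV (sets borel) (hausdorff_outer k)"

definition surface_measure :: "'a::euclidean_space set \<Rightarrow> 'a measure" where
  "surface_measure \<Omega> = restrict_space (hausdorff_measure (DIM('a) - 1)) (frontier \<Omega>)"


section \<open>Sobolev spaces\<close>

text \<open>\<open>H^s\<close> of a domain is the space of restrictions of elements of \<open>H^s\<close> of the whole space, with
  the quotient norm; the whole-space norm is the \<open>L^2\<close> norm of \<open>(1 + |\<xi>|^2)^(s/2)\<close> times the
  (unitary) Fourier transform \<open>g\<close>.  Only \<open>s > DIM('a) / 2\<close> is covered: then \<open>g\<close> is in \<open>L^1\<close>,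
  the inversion integral converges absolutely, and every element has a unique representative that
  is continuous on the closure of the domain.  Elements are these representatives, so boundary
  values are traces; outside the closure they are set to \<open>0\<close>.\<close>

definition Hs_weighted :: "real \<Rightarrow> ('a::euclidean_space \<Rightarrow> complex) \<Rightarrow> bool" where
  "Hs_weighted s g \<longleftrightarrow> g \<in> borel_measurable lborel \<and>
     integrable lborel (\<lambda>\<xi>. (1 + (norm \<xi>)\<^sup>2) powr s * (cmod (g \<xi>))\<^sup>2)"

definition inverse_fourier :: "('a::euclidean_space \<Rightarrow> complex) \<Rightarrow> 'a \<Rightarrow> complex" where
  "inverse_fourier g x =
     of_real ((2 * pi) powr (- real DIM('a) / 2)) * (LINT \<xi>|lborel. cis (x \<bullet> \<xi>) * g \<xi>)"

definition Hs_lifts :: "real \<Rightarrow> 'a::euclidean_space set \<Rightarrow> ('a \<Rightarrow> complex) \<Rightarrow> ('a \<Rightarrow> complex) set" where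
  "Hs_lifts s \<Omega> u = {g. Hs_weighted s g \<and> (\<forall>x\<in>closure \<Omega>. u x = inverse_fourier g x)}"

definition Hs_space :: "real \<Rightarrow> 'a::euclidean_space set \<Rightarrow> ('a \<Rightarrow> complex) set" where
  "Hs_space s \<Omega> = {u. Hs_lifts s \<Omega> u \<noteq> {} \<and> (\<forall>x. x \<notin> closure \<Omega> \<longrightarrow> u x = 0)}"

definition Hs_norm :: "real \<Rightarrow> 'a::euclidean_space set \<Rightarrow> ('a \<Rightarrow> complex) \<Rightarrow> real" where
  "Hs_norm s \<Omega> u = (INF g\<in>Hs_lifts s \<Omega> u.
     sqrt (LINT \<xi>|lborel. (1 + (norm \<xi>)\<^sup>2) powr s * (cmod (g \<xi>))\<^sup>2))"


section \<open>Legendre time basis\<close>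

definition legendre :: "nat \<Rightarrow> real \<Rightarrow> real" where
  "legendre n x = (deriv ^^ n) (\<lambda>y. (y\<^sup>2 - 1) ^ n) x / (2 ^ n * fact n)"

definition Psi :: "real \<Rightarrow> nat \<Rightarrow> real \<Rightarrow> real" where
  "Psi T n t = exp t * (sqrt ((2 * real n + 1) / T) * legendre n (2 * t / T - 1))"

definition s_coeff :: "real \<Rightarrow> nat \<Rightarrow> nat \<Rightarrow> real" where
  "s_coeff T m n = (LINT t|lebesgue_on {0<..<T}. exp (- 2 * t) * deriv (Psi T n) t * Psi T m t)"

text \<open>Vectors \<open>(\<phi>\<^sub>0, \<dots>, \<phi>\<^sub>N)\<close> of functions are maps \<open>nat \<Rightarrow> 'a \<Rightarrow> complex\<close>; in the
  admissible set below the components with index above \<open>N\<close> are \<open>0\<close>.\<close>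

definition b_coeff ::
  "real \<Rightarrow> real \<Rightarrow> ('a::euclidean_space \<Rightarrow> real \<Rightarrow> real) \<Rightarrow> nat \<Rightarrow> (nat \<Rightarrow> 'a \<Rightarrow> complex)
    \<Rightarrow> nat \<Rightarrow> nat \<Rightarrow> 'a \<Rightarrow> real" where
  "b_coeff T p q N \<phi> m n x =
     (LINT t|lebesgue_on {0<..<T}. exp (- 2 * t) * q x t *
        cmod (\<Sum>l\<le>N. \<phi> l x * of_real (Psi T l t)) powr (p - 1) * Psi T n t * Psi T m t)"

definition essentially_bounded_potential ::
  "'a::euclidean_space set \<Rightarrow> real \<Rightarrow> ('a \<Rightarrow> real \<Rightarrow> real) \<Rightarrow> bool" where
  "essentially_bounded_potential \<Omega> T q \<longleftrightarrow>
     (\<lambda>(x, t). q x t) \<in> borel_measurable (lebesgue_on (\<Omega> \<times> {0<..<T})) \<and>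
     (\<exists>K. AE z in lebesgue_on (\<Omega> \<times> {0<..<T}). \<bar>q (fst z) (snd z)\<bar> \<le> K)"


section \<open>Carleman weight\<close>

definition carleman_weight :: "'a::euclidean_space \<Rightarrow> real \<Rightarrow> real \<Rightarrow> 'a \<Rightarrow> real" where
  "carleman_weight x0 \<beta> lam x = exp (2 * lam * norm (x - x0) powr (- \<beta>))"

definition lambda0 :: "'a::euclidean_space set \<Rightarrow> 'a \<Rightarrow> real \<Rightarrow> real" where
  "lambda0 \<Omega> x0 \<beta> = 2 * (SUP x\<in>closure \<Omega>. norm (x - x0)) powr \<beta>"

definition carleman_threshold :: "'a::euclidean_space set \<Rightarrow> 'a \<Rightarrow> real \<Rightarrow> bool" where
  "carleman_threshold \<Omega> x0 \<beta>0 \<longleftrightarrow> \<beta>0 > 0 \<and>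
     (\<exists>C>0. \<forall>\<beta>\<ge>\<beta>0. \<forall>lam\<ge>lambda0 \<Omega> x0 \<beta>. \<forall>u :: 'a \<Rightarrow> complex. Ck_closure 2 \<Omega> u \<longrightarrow>
       (\<exists>U :: 'a \<Rightarrow> 'a. Ck_closure 1 \<Omega> U \<and>
         (\<forall>x\<in>\<Omega>. let r = norm (x - x0); w = carleman_weight x0 \<beta> lam x in
            r powr (\<beta> + 2) * w * (cmod (laplacian u x))\<^sup>2
              \<ge> C * (divergence U x
                   + lam ^ 3 * \<beta> ^ 4 * w * r powr (- 2 * \<beta> - 2) * (cmod (u x))\<^sup>2
                   + lam * \<beta> * w * (grad_norm u x)\<^sup>2) \<and>
            norm (U x) \<le> C * w * (lam ^ 3 * \<beta> ^ 3 * r powr (- 2 * \<beta> - 2) * (cmod (u x))\<^sup>2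
                   + lam * \<beta> * (grad_norm u x)\<^sup>2))))"


section \<open>Admissible set, functional, solution map, norm\<close>

definition admissible :: "real \<Rightarrow> 'a::euclidean_space set \<Rightarrow> nat \<Rightarrow> real \<Rightarrow> (nat \<Rightarrow> 'a \<Rightarrow> complex) set" where
  "admissible s \<Omega> N M = {\<phi>. (\<forall>n\<le>N. \<phi> n \<in> Hs_space s \<Omega>) \<and> (\<forall>n>N. \<phi> n = (\<lambda>x. 0)) \<and>
     (\<forall>n\<le>N. \<forall>x\<in>frontier \<Omega>. \<phi> n x = 0) \<and>
     (AE x in lebesgue_on \<Omega>. L2_set (\<lambda>n. cmod (\<phi> n x)) {..N} \<le> M)}"

definition functional_J ::
  "'a::euclidean_space set \<Rightarrow> ('a \<Rightarrow> 'a) \<Rightarrow> real \<Rightarrow> real \<Rightarrow> ('a \<Rightarrow> real \<Rightarrow> real) \<Rightarrow> nat \<Rightarrow> 'a \<Rightarrow> real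
    \<Rightarrow> real \<Rightarrow> (nat \<Rightarrow> 'a \<Rightarrow> complex) \<Rightarrow> real \<Rightarrow> real
    \<Rightarrow> (nat \<Rightarrow> 'a \<Rightarrow> complex) \<Rightarrow> (nat \<Rightarrow> 'a \<Rightarrow> complex) \<Rightarrow> real" where
  "functional_J \<Omega> \<nu> T p q N x0 \<beta> s f \<epsilon> lam \<phi> u =
     (\<Sum>m\<le>N.
        (LINT x|lebesgue_on \<Omega>. carleman_weight x0 \<beta> lam x *
           (cmod (\<i> * (\<Sum>n\<le>N. of_real (s_coeff T m n) * u n x) + laplacian (u m) x
                  + (\<Sum>n\<le>N. of_real (b_coeff T p q N \<phi> m n x) * \<phi> n x)))\<^sup>2)
      + lam ^ 3 * (LINT x|surface_measure \<Omega>. carleman_weight x0 \<beta> lam x *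
           (cmod (normal_deriv \<nu> (u m) x - f m x))\<^sup>2)
      + \<epsilon> * (Hs_norm s \<Omega> (u m))\<^sup>2)"

definition solution_map ::
  "'a::euclidean_space set \<Rightarrow> ('a \<Rightarrow> 'a) \<Rightarrow> real \<Rightarrow> real \<Rightarrow> ('a \<Rightarrow> real \<Rightarrow> real) \<Rightarrow> nat \<Rightarrow> 'a \<Rightarrow> real
    \<Rightarrow> real \<Rightarrow> real \<Rightarrow> (nat \<Rightarrow> 'a \<Rightarrow> complex) \<Rightarrow> real \<Rightarrow> real
    \<Rightarrow> (nat \<Rightarrow> 'a \<Rightarrow> complex) \<Rightarrow> (nat \<Rightarrow> 'a \<Rightarrow> complex)" where
  "solution_map \<Omega> \<nu> T p q N x0 \<beta> s M f \<epsilon> lam \<phi> =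
     arg_min_on (functional_J \<Omega> \<nu> T p q N x0 \<beta> s f \<epsilon> lam \<phi>) (admissible s \<Omega> N M)"

definition carleman_norm ::
  "'a::euclidean_space set \<Rightarrow> ('a \<Rightarrow> 'a) \<Rightarrow> nat \<Rightarrow> 'a \<Rightarrow> real \<Rightarrow> real \<Rightarrow> real \<Rightarrow> real
    \<Rightarrow> (nat \<Rightarrow> 'a \<Rightarrow> complex) \<Rightarrow> real" where
  "carleman_norm \<Omega> \<nu> N x0 \<beta> s \<epsilon> lam u = sqrt
     ((LINT x|lebesgue_on \<Omega>. carleman_weight x0 \<beta> lam x * (\<Sum>n\<le>N. (cmod (u n x))\<^sup>2))
      + 2 * (LINT x|surface_measure \<Omega>. carleman_weight x0 \<beta> lam x *
               (\<Sum>n\<le>N. (cmod (normal_deriv \<nu> (u n) x))\<^sup>2))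
      + 2 * \<epsilon> / lam ^ 3 * (\<Sum>n\<le>N. (Hs_norm s \<Omega> (u n))\<^sup>2))"

end

theory Submission
  imports Defs
begin

text \<open>For \<open>s > d / 2 + 2\<close> the values, the Laplacian and the normal derivative of \<open>u\<close> are continuous in space and
  bounded by the \<open>H^s\<close> norm of \<open>u\<close>.  Hence the functional is continuous on the closed convex set \<open>H\<close>, and
  its Sobolev term makes it strongly convex by the parallelogram law: minimizing sequences are Cauchy, and \<open>F\<close>
  is well defined.  For the same reason the weighted norm is equivalent to the \<open>H^s\<close> norm, so that \<open>H\<close> is
  complete and Banach's argument applies.  As integrals of non-integrable functions are \<open>0\<close>, all this requires
  the boundary to have finite surface measure and the coefficients \<open>b_coeff\<close> to be measurable and bounded.\<close>

section \<open>Weighted square integrals\<close>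

text \<open>\<open>Hs_norm\<close> is an infimum over lifts, and no minimal lift is at hand;
  inequalities for it are shown for almost optimal lifts and then passed to the infimum. What
  survives this, and also the summation over components and over the terms of the functional, is an
  inequality between squares. The triangle inequality is therefore used as
  \<open>(a + b)^2 <= (1 + \<delta>) a^2 + (1 + 1/\<delta>) b^2\<close> for all
  \<open>\<delta> > 0\<close>, and norms are recovered by optimizing \<open>\<delta>\<close>.
  Derivatives are handled on the Fourier side: once a function is replaced by a lift, its
  derivatives are absolutely convergent integrals with a multiplier bounded by
  \<open>1 + |\<xi>|^2\<close>. This also restores linearity, which \<open>vector_derivative\<close>
  has only where derivatives exist. The Lipschitz estimate is given strictly above
  \<open>lambda1\<close>. At \<open>lambda1\<close> it is obtained as a limit: functionals with
  nearby parameters differ by a factor close to 1, and strong convexity turns this into closeness of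
  the minimizers.\<close>

definition sq_int :: "'a measure \<Rightarrow> ('a \<Rightarrow> real) \<Rightarrow> ('a \<Rightarrow> complex) \<Rightarrow> bool" where
  "sq_int \<mu> w a \<longleftrightarrow> a \<in> borel_measurable \<mu> \<and> integrable \<mu> (\<lambda>x. w x * (cmod (a x))\<^sup>2)"

definition sqn :: "'a measure \<Rightarrow> ('a \<Rightarrow> real) \<Rightarrow> ('a \<Rightarrow> complex) \<Rightarrow> real" where
  "sqn \<mu> w a = (LINT x|\<mu>. w x * (cmod (a x))\<^sup>2)"

text \<open>The defect is the perfect square \<open>(\<delta> a - b)^2 / \<delta>\<close>. In this
  form the triangle inequality is linear in the squares, so it can be integrated, summed and passed
  through an infimum.\<close>

lemma weak_triangle_sq:
  fixes a b \<delta> :: real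
  assumes "\<delta> > 0"
  shows "(a + b)\<^sup>2 \<le> (1 + \<delta>) * a\<^sup>2 + (1 + 1 / \<delta>) * b\<^sup>2"
proof -
  have "(1 + \<delta>) * a\<^sup>2 + (1 + 1 / \<delta>) * b\<^sup>2 - (a + b)\<^sup>2 = (\<delta> * a - b)\<^sup>2 / \<delta>"
    using assms by (simp add: field_simps power2_eq_square)
  moreover have "(\<delta> * a - b)\<^sup>2 / \<delta> \<ge> 0" using assms by simp
  ultimately show ?thesis by linarith
qed

lemma weak_triangle_norm_sq:
  fixes a b :: "'b::real_normed_vector"
  assumes "\<delta> > 0"
  shows "(norm (a + b))\<^sup>2 \<le> (1 + \<delta>) * (norm a)\<^sup>2 + (1 + 1 / \<delta>) * (norm b)\<^sup>2"
  using power_mono[OF norm_triangle_ineq[of a b] norm_ge_zero, of 2]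
    weak_triangle_sq[OF assms, of "norm a" "norm b"] by linarith

lemma parallelogram_law_norm:
  fixes a b :: "'b::real_inner"
  shows "(norm (a + b))\<^sup>2 + (norm (a - b))\<^sup>2 = 2 * (norm a)\<^sup>2 + 2 * (norm b)\<^sup>2"
  unfolding power2_norm_eq_inner by (simp add: inner_simps inner_commute)

text \<open>The bound in \<open>weak\<close>, minimized over \<open>\<delta>\<close>, is
  \<open>(sqrt X + sqrt Y)^2\<close>; this is how triangle inequalities for norms come back from
  inequalities between squares.\<close>

lemma sqrt_triangle_from_weak:
  fixes X Y Z :: real
  assumes "X \<ge> 0" "Y \<ge> 0" and weak: "\<And>\<delta>. \<delta> > 0 \<Longrightarrow> Z \<le> (1 + \<delta>) * X + (1 + 1 / \<delta>) * Y"
  shows "sqrt Z \<le> sqrt X + sqrt Y"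
proof (rule field_le_epsilon)
  fix \<eta> :: real assume \<eta>: "\<eta> > 0"
  \<comment> \<open>Shifting both roots by \<open>\<eta> / 2\<close> makes them positive, so that
    the optimal \<open>\<delta> = y / x\<close> is available even when \<open>X\<close> or
    \<open>Y\<close> vanishes.\<close>
  define x where "x = sqrt X + \<eta> / 2"
  define y where "y = sqrt Y + \<eta> / 2"
  have pos: "x > 0" "y > 0" and le: "sqrt X \<le> x" "sqrt Y \<le> y"
    using \<eta> assms by (auto simp: x_def y_def intro: add_nonneg_pos)
  then have X: "X \<le> x\<^sup>2" and Y: "Y \<le> y\<^sup>2"
    by (simp_all add: sqrt_le_D)
  have exact: "(1 + y / x) * x\<^sup>2 + (1 + 1 / (y / x)) * y\<^sup>2 = (x + y)\<^sup>2"
    using pos by (simp add: field_simps power2_eq_square)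
  have "Z \<le> (1 + y / x) * X + (1 + 1 / (y / x)) * Y"
    using weak[of "y / x"] pos by simp
  also have "\<dots> \<le> (x + y)\<^sup>2"
    unfolding exact[symmetric] using X Y pos
    by (intro add_mono mult_left_mono) (auto simp: add_nonneg_nonneg)
  finally have "sqrt Z \<le> x + y" using pos by (simp add: real_le_lsqrt)
  then show "sqrt Z \<le> sqrt X + sqrt Y + \<eta>" by (simp add: x_def y_def)
qed

lemma sq_int_lincomb:
  assumes [measurable]: "w \<in> borel_measurable \<mu>" and w: "\<And>x. w x \<ge> 0"
    and a: "sq_int \<mu> w a" and b: "sq_int \<mu> w b"
  shows "sq_int \<mu> w (\<lambda>x. c * a x + d * b x)"
proof -
  note [measurable] = a[unfolded sq_int_def, THEN conjunct1] b[unfolded sq_int_def, THEN conjunct1]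
  have "integrable \<mu> (\<lambda>x. w x * (cmod (c * a x + d * b x))\<^sup>2)"
  proof (rule Bochner_Integration.integrable_bound)
    show "integrable \<mu> (\<lambda>x. 2 * (cmod c)\<^sup>2 * (w x * (cmod (a x))\<^sup>2) + 2 * (cmod d)\<^sup>2 * (w x * (cmod (b x))\<^sup>2))"
      using a b unfolding sq_int_def by (intro Bochner_Integration.integrable_add integrable_mult_right) auto
    show "AE x in \<mu>. norm (w x * (cmod (c * a x + d * b x))\<^sup>2)
      \<le> norm (2 * (cmod c)\<^sup>2 * (w x * (cmod (a x))\<^sup>2) + 2 * (cmod d)\<^sup>2 * (w x * (cmod (b x))\<^sup>2))"
    proof (rule AE_I2)
      fix x
      have "(cmod (c * a x + d * b x))\<^sup>2 \<le> 2 * (cmod (c * a x))\<^sup>2 + 2 * (cmod (d * b x))\<^sup>2"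
        using weak_triangle_norm_sq[of 1 "c * a x" "d * b x"] by simp
      from mult_left_mono[OF this w[of x]] show "norm (w x * (cmod (c * a x + d * b x))\<^sup>2)
      \<le> norm (2 * (cmod c)\<^sup>2 * (w x * (cmod (a x))\<^sup>2) + 2 * (cmod d)\<^sup>2 * (w x * (cmod (b x))\<^sup>2))"
        using w[of x] by (simp add: norm_mult power_mult_distrib algebra_simps)
    qed
  qed measurable
  then show ?thesis unfolding sq_int_def by simp
qed

lemma sq_int_add: "\<lbrakk>w \<in> borel_measurable \<mu>; \<And>x. w x \<ge> 0; sq_int \<mu> w a; sq_int \<mu> w b\<rbrakk> \<Longrightarrow> sq_int \<mu> w (\<lambda>x. a x + b x)"
  and sq_int_diff: "\<lbrakk>w \<in> borel_measurable \<mu>; \<And>x. w x \<ge> 0; sq_int \<mu> w a; sq_int \<mu> w b\<rbrakk> \<Longrightarrow> sq_int \<mu> w (\<lambda>x. a x - b x)"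
  using sq_int_lincomb[of w \<mu> a b 1 1] sq_int_lincomb[of w \<mu> a b 1 "-1"] by simp_all

lemma sqn_nonneg: "(\<And>x. w x \<ge> 0) \<Longrightarrow> sqn \<mu> w a \<ge> 0"
  unfolding sqn_def by (intro integral_nonneg_AE) auto

lemma sqn_scale: "sqn \<mu> w (\<lambda>x. c * a x) = (cmod c)\<^sup>2 * sqn \<mu> w a"
proof -
  have "(\<lambda>x. w x * (cmod (c * a x))\<^sup>2) = (\<lambda>x. (cmod c)\<^sup>2 * (w x * (cmod (a x))\<^sup>2))"
    by (simp add: norm_mult power_mult_distrib mult_ac)
  then show ?thesis unfolding sqn_def by simp
qed

lemma sqn_weak_triangle:
  assumes "w \<in> borel_measurable \<mu>" and w: "\<And>x. w x \<ge> 0" and a: "sq_int \<mu> w a" and b: "sq_int \<mu> w b" and "\<delta> > 0"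
  shows "sqn \<mu> w (\<lambda>x. a x + b x) \<le> (1 + \<delta>) * sqn \<mu> w a + (1 + 1 / \<delta>) * sqn \<mu> w b"
proof -
  have int: "integrable \<mu> (\<lambda>x. (1 + \<delta>) * (w x * (cmod (a x))\<^sup>2))" "integrable \<mu> (\<lambda>x. (1 + 1/\<delta>) * (w x * (cmod (b x))\<^sup>2))"
    using a b unfolding sq_int_def by (auto intro!: integrable_mult_right)
  have "sqn \<mu> w (\<lambda>x. a x + b x) \<le> (LINT x|\<mu>. (1 + \<delta>) * (w x * (cmod (a x))\<^sup>2) + (1 + 1/\<delta>) * (w x * (cmod (b x))\<^sup>2))"
    unfolding sqn_def
  proof (rule integral_mono)
    show "integrable \<mu> (\<lambda>x. w x * (cmod (a x + b x))\<^sup>2)"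
      using sq_int_add[OF assms(1-4)] unfolding sq_int_def by simp
    show "integrable \<mu> (\<lambda>x. (1 + \<delta>) * (w x * (cmod (a x))\<^sup>2) + (1 + 1/\<delta>) * (w x * (cmod (b x))\<^sup>2))"
      using int by (rule Bochner_Integration.integrable_add)
    fix x
    show "w x * (cmod (a x + b x))\<^sup>2 \<le> (1 + \<delta>) * (w x * (cmod (a x))\<^sup>2) + (1 + 1/\<delta>) * (w x * (cmod (b x))\<^sup>2)"
      using mult_left_mono[OF weak_triangle_norm_sq[OF \<open>\<delta> > 0\<close>, of "a x" "b x"] w[of x]] 
      by (simp only: distrib_left mult.left_commute)
  qed
  also have "\<dots> = (1 + \<delta>) * sqn \<mu> w a + (1 + 1 / \<delta>) * sqn \<mu> w b"
    using int by (subst Bochner_Integration.integral_add) (simp_all add: sqn_def)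
  finally show ?thesis .
qed

lemma sqn_parallelogram:
  assumes "w \<in> borel_measurable \<mu>" and w: "\<And>x. w x \<ge> 0" and a: "sq_int \<mu> w a" and b: "sq_int \<mu> w b"
  shows "sqn \<mu> w (\<lambda>x. a x + b x) + sqn \<mu> w (\<lambda>x. a x - b x) = 2 * sqn \<mu> w a + 2 * sqn \<mu> w b"
proof -
  have "integrable \<mu> (\<lambda>x. w x * (cmod (a x + b x))\<^sup>2)" "integrable \<mu> (\<lambda>x. w x * (cmod (a x - b x))\<^sup>2)"
    using sq_int_add[OF assms] sq_int_diff[OF assms] unfolding sq_int_def by auto
  then have "sqn \<mu> w (\<lambda>x. a x + b x) + sqn \<mu> w (\<lambda>x. a x - b x) =
    (LINT x|\<mu>. w x * (cmod (a x + b x))\<^sup>2 + w x * (cmod (a x - b x))\<^sup>2)"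
    unfolding sqn_def by simp
  also have "\<dots> = (LINT x|\<mu>. 2 * (w x * (cmod (a x))\<^sup>2) + 2 * (w x * (cmod (b x))\<^sup>2))"
    by (intro Bochner_Integration.integral_cong refl)
       (metis (no_types, lifting) parallelogram_law_norm distrib_left mult.left_commute)
  also have "\<dots> = 2 * sqn \<mu> w a + 2 * sqn \<mu> w b"
    using a b unfolding sqn_def sq_int_def by simp
  finally show ?thesis .
qed

lemma sqn_mono_weight:
  assumes "sq_int \<mu> w a" "sq_int \<mu> w' a" "\<And>x. x \<in> space \<mu> \<Longrightarrow> w x \<le> w' x"
  shows "sqn \<mu> w a \<le> sqn \<mu> w' a"
  using assms unfolding sqn_def sq_int_def by (intro integral_mono) (auto intro: mult_right_mono)

lemma sqn_scale_weight: "sqn \<mu> (\<lambda>x. c * w x) a = c * sqn \<mu> w a"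
  unfolding sqn_def by (simp add: mult.assoc)

lemma sq_int_bounded:
  assumes "finite_measure \<mu>" "w \<in> borel_measurable \<mu>" "a \<in> borel_measurable \<mu>"
    and "AE x in \<mu>. 0 \<le> w x \<and> w x \<le> W" and "AE x in \<mu>. cmod (a x) \<le> B"
  shows "sq_int \<mu> w a"
  unfolding sq_int_def
proof
  interpret finite_measure \<mu> by fact
  note [measurable] = assms(2,3)
  show "integrable \<mu> (\<lambda>x. w x * (cmod (a x))\<^sup>2)"
  proof (rule integrable_const_bound)
    show "AE x in \<mu>. norm (w x * (cmod (a x))\<^sup>2) \<le> W * B\<^sup>2"
      using assms(4,5) by eventually_elim (auto simp: abs_mult intro!: mult_mono power_mono)
  qed measurable
qed fact

lemma sqn_bounded:
  assumes "finite_measure \<mu>" "w \<in> borel_measurable \<mu>" "a \<in> borel_measurable \<mu>"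
    and w: "\<And>x. x \<in> space \<mu> \<Longrightarrow> 0 \<le> w x \<and> w x \<le> W" and a: "\<And>x. x \<in> space \<mu> \<Longrightarrow> cmod (a x) \<le> B"
  shows "sqn \<mu> w a \<le> W * B\<^sup>2 * measure \<mu> (space \<mu>)"
proof -
  interpret finite_measure \<mu> by fact
  have "sq_int \<mu> w a" using assms by (intro sq_int_bounded[where W = W and B = B]) auto
  then have "sqn \<mu> w a \<le> (LINT x|\<mu>. W * B\<^sup>2)"
    unfolding sqn_def sq_int_def using w a by (intro integral_mono mult_mono power_mono) (auto intro: order_trans)
  then show ?thesis by (simp add: mult_ac)
qed

lemma sqn_cong: "(\<And>x. x \<in> space \<mu> \<Longrightarrow> a x = b x) \<Longrightarrow> sqn \<mu> w a = sqn \<mu> w b"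
  unfolding sqn_def by (intro Bochner_Integration.integral_cong) auto

text \<open>Convexity of a squared seminorm: the parallelogram law with the difference term
  dropped.\<close>

lemma sqn_midpoint:
  assumes "w \<in> borel_measurable \<mu>" and w: "\<And>x. w x \<ge> 0" and a: "sq_int \<mu> w a" and b: "sq_int \<mu> w b"
  shows "sqn \<mu> w (\<lambda>x. (a x + b x) / 2) \<le> (sqn \<mu> w a + sqn \<mu> w b) / 2"
proof -
  have "sqn \<mu> w (\<lambda>x. (a x + b x) / 2) = sqn \<mu> w (\<lambda>x. a x + b x) / 4"
    using sqn_scale[of \<mu> w "1/2" "\<lambda>x. a x + b x"] by (simp add: power_divide)
  moreover have "sqn \<mu> w (\<lambda>x. a x + b x) \<le> 2 * sqn \<mu> w a + 2 * sqn \<mu> w b"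
    unfolding sqn_parallelogram[OF assms, symmetric] using sqn_nonneg[of w \<mu> "\<lambda>x. a x - b x", OF w] by simp
  ultimately show ?thesis by simp
qed

lemma sqn_triangle:
  assumes "w \<in> borel_measurable \<mu>" "\<And>x. w x \<ge> 0" "sq_int \<mu> w a" "sq_int \<mu> w b"
  shows "sqrt (sqn \<mu> w (\<lambda>x. a x + b x)) \<le> sqrt (sqn \<mu> w a) + sqrt (sqn \<mu> w b)"
  by (intro sqrt_triangle_from_weak sqn_nonneg sqn_weak_triangle assms)

lemma sqn_sum_triangle:
  assumes w: "w \<in> borel_measurable \<mu>" "\<And>x. w x \<ge> 0" and "finite F" and h: "\<And>k. k \<in> F \<Longrightarrow> sq_int \<mu> w (h k)"
  shows "sq_int \<mu> w (\<lambda>x. \<Sum>k\<in>F. h k x) \<and> sqrt (sqn \<mu> w (\<lambda>x. \<Sum>k\<in>F. h k x)) \<le> (\<Sum>k\<in>F. sqrt (sqn \<mu> w (h k)))"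
  using \<open>finite F\<close> h
proof (induction F rule: finite_induct)
  case empty
  then show ?case by (simp add: sq_int_def sqn_def)
next
  case (insert k F)
  from insert.IH insert.prems have IH: "sq_int \<mu> w (\<lambda>x. \<Sum>k\<in>F. h k x)" "sqrt (sqn \<mu> w (\<lambda>x. \<Sum>k\<in>F. h k x)) \<le> (\<Sum>k\<in>F. sqrt (sqn \<mu> w (h k)))"
    and k: "sq_int \<mu> w (h k)" by (blast intro: insert.prems)+
  show ?case
    using sq_int_add[OF w k IH(1)] sqn_triangle[OF w k IH(1)] IH(2) insert.hyps by simp
qed

section \<open>Inverse Fourier transforms of weighted square integrable functions\<close>

text \<open>The Japanese bracket of \<open>\<xi>\<close> to the power \<open>2 * s\<close>. It
  weights \<open>|g|^2\<close>; its square root is the usual Bessel potential symbol of order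
  \<open>s\<close>.\<close>

definition jw :: "real \<Rightarrow> 'a::euclidean_space \<Rightarrow> real" where
  "jw s \<xi> = (1 + (norm \<xi>)\<^sup>2) powr s"

lemma jw_measurable [measurable]: "jw s \<in> borel_measurable borel"
  unfolding jw_def by measurable

lemma jw_pos: "jw s \<xi> > 0"
  unfolding jw_def by (smt (verit) powr_gt_zero zero_le_power2)

lemma jw_nonneg: "jw s \<xi> \<ge> 0"
  using jw_pos[of s \<xi>] by simp

lemma jw_add: "jw (s + t) \<xi> = jw s \<xi> * jw t \<xi>"
  unfolding jw_def by (rule powr_add)

lemma jw_1: "jw 1 \<xi> = 1 + (norm \<xi>)\<^sup>2"
  unfolding jw_def by simp

text \<open>Where \<open>2^k <= |\<xi>| < 2^(k+1)\<close> the function is at most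
  \<open>2^(-2tk)\<close>, while the ball of radius \<open>2^(k+1)\<close> has volume of order
  \<open>2^(kd)\<close>; the sum is geometric with ratio \<open>2^(d-2t) < 1\<close>. Whole balls
  can replace the dyadic shells because only an upper bound is wanted.\<close>

lemma jw_integrable:
  assumes t: "t > real DIM('a) / 2"
  shows "integrable lborel (jw (- t) :: 'a::euclidean_space \<Rightarrow> real)"
proof -
  let ?d = "DIM('a)"
  let ?V = "unit_ball_vol (real ?d)"
  define b where "b k = 2 powr (- 2 * t * real k)" for k :: nat
  define \<theta> where "\<theta> = 2 powr (real ?d - 2 * t)"
  have t0: "t > 0" using t by (smt (verit) divide_nonneg_pos of_nat_0_le_iff)
  have shells: "ennreal (jw (- t) \<xi>) \<le> (\<Sum>k. ennreal (b k) * indicator (ball (0::'a) (2 ^ Suc k)) \<xi>)" for \<xi> :: 'a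
  proof -
    obtain n where "norm \<xi> < 2 ^ n" using real_arch_pow[of 2] by auto
    then have ex: "\<exists>k. norm \<xi> < 2 ^ Suc k" by (intro exI[of _ n], elim less_le_trans) simp
    \<comment> \<open>By minimality \<open>|\<xi>| >= 2^k\<close> unless \<open>k = 0\<close>; in
      that case \<open>b 0 = 1\<close> and the trivial bound by 1 is enough.\<close>
    define k where "k = (LEAST k. norm \<xi> < 2 ^ Suc k)"
    have k: "norm \<xi> < 2 ^ Suc k" unfolding k_def using ex by (rule LeastI_ex)
    have "jw (- t) \<xi> \<le> b k"
    proof (cases k)
      case 0
      have "1 + (norm \<xi>)\<^sup>2 > 0" by (simp add: add_pos_nonneg)
      moreover have "jw (- t) \<xi> \<le> jw 0 \<xi>" unfolding jw_def using t0 by (intro powr_mono) auto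
      ultimately show ?thesis using 0 by (simp add: jw_def b_def)
    next
      case (Suc j)
      have "\<not> norm \<xi> < 2 ^ k" 
        using not_less_Least[of j "\<lambda>k. norm \<xi> < 2 ^ Suc k"] Suc unfolding k_def[symmetric] by simp
      then have "(2 ^ k)\<^sup>2 \<le> (norm \<xi>)\<^sup>2" by (intro power_mono) auto
      then have "2 powr (2 * real k) \<le> 1 + (norm \<xi>)\<^sup>2"
        using powr_realpow[of 2 "2 * k"] by (simp add: power_mult[symmetric] mult.commute)
      then have "jw (-t) \<xi> \<le> (2 powr (2 * real k)) powr (- t)"
        unfolding jw_def using t0 by (intro powr_mono2') auto
      also have "\<dots> = b k" by (simp add: b_def powr_powr mult_ac)
      finally show ?thesis .
    qed
    then have "ennreal (jw (- t) \<xi>) \<le> ennreal (b k) * indicator (ball (0::'a) (2 ^ Suc k)) \<xi>"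
      using k by (simp add: ennreal_leI)
    also have "\<dots> \<le> (\<Sum>k. ennreal (b k) * indicator (ball (0::'a) (2 ^ Suc k)) \<xi>)"
    proof -
      define u where "u k = ennreal (b k) * indicator (ball (0::'a) (2 ^ Suc k)) \<xi>" for k
      show ?thesis using sum_le_suminf[OF summableI, of "{k}" u] unfolding u_def[symmetric] by simp
    qed
    finally show ?thesis .
  qed
  have summand: "b k * (?V * (2 ^ Suc k) ^ ?d) = ?V * 2 ^ ?d * \<theta> ^ k" for k
  proof -
    have "(2 ^ k) ^ ?d = 2 powr (real (k * ?d))"
      by (subst powr_realpow) (simp_all add: power_mult)
    moreover have "\<theta> ^ k = 2 powr ((real ?d - 2 * t) * real k)"
      unfolding \<theta>_def by (subst powr_power) (simp_all add: mult.commute)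
    moreover have "b k * 2 powr (real (k * ?d)) = 2 powr (- 2 * t * real k + real (k * ?d))"
      unfolding b_def by (rule powr_add[symmetric])
    moreover have "- 2 * t * real k + real (k * ?d) = (real ?d - 2 * t) * real k" by (simp add: algebra_simps)
    ultimately have "b k * (2 ^ k) ^ ?d = \<theta> ^ k" by simp
    then show ?thesis by (simp add: power_mult_distrib)
  qed
  have \<theta>: "0 \<le> \<theta>" "\<theta> < 1" using t by (auto simp: \<theta>_def powr_less_one)
  have ball_sets [measurable]: "ball (0::'a) r \<in> sets lborel" for r by simp
  have "(\<integral>\<^sup>+\<xi>. ennreal (jw (- t) (\<xi>::'a)) \<partial>lborel) \<le> (\<integral>\<^sup>+\<xi>. (\<Sum>k. ennreal (b k) * indicator (ball (0::'a) (2 ^ Suc k)) \<xi>) \<partial>lborel)"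
    by (intro nn_integral_mono shells)
  also have "\<dots> = (\<Sum>k. \<integral>\<^sup>+\<xi>. ennreal (b k) * indicator (ball (0::'a) (2 ^ Suc k)) \<xi> \<partial>lborel)"
    by (intro nn_integral_suminf) (use ball_sets in measurable)
  also have "\<dots> = (\<Sum>k. ennreal (?V * 2 ^ ?d * \<theta> ^ k))"
  proof (intro suminf_cong)
    fix k
    have "(\<integral>\<^sup>+\<xi>. ennreal (b k) * indicator (ball (0::'a) (2 ^ Suc k)) \<xi> \<partial>lborel) = ennreal (b k) * emeasure lborel (ball (0::'a) (2 ^ Suc k))"
      by (subst nn_integral_cmult_indicator) auto
    also have "\<dots> = ennreal (b k * (?V * (2 ^ Suc k) ^ ?d))"
      by (subst emeasure_ball) (auto simp: ennreal_mult b_def)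
    finally show "(\<integral>\<^sup>+\<xi>. ennreal (b k) * indicator (ball (0::'a) (2 ^ Suc k)) \<xi> \<partial>lborel) = ennreal (?V * 2 ^ ?d * \<theta> ^ k)"
      unfolding summand .
  qed
  also have "\<dots> < \<infinity>"
    using \<theta> by (subst suminf_ennreal2) (auto intro!: summable_mult summable_geometric simp: less_top)
  finally show ?thesis
    by (intro integrableI_bounded) (auto simp: jw_nonneg)
qed

lemma Hs_weighted_iff: "Hs_weighted s g \<longleftrightarrow> sq_int lborel (jw s) g"
  unfolding Hs_weighted_def sq_int_def jw_def ..

text \<open>Cauchy-Schwarz for \<open>jw (1 - s/2)\<close> and \<open>jw (s/2) |g|\<close>, whose
  product is \<open>jw 1 |g|\<close>; the first factor is square integrable because
  \<open>s - 2 > d/2\<close>. It is run through the arithmetic-geometric mean with a scaling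
  \<open>\<tau>\<close>, which explains the constant \<open>(A + 1) / 2\<close> in place of
  \<open>sqrt A\<close>.\<close>

lemma weighted_L1:
  fixes g :: "'a::euclidean_space \<Rightarrow> complex"
  assumes s: "s > real DIM('a) / 2 + 2" and g: "sq_int lborel (jw s) g"
  defines "A \<equiv> LINT \<xi>|lborel. jw (2 - s) (\<xi>::'a)"
  shows "integrable lborel (\<lambda>\<xi>. jw 1 \<xi> * cmod (g \<xi>))"
    and "(LINT \<xi>|lborel. jw 1 \<xi> * cmod (g \<xi>)) \<le> (A + 1) / 2 * sqrt (sqn lborel (jw s) g)"
proof -
  have A: "integrable lborel (jw (2 - s) :: 'a \<Rightarrow> real)"
    using jw_integrable[where 'a = 'a, of "s - 2"] s by simp
  have gm [measurable]: "g \<in> borel_measurable borel" using g unfolding sq_int_def by simp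
  have I: "integrable lborel (\<lambda>\<xi>. jw s \<xi> * (cmod (g \<xi>))\<^sup>2)" using g unfolding sq_int_def by simp
  have am_gm: "jw 1 \<xi> * (\<tau> * cmod (g \<xi>)) \<le> (jw (2 - s) \<xi> + \<tau>\<^sup>2 * (jw s \<xi> * (cmod (g \<xi>))\<^sup>2)) / 2" for \<xi> \<tau>
  proof -
    define X where "X = jw (1 - s / 2) \<xi>"
    define Y where "Y = jw (s / 2) \<xi>"
    have "jw 1 \<xi> = X * Y" "jw (2 - s) \<xi> = X\<^sup>2" "jw s \<xi> = Y\<^sup>2"
      unfolding X_def Y_def power2_eq_square jw_add[symmetric] by simp_all
    moreover have "0 \<le> (X - Y * (\<tau> * cmod (g \<xi>)))\<^sup>2" by simp
    ultimately show ?thesis by (simp add: power2_eq_square algebra_simps)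
  qed
  show int: "integrable lborel (\<lambda>\<xi>. jw 1 \<xi> * cmod (g \<xi>))"
  proof (rule Bochner_Integration.integrable_bound)
    show "integrable lborel (\<lambda>\<xi>. (jw (2 - s) \<xi> + jw s \<xi> * (cmod (g \<xi>))\<^sup>2) / 2)"
      using A I by simp
    show "AE \<xi> in lborel. norm (jw 1 \<xi> * cmod (g \<xi>)) \<le> norm ((jw (2 - s) \<xi> + jw s \<xi> * (cmod (g \<xi>))\<^sup>2) / 2)"
      using am_gm[of _ 1] by (auto simp: jw_nonneg abs_mult intro!: AE_I2 order_trans[OF _ abs_ge_self])
  qed measurable
  define L where "L = (LINT \<xi>|lborel. jw 1 \<xi> * cmod (g \<xi>))"
  define G where "G = sqrt (sqn lborel (jw s) g)"
  have G2: "G\<^sup>2 = sqn lborel (jw s) g" unfolding G_def by (simp add: sqn_nonneg jw_nonneg)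
  have scaled: "\<tau> * L \<le> (A + \<tau>\<^sup>2 * G\<^sup>2) / 2" for \<tau>
  proof -
    have "\<tau> * L = (LINT \<xi>|lborel. jw 1 \<xi> * (\<tau> * cmod (g \<xi>)))"
      unfolding L_def by (simp add: mult.left_commute)
    also have "\<dots> \<le> (LINT \<xi>|lborel. (jw (2 - s) \<xi> + \<tau>\<^sup>2 * (jw s \<xi> * (cmod (g \<xi>))\<^sup>2)) / 2)"
      using integrable_mult_right[OF int, of \<tau>] A I
      by (intro integral_mono am_gm integrable_divide Bochner_Integration.integrable_add integrable_mult_right)
         (simp_all add: mult.left_commute)
    also have "\<dots> = (A + \<tau>\<^sup>2 * G\<^sup>2) / 2"
      unfolding G2 unfolding sqn_def A_def using A I by simp
    finally show ?thesis .
  qed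
  have A0: "A \<ge> 0" unfolding A_def by (intro integral_nonneg_AE) (auto simp: jw_nonneg)
  have G0: "G \<ge> 0" unfolding G_def by (simp add: sqn_nonneg jw_nonneg)
  have "L \<le> (A + 1) / 2 * G + \<eta>" if "\<eta> > 0" for \<eta>
  proof -
    \<comment> \<open>The natural scaling is \<open>1 / G\<close>, but \<open>G\<close> may be 0, so
      \<open>\<kappa>\<close> is added to it; its value makes the loss exactly
      \<open>\<eta>\<close>.\<close>
    define \<kappa> where "\<kappa> = 2 * \<eta> / (A + 1)"
    have \<kappa>: "\<kappa> > 0" using \<open>\<eta> > 0\<close> A0 by (simp add: \<kappa>_def)
    have "(1 / (G + \<kappa>))\<^sup>2 * G\<^sup>2 \<le> 1"
      using G0 \<kappa> by (simp add: power_divide power_mono divide_le_eq_1)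
    then have "1 / (G + \<kappa>) * L \<le> (A + 1) / 2" using scaled[of "1 / (G + \<kappa>)"] by simp
    then have "L \<le> (A + 1) / 2 * (G + \<kappa>)" using G0 \<kappa> by (simp add: field_simps)
    also have "\<dots> = (A + 1) / 2 * G + \<eta>" using A0 by (simp add: \<kappa>_def field_simps)
    finally show ?thesis .
  qed
  then show "L \<le> (A + 1) / 2 * G" by (rule field_le_epsilon)
qed

section \<open>Continuity and differentiation of inverse Fourier integrals\<close>

lemma measurable_cis [measurable]: "cis \<in> borel_measurable borel"
  by (intro borel_measurable_continuous_onI continuous_intros)

lemma fourier_kernel_integrable:
  assumes "integrable lborel g"
  shows "integrable lborel (\<lambda>\<xi>. cis (x \<bullet> \<xi>) * g \<xi>)"
proof (rule Bochner_Integration.integrable_bound[OF assms])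
  have [measurable]: "g \<in> borel_measurable borel" using borel_measurable_integrable[OF assms] by simp
  show "(\<lambda>\<xi>. cis (x \<bullet> \<xi>) * g \<xi>) \<in> borel_measurable lborel" by measurable
qed (simp add: norm_mult)

lemma inverse_fourier_lincomb:
  assumes "integrable lborel g" "integrable lborel h"
  shows "inverse_fourier (\<lambda>\<xi>. a * g \<xi> + b * h \<xi>) x = a * inverse_fourier g x + b * inverse_fourier h x"
proof -
  have "(\<lambda>\<xi>. cis (x \<bullet> \<xi>) * (a * g \<xi> + b * h \<xi>)) = (\<lambda>\<xi>. a * (cis (x \<bullet> \<xi>) * g \<xi>) + b * (cis (x \<bullet> \<xi>) * h \<xi>))"
    by (simp add: algebra_simps)
  then show ?thesis
    unfolding inverse_fourier_def
    using fourier_kernel_integrable[OF assms(1), of x] fourier_kernel_integrable[OF assms(2), of x]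
    by (simp add: algebra_simps)
qed

lemma inverse_fourier_sum:
  assumes "\<And>i. i \<in> I \<Longrightarrow> integrable lborel (g i)"
  shows "inverse_fourier (\<lambda>\<xi>. \<Sum>i\<in>I. g i \<xi>) x = (\<Sum>i\<in>I. inverse_fourier (g i) x)"
  unfolding inverse_fourier_def sum_distrib_left
  by (subst Bochner_Integration.integral_sum) (auto intro: fourier_kernel_integrable assms simp: sum_distrib_left)

lemma fourier_const_le_1: "(2 * pi) powr (- real n / 2) \<le> 1"
  using pi_gt3 powr_mono[of "- real n / 2" 0 "2 * pi"] by simp

lemma norm_inverse_fourier_le:
  fixes g :: "'a::euclidean_space \<Rightarrow> complex"
  assumes "integrable lborel g"
  shows "cmod (inverse_fourier g x) \<le> (LINT \<xi>|lborel. cmod (g \<xi>))"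
proof -
  have "cmod (inverse_fourier g x) \<le> 1 * cmod (LINT \<xi>|lborel. cis (x \<bullet> \<xi>) * g \<xi>)"
    unfolding inverse_fourier_def norm_mult using fourier_const_le_1[of "DIM('a)"]
    by (intro mult_right_mono) auto
  also have "\<dots> \<le> (LINT \<xi>|lborel. cmod (cis (x \<bullet> \<xi>) * g \<xi>))"
    by (simp del: norm_mult)
  finally show ?thesis by (simp add: norm_mult)
qed

lemma continuous_inverse_fourier:
  fixes g :: "'a::euclidean_space \<Rightarrow> complex"
  assumes g: "integrable lborel g"
  shows "continuous_on S (inverse_fourier g)"
  unfolding continuous_on_sequentially comp_def
proof (intro allI ballI impI, elim conjE)
  fix X and x :: 'a assume X: "X \<longlonglongrightarrow> x"
  have [measurable]: "g \<in> borel_measurable borel" using borel_measurable_integrable[OF g] by simp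
  have "(\<lambda>n. LINT \<xi>|lborel. cis (X n \<bullet> \<xi>) * g \<xi>) \<longlonglongrightarrow> (LINT \<xi>|lborel. cis (x \<bullet> \<xi>) * g \<xi>)"
  proof (rule integral_dominated_convergence[where w = "\<lambda>\<xi>. cmod (g \<xi>)"])
    show "AE \<xi> in lborel. (\<lambda>n. cis (X n \<bullet> \<xi>) * g \<xi>) \<longlonglongrightarrow> cis (x \<bullet> \<xi>) * g \<xi>"
      using X by (intro AE_I2 tendsto_intros)
  qed (use g in \<open>auto simp: norm_mult\<close>)
  then show "(\<lambda>n. inverse_fourier g (X n)) \<longlonglongrightarrow> inverse_fourier g x"
    unfolding inverse_fourier_def by (intro tendsto_mult tendsto_const)
qed

text \<open>The chord is no longer than the arc; this dominates the difference quotients of the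
  Fourier kernel.\<close>

lemma norm_cis_minus_1_le: "cmod (cis \<theta> - 1) \<le> \<bar>\<theta>\<bar>"
proof -
  have "cmod (cis \<theta> - 1) = 2 * \<bar>sin (\<theta> / 2)\<bar>"
    using dist_exp_i_1[of \<theta>] by (simp add: cis_conv_exp)
  also have "\<dots> \<le> 2 * \<bar>\<theta> / 2\<bar>" by (intro mult_left_mono abs_sin_x_le_abs_x) auto
  finally show ?thesis by simp
qed

text \<open>Differentiation under the integral: the error of the difference quotient tends to 0
  pointwise and is dominated by \<open>2 |v| |\<xi>| |g|\<close>, which is integrable by the second
  hypothesis.\<close>

lemma has_vector_derivative_inverse_fourier:
  fixes g :: "'a::euclidean_space \<Rightarrow> complex"
  assumes g: "integrable lborel g" and \<xi>g: "integrable lborel (\<lambda>\<xi>. norm \<xi> * cmod (g \<xi>))"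
  shows "((\<lambda>t. inverse_fourier g (x + t *\<^sub>R v)) has_vector_derivative
           inverse_fourier (\<lambda>\<xi>. \<i> * of_real (v \<bullet> \<xi>) * g \<xi>) x) (at 0)"
proof -
  let ?h = "\<lambda>\<xi>. \<i> * of_real (v \<bullet> \<xi>) * g \<xi>"
  let ?c = "complex_of_real ((2 * pi) powr (- real DIM('a) / 2))"
  have [measurable]: "g \<in> borel_measurable borel" using borel_measurable_integrable[OF g] by simp
  have v\<xi>: "cmod (?h \<xi>) \<le> norm v * (norm \<xi> * cmod (g \<xi>))" for \<xi>
    using mult_right_mono[OF Cauchy_Schwarz_ineq2[of v \<xi>], of "cmod (g \<xi>)"] by (simp add: norm_mult mult.assoc)
  have h: "integrable lborel ?h"
    by (rule Bochner_Integration.integrable_bound[OF integrable_mult_right[OF \<xi>g, of "norm v"]])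
       (use v\<xi> in \<open>auto simp: abs_mult\<close>)
  \<comment> \<open>The integrand of the difference quotient minus that of the candidate derivative.
    \<open>r_alt\<close> splits off the factor that depends on \<open>t\<close>; it tends to 0 and
    is at most twice \<open>|v \<bullet> \<xi>|\<close> in modulus.\<close>
  define r where "r t \<xi> = (cis ((x + t *\<^sub>R v) \<bullet> \<xi>) - cis (x \<bullet> \<xi>)
      - of_real t * (\<i> * of_real (v \<bullet> \<xi>)) * cis (x \<bullet> \<xi>)) / of_real t * g \<xi>" for t :: real and \<xi>
  have r_alt: "r t \<xi> = ((cis (t * (v \<bullet> \<xi>)) - 1) / of_real t - \<i> * of_real (v \<bullet> \<xi>)) * (cis (x \<bullet> \<xi>) * g \<xi>)"
    if "t \<noteq> 0" for t \<xi>
    using that unfolding r_def by (simp add: inner_add_left cis_mult[symmetric] field_simps)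
  have lim: "((\<lambda>t. LINT \<xi>|lborel. r t \<xi>) \<longlongrightarrow> 0) (at 0)"
    unfolding tendsto_at_iff_sequentially comp_def
  proof (intro allI impI)
    fix X :: "nat \<Rightarrow> real" assume X: "\<forall>i. X i \<in> UNIV - {0}" "X \<longlonglongrightarrow> 0"
    have "(\<lambda>n. LINT \<xi>|lborel. r (X n) \<xi>) \<longlonglongrightarrow> (LINT \<xi>|(lborel :: 'a measure). (0::complex))"
    proof (rule integral_dominated_convergence[where w = "\<lambda>\<xi>. 2 * norm v * (norm \<xi> * cmod (g \<xi>))"])
      show "integrable lborel (\<lambda>\<xi>. 2 * norm v * (norm \<xi> * cmod (g \<xi>)))" using \<xi>g by (rule integrable_mult_right)
      show "AE \<xi> in lborel. (\<lambda>n. r (X n) \<xi>) \<longlonglongrightarrow> 0"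
      proof (rule AE_I2)
        fix \<xi>
        have "((\<lambda>t. cis (t * (v \<bullet> \<xi>))) has_vector_derivative (\<i> * of_real (v \<bullet> \<xi>))) (at 0)"
          unfolding has_vector_derivative_def
          by (auto intro!: derivative_eq_intros simp: scaleR_conv_of_real)
        then have "((\<lambda>t. (cis (t * (v \<bullet> \<xi>)) - 1) / of_real t) \<longlongrightarrow> \<i> * of_real (v \<bullet> \<xi>)) (at 0)"
        proof -
          let ?q = "\<lambda>t. (cis (t * (v \<bullet> \<xi>)) - 1) / of_real t"
          assume "((\<lambda>t. cis (t * (v \<bullet> \<xi>))) has_vector_derivative (\<i> * of_real (v \<bullet> \<xi>))) (at 0)"
          then have "((\<lambda>t. norm (cis (t * (v \<bullet> \<xi>)) - 1 - t *\<^sub>R (\<i> * of_real (v \<bullet> \<xi>))) / norm t) \<longlongrightarrow> 0) (at 0)"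
            unfolding has_vector_derivative_def has_derivative_at by simp
          moreover have "norm (cis (t * (v \<bullet> \<xi>)) - 1 - t *\<^sub>R (\<i> * of_real (v \<bullet> \<xi>))) / norm t = norm (?q t - \<i> * of_real (v \<bullet> \<xi>))"
            if "t \<noteq> 0" for t
          proof -
            have "?q t - \<i> * of_real (v \<bullet> \<xi>) = (cis (t * (v \<bullet> \<xi>)) - 1 - t *\<^sub>R (\<i> * of_real (v \<bullet> \<xi>))) / of_real t"
              using that by (simp add: scaleR_conv_of_real field_simps)
            then show ?thesis by (simp only: norm_divide norm_of_real real_norm_def)
          qed
          ultimately have "((\<lambda>t. norm (?q t - \<i> * of_real (v \<bullet> \<xi>))) \<longlongrightarrow> 0) (at 0)"
            by (elim Lim_transform_eventually) (simp add: eventually_at_filter)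
          then show ?thesis by (simp add: tendsto_norm_zero_iff LIM_zero_iff)
        qed
        then have "(\<lambda>n. (cis (X n * (v \<bullet> \<xi>)) - 1) / of_real (X n)) \<longlonglongrightarrow> \<i> * of_real (v \<bullet> \<xi>)"
          using X unfolding tendsto_at_iff_sequentially comp_def by blast
        then have "(\<lambda>n. ((cis (X n * (v \<bullet> \<xi>)) - 1) / of_real (X n) - \<i> * of_real (v \<bullet> \<xi>)) * (cis (x \<bullet> \<xi>) * g \<xi>))
            \<longlonglongrightarrow> (\<i> * of_real (v \<bullet> \<xi>) - \<i> * of_real (v \<bullet> \<xi>)) * (cis (x \<bullet> \<xi>) * g \<xi>)"
          by (intro tendsto_intros)
        then show "(\<lambda>n. r (X n) \<xi>) \<longlonglongrightarrow> 0" using X(1) by (simp add: r_alt)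
      qed
      show "AE \<xi> in lborel. norm (r (X n) \<xi>) \<le> 2 * norm v * (norm \<xi> * cmod (g \<xi>))" for n
      proof (rule AE_I2)
        fix \<xi>
        have X0: "X n \<noteq> 0" using X by auto
        have "cmod ((cis (X n * (v \<bullet> \<xi>)) - 1) / of_real (X n)) \<le> \<bar>v \<bullet> \<xi>\<bar>"
          using norm_cis_minus_1_le[of "X n * (v \<bullet> \<xi>)"] X0 by (simp add: norm_divide field_simps abs_mult)
        then have "cmod ((cis (X n * (v \<bullet> \<xi>)) - 1) / of_real (X n) - \<i> * of_real (v \<bullet> \<xi>)) \<le> 2 * \<bar>v \<bullet> \<xi>\<bar>"
          using norm_triangle_ineq4[of "(cis (X n * (v \<bullet> \<xi>)) - 1) / of_real (X n)" "\<i> * of_real (v \<bullet> \<xi>)"]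
          by (simp add: norm_mult)
        also have "\<dots> \<le> 2 * (norm v * norm \<xi>)" using Cauchy_Schwarz_ineq2[of v \<xi>] by simp
        finally have "cmod ((cis (X n * (v \<bullet> \<xi>)) - 1) / of_real (X n) - \<i> * of_real (v \<bullet> \<xi>)) * cmod (g \<xi>)
           \<le> 2 * (norm v * norm \<xi>) * cmod (g \<xi>)" by (rule mult_right_mono) simp
        then show "norm (r (X n) \<xi>) \<le> 2 * norm v * (norm \<xi> * cmod (g \<xi>))"
          by (simp add: r_alt[OF X0] norm_mult mult_ac)
      qed
    qed (simp_all add: r_def)
    then show "(\<lambda>n. LINT \<xi>|lborel. r (X n) \<xi>) \<longlonglongrightarrow> 0" by simp
  qed
  have rem: "inverse_fourier g (x + t *\<^sub>R v) - inverse_fourier g x - t *\<^sub>R inverse_fourier ?h x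
     = of_real t * (?c * (LINT \<xi>|lborel. r t \<xi>))" if "t \<noteq> 0" for t
  proof -
    have "of_real t * (LINT \<xi>|lborel. r t \<xi>) = (LINT \<xi>|lborel. of_real t * r t \<xi>)" by simp
    also have "\<dots> = (LINT \<xi>|lborel. cis ((x + t *\<^sub>R v) \<bullet> \<xi>) * g \<xi> - cis (x \<bullet> \<xi>) * g \<xi> - of_real t * (cis (x \<bullet> \<xi>) * ?h \<xi>))"
      using that by (intro Bochner_Integration.integral_cong refl) (simp add: r_def field_simps)
    also have "\<dots> = (LINT \<xi>|lborel. cis ((x + t *\<^sub>R v) \<bullet> \<xi>) * g \<xi>) - (LINT \<xi>|lborel. cis (x \<bullet> \<xi>) * g \<xi>) - of_real t * (LINT \<xi>|lborel. cis (x \<bullet> \<xi>) * ?h \<xi>)"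
      using fourier_kernel_integrable[OF g, of x] fourier_kernel_integrable[OF g, of "x + t *\<^sub>R v"]
        fourier_kernel_integrable[OF h, of x] by simp
    finally show ?thesis
      unfolding inverse_fourier_def scaleR_conv_of_real mult.left_commute[of "of_real t" ?c]
        right_diff_distrib[symmetric] by simp
  qed
  have "((\<lambda>t. norm (?c * (LINT \<xi>|lborel. r t \<xi>))) \<longlongrightarrow> 0) (at 0)"
    using tendsto_norm_zero[OF tendsto_mult_right_zero[OF lim, of ?c]] .
  then have "((\<lambda>t. norm (inverse_fourier g (x + t *\<^sub>R v) - inverse_fourier g x - t *\<^sub>R inverse_fourier ?h x) / norm t) \<longlongrightarrow> 0) (at 0)"
    by (rule tendsto_cong[THEN iffD1, rotated])
       (auto simp: eventually_at_filter rem norm_mult)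
  then show ?thesis
    unfolding has_vector_derivative_def has_derivative_at by (auto intro: bounded_linear_scaleR_left)
qed

text \<open>Serves every multiplier in use: those of the identity, of first and second derivatives
  in unit directions and of the Laplacian are all bounded by \<open>1 + |\<xi>|^2\<close>.\<close>

lemma weighted_dominated_integrable:
  fixes g :: "'a::euclidean_space \<Rightarrow> complex" and k :: "'a \<Rightarrow> 'b::{banach,second_countable_topology}"
  assumes s: "s > real DIM('a) / 2 + 2" and g: "sq_int lborel (jw s) g"
    and "k \<in> borel_measurable lborel" "\<And>\<xi>. norm (k \<xi>) \<le> (1 + (norm \<xi>)\<^sup>2) * cmod (g \<xi>)"
  shows "integrable lborel k"
  by (rule Bochner_Integration.integrable_bound[OF weighted_L1(1)[OF s g]])
     (use assms(3,4) in \<open>auto simp: jw_1\<close>)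

lemma one_plus_sq_ge:
  fixes r :: real
  shows "1 \<le> 1 + r\<^sup>2" "r \<le> 1 + r\<^sup>2" "r\<^sup>2 \<le> 1 + r\<^sup>2"
proof -
  have "0 \<le> (r - 1)\<^sup>2 + r\<^sup>2 + 1" by simp
  then show "r \<le> 1 + r\<^sup>2" by (simp add: power2_eq_square algebra_simps)
qed auto

context
  fixes s :: real and g :: "'a::euclidean_space \<Rightarrow> complex"
  assumes s: "s > real DIM('a) / 2 + 2" and g: "sq_int lborel (jw s) g"
begin

lemma weighted_measurable [measurable]: "g \<in> borel_measurable borel"
  using g unfolding sq_int_def by simp

lemma weighted_integrable: "integrable lborel g"
proof (rule weighted_dominated_integrable[OF s g])
  show "norm (g \<xi>) \<le> (1 + (norm \<xi>)\<^sup>2) * cmod (g \<xi>)" for \<xi>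
    using mult_right_mono[OF one_plus_sq_ge(1), of "cmod (g \<xi>)" "norm \<xi>"] by simp
qed measurable

lemma weighted_integrable_norm: "integrable lborel (\<lambda>\<xi>. norm \<xi> * cmod (g \<xi>))"
  by (rule weighted_dominated_integrable[OF s g])
     (auto simp: one_plus_sq_ge mult_right_mono)

lemma weighted_integrable_deriv: "norm v = 1 \<Longrightarrow> integrable lborel (\<lambda>\<xi>. \<i> * of_real (v \<bullet> \<xi>) * g \<xi>)"
proof (rule weighted_dominated_integrable[OF s g])
  fix \<xi> assume "norm v = 1"
  then have "\<bar>v \<bullet> \<xi>\<bar> \<le> 1 + (norm \<xi>)\<^sup>2" 
    using Cauchy_Schwarz_ineq2[of v \<xi>] one_plus_sq_ge(2)[of "norm \<xi>"] by simp
  then show "norm (\<i> * of_real (v \<bullet> \<xi>) * g \<xi>) \<le> (1 + (norm \<xi>)\<^sup>2) * cmod (g \<xi>)"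
    by (simp add: norm_mult mult_right_mono)
qed measurable

lemma weighted_integrable_deriv_norm:
  "norm v = 1 \<Longrightarrow> integrable lborel (\<lambda>\<xi>. norm \<xi> * cmod (\<i> * of_real (v \<bullet> \<xi>) * g \<xi>))"
proof (rule weighted_dominated_integrable[OF s g])
  fix \<xi> assume v: "norm v = 1"
  have "norm \<xi> * \<bar>v \<bullet> \<xi>\<bar> \<le> norm \<xi> * norm \<xi>"
    using Cauchy_Schwarz_ineq2[of v \<xi>] v by (intro mult_left_mono) auto
  then have "norm \<xi> * \<bar>v \<bullet> \<xi>\<bar> \<le> 1 + (norm \<xi>)\<^sup>2" by (simp add: power2_eq_square)
  then show "norm (norm \<xi> * cmod (\<i> * of_real (v \<bullet> \<xi>) * g \<xi>)) \<le> (1 + (norm \<xi>)\<^sup>2) * cmod (g \<xi>)"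
    by (simp add: norm_mult mult_right_mono mult.assoc[symmetric])
qed measurable

lemma weighted_integrable_deriv2:
  "norm v = 1 \<Longrightarrow> integrable lborel (\<lambda>\<xi>. \<i> * of_real (v \<bullet> \<xi>) * (\<i> * of_real (v \<bullet> \<xi>) * g \<xi>))"
proof (rule weighted_dominated_integrable[OF s g])
  fix \<xi> assume v: "norm v = 1"
  have "\<bar>v \<bullet> \<xi>\<bar> * \<bar>v \<bullet> \<xi>\<bar> \<le> norm \<xi> * norm \<xi>"
    using Cauchy_Schwarz_ineq2[of v \<xi>] v by (intro mult_mono) auto
  then have "\<bar>v \<bullet> \<xi>\<bar> * \<bar>v \<bullet> \<xi>\<bar> \<le> 1 + (norm \<xi>)\<^sup>2" by (simp add: power2_eq_square)
  then show "norm (\<i> * of_real (v \<bullet> \<xi>) * (\<i> * of_real (v \<bullet> \<xi>) * g \<xi>)) \<le> (1 + (norm \<xi>)\<^sup>2) * cmod (g \<xi>)"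
    by (simp add: norm_mult mult_right_mono mult.assoc[symmetric])
qed measurable

lemma weighted_integrable_laplacian: "integrable lborel (\<lambda>\<xi>. - of_real ((norm \<xi>)\<^sup>2) * g \<xi>)"
  by (rule weighted_dominated_integrable[OF s g])
     (auto simp: norm_mult norm_power intro!: mult_right_mono)

end

text \<open>Since \<open>\<Omega>\<close> is open, \<open>u\<close> agrees with the integral near
  \<open>x\<close>, so both have the same directional derivative. Agreement is asked for on
  \<open>\<Omega>\<close> only, so that the lemma applies again to \<open>partial_deriv b u\<close>,
  whose values are known just there.\<close>

lemma partial_deriv_inverse_fourier:
  fixes g :: "'a::euclidean_space \<Rightarrow> complex"
  assumes "open \<Omega>" "x \<in> \<Omega>" and u: "\<And>y. y \<in> \<Omega> \<Longrightarrow> u y = inverse_fourier g y"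
    and "integrable lborel g" "integrable lborel (\<lambda>\<xi>. norm \<xi> * cmod (g \<xi>))"
  shows "partial_deriv b u x = inverse_fourier (\<lambda>\<xi>. \<i> * of_real (b \<bullet> \<xi>) * g \<xi>) x"
  unfolding partial_deriv_def
proof (rule vector_derivative_at)
  have "((\<lambda>t. x + t *\<^sub>R b) \<longlongrightarrow> x + 0 *\<^sub>R b) (nhds 0)"
    by (intro tendsto_intros filterlim_ident)
  then have "\<forall>\<^sub>F t in nhds 0. x + t *\<^sub>R b \<in> \<Omega>"
    by (rule topological_tendstoD) (use assms(1,2) in simp_all)
  then have ev: "\<forall>\<^sub>F t in nhds 0. t \<in> UNIV \<longrightarrow> u (x + t *\<^sub>R b) = inverse_fourier g (x + t *\<^sub>R b)"
    by (rule eventually_mono) (simp add: u)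
  show "((\<lambda>t. u (x + t *\<^sub>R b)) has_vector_derivative inverse_fourier (\<lambda>\<xi>. \<i> * of_real (b \<bullet> \<xi>) * g \<xi>) x) (at 0)"
    using has_vector_derivative_inverse_fourier[OF assms(4,5), of x b] has_vector_derivative_cong_ev[OF ev]
    by (simp add: u assms(2))
qed

lemma laplacian_inverse_fourier:
  fixes g :: "'a::euclidean_space \<Rightarrow> complex"
  assumes s: "s > real DIM('a) / 2 + 2" and g: "sq_int lborel (jw s) g"
    and \<Omega>: "open \<Omega>" "x \<in> \<Omega>" and u: "\<And>y. y \<in> \<Omega> \<Longrightarrow> u y = inverse_fourier g y"
  shows "laplacian u x = inverse_fourier (\<lambda>\<xi>. - of_real ((norm \<xi>)\<^sup>2) * g \<xi>) x"
proof -
  have "laplacian u x = (\<Sum>b\<in>Basis. inverse_fourier (\<lambda>\<xi>. \<i> * of_real (b \<bullet> \<xi>) * (\<i> * of_real (b \<bullet> \<xi>) * g \<xi>)) x)"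
    unfolding laplacian_def
  proof (rule sum.cong[OF refl])
    fix b :: 'a assume b: "b \<in> Basis"
    have "partial_deriv b u y = inverse_fourier (\<lambda>\<xi>. \<i> * of_real (b \<bullet> \<xi>) * g \<xi>) y" if "y \<in> \<Omega>" for y
      using \<Omega>(1) that u weighted_integrable[OF s g] weighted_integrable_norm[OF s g] by (rule partial_deriv_inverse_fourier)
    then show "partial_deriv b (partial_deriv b u) x = inverse_fourier (\<lambda>\<xi>. \<i> * of_real (b \<bullet> \<xi>) * (\<i> * of_real (b \<bullet> \<xi>) * g \<xi>)) x"
      by (intro partial_deriv_inverse_fourier[OF \<Omega>] weighted_integrable_deriv[OF s g] weighted_integrable_deriv_norm[OF s g] norm_Basis b)
  qed
  also have "\<dots> = inverse_fourier (\<lambda>\<xi>. \<Sum>b\<in>Basis. \<i> * of_real (b \<bullet> \<xi>) * (\<i> * of_real (b \<bullet> \<xi>) * g \<xi>)) x"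
    by (subst inverse_fourier_sum) (auto intro: weighted_integrable_deriv2[OF s g])
  also have "(\<lambda>\<xi>. \<Sum>b\<in>Basis. \<i> * of_real (b \<bullet> \<xi>) * (\<i> * of_real (b \<bullet> \<xi>) * g \<xi>)) = (\<lambda>\<xi>. - of_real ((norm \<xi>)\<^sup>2) * g \<xi>)"
  proof
    fix \<xi> :: 'a
    have "(norm \<xi>)\<^sup>2 = (\<Sum>b\<in>Basis. (b \<bullet> \<xi>) * (b \<bullet> \<xi>))"
      unfolding power2_norm_eq_inner euclidean_inner[of \<xi> \<xi>] by (simp add: inner_commute)
    then have "complex_of_real ((norm \<xi>)\<^sup>2) = (\<Sum>b\<in>Basis. of_real (b \<bullet> \<xi>) * of_real (b \<bullet> \<xi>))"
      by simp
    then have "- of_real ((norm \<xi>)\<^sup>2) * g \<xi> = (\<Sum>b\<in>Basis. - (of_real (b \<bullet> \<xi>) * of_real (b \<bullet> \<xi>)) * g \<xi>)"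
      by (simp only: mult_minus_left sum_negf sum_distrib_right)
    then show "(\<Sum>b\<in>Basis. \<i> * of_real (b \<bullet> \<xi>) * (\<i> * of_real (b \<bullet> \<xi>) * g \<xi>)) = - of_real ((norm \<xi>)\<^sup>2) * g \<xi>"
      by (simp add: algebra_simps)
  qed
  finally show ?thesis .
qed

text \<open>The normal derivative looks only at the points \<open>x - t \<nu>\<close> with
  \<open>t >= 0\<close>. For small \<open>t > 0\<close> they lie in \<open>\<Omega>\<close> because
  \<open>\<nu>\<close> is outward, so \<open>u\<close> may be replaced by the integral, which is
  differentiable from both sides.\<close>

lemma normal_deriv_inverse_fourier:
  fixes g :: "'a::euclidean_space \<Rightarrow> complex"
  assumes s: "s > real DIM('a) / 2 + 2" and g: "sq_int lborel (jw s) g"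
    and \<nu>: "outward_unit_normal \<Omega> \<nu>" and x: "x \<in> frontier \<Omega>"
    and u: "\<And>y. y \<in> closure \<Omega> \<Longrightarrow> u y = inverse_fourier g y"
  shows "normal_deriv \<nu> u x = inverse_fourier (\<lambda>\<xi>. \<i> * of_real (\<nu> x \<bullet> \<xi>) * g \<xi>) x"
proof -
  let ?D = "inverse_fourier (\<lambda>\<xi>. \<i> * of_real (- \<nu> x \<bullet> \<xi>) * g \<xi>) x"
  have xc: "x \<in> closure \<Omega>" using x by (simp add: frontier_def)
  have "\<forall>\<^sub>F t in at_right 0. x - t *\<^sub>R \<nu> x \<in> \<Omega> \<and> x + t *\<^sub>R \<nu> x \<notin> closure \<Omega>"
    using \<nu> x unfolding outward_unit_normal_def by blast
  then have "\<forall>\<^sub>F t in at_right 0. x - t *\<^sub>R \<nu> x \<in> \<Omega>"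
    by (rule eventually_mono) blast
  then have "\<forall>\<^sub>F t in nhds 0. t \<noteq> 0 \<longrightarrow> t \<in> {0<..} \<longrightarrow> x - t *\<^sub>R \<nu> x \<in> \<Omega>"
    unfolding eventually_at_filter .
  then have ev: "\<forall>\<^sub>F t in nhds 0. t \<in> {0..} \<longrightarrow> u (x - t *\<^sub>R \<nu> x) = inverse_fourier g (x + t *\<^sub>R (- \<nu> x))"
  proof (rule eventually_mono)
    fix t :: real assume t: "t \<noteq> 0 \<longrightarrow> t \<in> {0<..} \<longrightarrow> x - t *\<^sub>R \<nu> x \<in> \<Omega>"
    show "t \<in> {0..} \<longrightarrow> u (x - t *\<^sub>R \<nu> x) = inverse_fourier g (x + t *\<^sub>R (- \<nu> x))"
    proof
      assume "t \<in> {0..}"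
      then have "t = 0 \<or> x - t *\<^sub>R \<nu> x \<in> \<Omega>" using t by fastforce
      then have "x - t *\<^sub>R \<nu> x \<in> closure \<Omega>" using xc closure_subset[of \<Omega>] by (metis diff_zero scaleR_zero_left subsetD)
      then show "u (x - t *\<^sub>R \<nu> x) = inverse_fourier g (x + t *\<^sub>R (- \<nu> x))" by (simp add: u)
    qed
  qed
  have at0: "u (x - 0 *\<^sub>R \<nu> x) = inverse_fourier g (x + 0 *\<^sub>R (- \<nu> x))" by (simp add: u xc)
  have "((\<lambda>t. inverse_fourier g (x + t *\<^sub>R (- \<nu> x))) has_vector_derivative ?D) (at 0 within {0..})"
    by (rule has_vector_derivative_at_within[OF has_vector_derivative_inverse_fourier[OF weighted_integrable[OF s g]
       weighted_integrable_norm[OF s g]]])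
  then have "((\<lambda>t. u (x - t *\<^sub>R \<nu> x)) has_vector_derivative ?D) (at 0 within {0..})"
    unfolding has_vector_derivative_cong_ev[OF ev at0] .
  \<comment> \<open>Here \<open>at 0 within {0..}\<close> is the right-hand filter; it is
    nontrivial, which makes the derivative unique.\<close>
  then have "vector_derivative (\<lambda>t. u (x - t *\<^sub>R \<nu> x)) (at 0 within {0..}) = ?D"
    by (intro vector_derivative_within) (simp_all add: at_within_Ici_at_right)
  moreover have "- ?D = inverse_fourier (\<lambda>\<xi>. \<i> * of_real (\<nu> x \<bullet> \<xi>) * g \<xi>) x"
  proof -
    have "(\<lambda>\<xi>. cis (x \<bullet> \<xi>) * (\<i> * of_real (- \<nu> x \<bullet> \<xi>) * g \<xi>)) = (\<lambda>\<xi>. - (cis (x \<bullet> \<xi>) * (\<i> * of_real (\<nu> x \<bullet> \<xi>) * g \<xi>)))"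
      by (simp add: fun_eq_iff)
    then show ?thesis unfolding inverse_fourier_def by simp
  qed
  ultimately show ?thesis
    unfolding normal_deriv_def by (rule trans[OF arg_cong[where f = uminus]])
qed

section \<open>The Sobolev norm\<close>

abbreviation "jint s \<equiv> sq_int lborel (jw s)"
abbreviation "jsq s \<equiv> sqn lborel (jw s)"

lemma Hs_lifts_iff:
  "g \<in> Hs_lifts s \<Omega> u \<longleftrightarrow> jint s g \<and> (\<forall>x\<in>closure \<Omega>. u x = inverse_fourier g x)"
  unfolding Hs_lifts_def by (simp add: Hs_weighted_iff)

lemma Hs_norm_eq: "Hs_norm s \<Omega> u = (INF g\<in>Hs_lifts s \<Omega> u. sqrt (jsq s g))"
  unfolding Hs_norm_def sqn_def jw_def ..

lemma sqn_jw_nonneg: "jsq s g \<ge> 0"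
  by (intro sqn_nonneg jw_nonneg)

lemma Hs_norm_le_lift:
  assumes "g \<in> Hs_lifts s \<Omega> u"
  shows "Hs_norm s \<Omega> u \<le> sqrt (jsq s g)"
  unfolding Hs_norm_eq using assms by (intro cINF_lower bdd_belowI[of _ 0]) (auto simp: sqn_jw_nonneg)

text \<open>Transfers a bound valid for every lift to the quotient norm; membership of
  \<open>u\<close> in the space keeps the infimum from being taken over the empty set.\<close>

lemma Hs_norm_greatest:
  assumes u: "u \<in> Hs_space s \<Omega>" and "K \<ge> 0"
    and B: "\<And>g. g \<in> Hs_lifts s \<Omega> u \<Longrightarrow> B \<le> K * sqrt (jsq s g)"
  shows "B \<le> K * Hs_norm s \<Omega> u"
proof (cases "K = 0")
  case True
  then show ?thesis using u B unfolding Hs_space_def by auto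
next
  case False
  then have "K > 0" using \<open>K \<ge> 0\<close> by simp
  have "B / K \<le> Hs_norm s \<Omega> u"
    unfolding Hs_norm_eq using u B \<open>K > 0\<close> unfolding Hs_space_def
    by (intro cINF_greatest) (auto simp: field_simps)
  then show ?thesis using \<open>K > 0\<close> by (simp add: field_simps)
qed

lemma Hs_norm_nonneg: "u \<in> Hs_space s \<Omega> \<Longrightarrow> Hs_norm s \<Omega> u \<ge> 0"
  using Hs_norm_greatest[of u s \<Omega> 1 0] by (simp add: sqn_jw_nonneg)

lemma Hs_lift_approx:
  assumes u: "u \<in> Hs_space s \<Omega>" and "\<eta> > 0"
  obtains g where "g \<in> Hs_lifts s \<Omega> u" "sqrt (jsq s g) < Hs_norm s \<Omega> u + \<eta>"
proof -
  have "Hs_norm s \<Omega> u < Hs_norm s \<Omega> u + \<eta>" using \<open>\<eta> > 0\<close> by simp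
  then have "\<exists>g\<in>Hs_lifts s \<Omega> u. sqrt (jsq s g) < Hs_norm s \<Omega> u + \<eta>"
    using u unfolding Hs_norm_eq Hs_space_def
    by (subst (asm) cINF_less_iff) (auto intro!: bdd_belowI[of _ 0] simp: sqn_jw_nonneg)
  then show ?thesis using that by blast
qed

lemma Hs_lift_approx_sq:
  assumes u: "u \<in> Hs_space s \<Omega>" and \<eta>: "\<eta> > 0"
  obtains g where "g \<in> Hs_lifts s \<Omega> u" "jsq s g \<le> (Hs_norm s \<Omega> u)\<^sup>2 + \<eta>"
proof -
  define h where "h = Hs_norm s \<Omega> u"
  have h: "h \<ge> 0" using Hs_norm_nonneg[OF u] by (simp add: h_def)
  \<comment> \<open>Chosen so that \<open>(h + \<theta>)^2 = h^2 + \<eta>\<close>.\<close>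
  define \<theta> where "\<theta> = sqrt (h\<^sup>2 + \<eta>) - h"
  have "h < sqrt (h\<^sup>2 + \<eta>)" using \<eta> h by (intro real_less_rsqrt) simp
  then have "\<theta> > 0" by (simp add: \<theta>_def)
  then obtain g where g: "g \<in> Hs_lifts s \<Omega> u" "sqrt (jsq s g) < h + \<theta>"
    using Hs_lift_approx[OF u] unfolding h_def by blast
  then have "jsq s g \<le> h\<^sup>2 + \<eta>" by (simp add: \<theta>_def)
  with g(1) show ?thesis using that by (simp add: h_def)
qed

lemma Hs_lifts_lincomb:
  fixes u v :: "'a::euclidean_space \<Rightarrow> complex"
  assumes s: "s > real DIM('a) / 2 + 2" and "g \<in> Hs_lifts s \<Omega> u" "h \<in> Hs_lifts s \<Omega> v"
  shows "(\<lambda>\<xi>. a * g \<xi> + b * h \<xi>) \<in> Hs_lifts s \<Omega> (\<lambda>x. a * u x + b * v x)"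
  using assms weighted_integrable[OF s, of g] weighted_integrable[OF s, of h] unfolding Hs_lifts_iff
  by (auto intro!: sq_int_lincomb jw_nonneg simp: inverse_fourier_lincomb)

lemma Hs_space_lincomb:
  fixes u v :: "'a::euclidean_space \<Rightarrow> complex"
  assumes s: "s > real DIM('a) / 2 + 2" and u: "u \<in> Hs_space s \<Omega>" and v: "v \<in> Hs_space s \<Omega>"
  shows "(\<lambda>x. a * u x + b * v x) \<in> Hs_space s \<Omega>"
proof -
  obtain g h where "g \<in> Hs_lifts s \<Omega> u" "h \<in> Hs_lifts s \<Omega> v" using u v unfolding Hs_space_def by auto
  from Hs_lifts_lincomb[OF s this, of a b] have "Hs_lifts s \<Omega> (\<lambda>x. a * u x + b * v x) \<noteq> {}" by blast
  then show ?thesis using u v unfolding Hs_space_def by simp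
qed

lemma Hs_space_add: "\<lbrakk>s > real DIM('a) / 2 + 2; u \<in> Hs_space s \<Omega>; v \<in> Hs_space s \<Omega>\<rbrakk> \<Longrightarrow> (\<lambda>x. u x + v x) \<in> Hs_space s (\<Omega> :: 'a::euclidean_space set)"
  using Hs_space_lincomb[of s u \<Omega> v 1 1] by simp

lemma Hs_space_diff: "\<lbrakk>s > real DIM('a) / 2 + 2; u \<in> Hs_space s \<Omega>; v \<in> Hs_space s \<Omega>\<rbrakk> \<Longrightarrow> (\<lambda>x. u x - v x) \<in> Hs_space s (\<Omega> :: 'a::euclidean_space set)"
  using Hs_space_lincomb[of s u \<Omega> v 1 "-1"] by simp

lemma Hs_norm_scale_le:
  fixes u :: "'a::euclidean_space \<Rightarrow> complex"
  assumes s: "s > real DIM('a) / 2 + 2" and u: "u \<in> Hs_space s \<Omega>"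
  shows "Hs_norm s \<Omega> (\<lambda>x. c * u x) \<le> cmod c * Hs_norm s \<Omega> u"
proof (rule Hs_norm_greatest[OF u])
  fix g assume g: "g \<in> Hs_lifts s \<Omega> u"
  have "(\<lambda>\<xi>. c * g \<xi>) \<in> Hs_lifts s \<Omega> (\<lambda>x. c * u x)" using Hs_lifts_lincomb[OF s g g, of c 0] by simp
  from Hs_norm_le_lift[OF this] show "Hs_norm s \<Omega> (\<lambda>x. c * u x) \<le> cmod c * sqrt (jsq s g)"
    by (simp add: sqn_scale real_sqrt_mult)
qed simp

text \<open>Almost optimal lifts of the summands add up to a lift of the sum, which competes in the
  infimum on the left.\<close>

lemma Hs_norm_weak_triangle:
  fixes u v :: "'a::euclidean_space \<Rightarrow> complex"
  assumes s: "s > real DIM('a) / 2 + 2" and u: "u \<in> Hs_space s \<Omega>" and v: "v \<in> Hs_space s \<Omega>" and \<delta>: "\<delta> > 0"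
  shows "(Hs_norm s \<Omega> (\<lambda>x. u x + v x))\<^sup>2 \<le> (1 + \<delta>) * (Hs_norm s \<Omega> u)\<^sup>2 + (1 + 1 / \<delta>) * (Hs_norm s \<Omega> v)\<^sup>2"
proof (rule field_le_epsilon)
  fix \<eta> :: real assume "\<eta> > 0"
  \<comment> \<open>The tolerance granted to each lift: multiplied by the two factors and added, it
    gives \<open>\<eta>\<close>.\<close>
  define \<kappa> where "\<kappa> = \<eta> / ((1 + \<delta>) + (1 + 1 / \<delta>))"
  have pos: "(1 + \<delta>) + (1 + 1 / \<delta>) > 0" using \<delta> by (simp add: add_pos_pos)
  have "\<kappa> > 0" using \<open>\<eta> > 0\<close> pos by (simp add: \<kappa>_def)
  then obtain g h where g: "g \<in> Hs_lifts s \<Omega> u" "jsq s g \<le> (Hs_norm s \<Omega> u)\<^sup>2 + \<kappa>"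
    and h: "h \<in> Hs_lifts s \<Omega> v" "jsq s h \<le> (Hs_norm s \<Omega> v)\<^sup>2 + \<kappa>"
    using Hs_lift_approx_sq[OF u] Hs_lift_approx_sq[OF v] by metis
  have lift: "(\<lambda>\<xi>. g \<xi> + h \<xi>) \<in> Hs_lifts s \<Omega> (\<lambda>x. u x + v x)"
    using Hs_lifts_lincomb[OF s g(1) h(1), of 1 1] by simp
  have "(Hs_norm s \<Omega> (\<lambda>x. u x + v x))\<^sup>2 \<le> jsq s (\<lambda>\<xi>. g \<xi> + h \<xi>)"
    using power_mono[OF Hs_norm_le_lift[OF lift] Hs_norm_nonneg[OF Hs_space_add[OF s u v]], of 2]
    by (simp add: sqn_jw_nonneg)
  also have "\<dots> \<le> (1 + \<delta>) * jsq s g + (1 + 1 / \<delta>) * jsq s h"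
    using g(1) h(1) \<delta> unfolding Hs_lifts_iff by (intro sqn_weak_triangle jw_nonneg) auto
  also have "\<dots> \<le> (1 + \<delta>) * ((Hs_norm s \<Omega> u)\<^sup>2 + \<kappa>) + (1 + 1 / \<delta>) * ((Hs_norm s \<Omega> v)\<^sup>2 + \<kappa>)"
    using g(2) h(2) \<delta> by (intro add_mono mult_left_mono) auto
  also have "\<dots> = (1 + \<delta>) * (Hs_norm s \<Omega> u)\<^sup>2 + (1 + 1 / \<delta>) * (Hs_norm s \<Omega> v)\<^sup>2 + \<kappa> * ((1 + \<delta>) + (1 + 1 / \<delta>))"
    by (simp add: algebra_simps)
  also have "\<kappa> * ((1 + \<delta>) + (1 + 1 / \<delta>)) = \<eta>" using pos unfolding \<kappa>_def by simp
  finally show "(Hs_norm s \<Omega> (\<lambda>x. u x + v x))\<^sup>2 \<le> (1 + \<delta>) * (Hs_norm s \<Omega> u)\<^sup>2 + (1 + 1 / \<delta>) * (Hs_norm s \<Omega> v)\<^sup>2 + \<eta>" .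
qed

text \<open>Sum and difference of almost optimal lifts compete in the infima on the left, so the
  parallelogram law of the weighted \<open>L^2\<close> space descends to the quotient norm as an
  inequality, in the direction that strong convexity needs.\<close>

lemma Hs_norm_parallelogram:
  fixes u v :: "'a::euclidean_space \<Rightarrow> complex"
  assumes s: "s > real DIM('a) / 2 + 2" and u: "u \<in> Hs_space s \<Omega>" and v: "v \<in> Hs_space s \<Omega>"
  shows "(Hs_norm s \<Omega> (\<lambda>x. u x + v x))\<^sup>2 + (Hs_norm s \<Omega> (\<lambda>x. u x - v x))\<^sup>2
     \<le> 2 * (Hs_norm s \<Omega> u)\<^sup>2 + 2 * (Hs_norm s \<Omega> v)\<^sup>2"
proof (rule field_le_epsilon)
  fix \<eta> :: real assume "\<eta> > 0"
  then have "\<eta> / 4 > 0" by simp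
  then obtain g h where g: "g \<in> Hs_lifts s \<Omega> u" "jsq s g \<le> (Hs_norm s \<Omega> u)\<^sup>2 + \<eta> / 4"
    and h: "h \<in> Hs_lifts s \<Omega> v" "jsq s h \<le> (Hs_norm s \<Omega> v)\<^sup>2 + \<eta> / 4"
    using Hs_lift_approx_sq[OF u] Hs_lift_approx_sq[OF v] by metis
  have lift: "(\<lambda>\<xi>. g \<xi> + h \<xi>) \<in> Hs_lifts s \<Omega> (\<lambda>x. u x + v x)" "(\<lambda>\<xi>. g \<xi> - h \<xi>) \<in> Hs_lifts s \<Omega> (\<lambda>x. u x - v x)"
    using Hs_lifts_lincomb[OF s g(1) h(1), of 1 1] Hs_lifts_lincomb[OF s g(1) h(1), of 1 "-1"] by simp_all
  have "(Hs_norm s \<Omega> (\<lambda>x. u x + v x))\<^sup>2 \<le> jsq s (\<lambda>\<xi>. g \<xi> + h \<xi>)"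
    using power_mono[OF Hs_norm_le_lift[OF lift(1)] Hs_norm_nonneg[OF Hs_space_add[OF s u v]], of 2]
    by (simp add: sqn_jw_nonneg)
  moreover have "(Hs_norm s \<Omega> (\<lambda>x. u x - v x))\<^sup>2 \<le> jsq s (\<lambda>\<xi>. g \<xi> - h \<xi>)"
    using power_mono[OF Hs_norm_le_lift[OF lift(2)] Hs_norm_nonneg[OF Hs_space_diff[OF s u v]], of 2]
    by (simp add: sqn_jw_nonneg)
  moreover have "jsq s (\<lambda>\<xi>. g \<xi> + h \<xi>) + jsq s (\<lambda>\<xi>. g \<xi> - h \<xi>) = 2 * jsq s g + 2 * jsq s h"
    using g(1) h(1) unfolding Hs_lifts_iff by (intro sqn_parallelogram jw_nonneg) auto
  ultimately show "(Hs_norm s \<Omega> (\<lambda>x. u x + v x))\<^sup>2 + (Hs_norm s \<Omega> (\<lambda>x. u x - v x))\<^sup>2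
     \<le> 2 * (Hs_norm s \<Omega> u)\<^sup>2 + 2 * (Hs_norm s \<Omega> v)\<^sup>2 + \<eta>"
    using g(2) h(2) by linarith
qed

lemma Hs_norm_minus_commute:
  fixes u v :: "'a::euclidean_space \<Rightarrow> complex"
  assumes s: "s > real DIM('a) / 2 + 2" and u: "u \<in> Hs_space s \<Omega>" and v: "v \<in> Hs_space s \<Omega>"
  shows "Hs_norm s \<Omega> (\<lambda>x. u x - v x) = Hs_norm s \<Omega> (\<lambda>x. v x - u x)"
  using Hs_norm_scale_le[OF s Hs_space_diff[OF s u v], of "-1"] Hs_norm_scale_le[OF s Hs_space_diff[OF s v u], of "-1"]
  by simp

text \<open>Uniform convexity of the squared norm. The quarter of the squared distance is the gain
  that later makes minimizing sequences Cauchy and minimizers unique.\<close>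

lemma Hs_norm_midpoint:
  fixes u v :: "'a::euclidean_space \<Rightarrow> complex"
  assumes s: "s > real DIM('a) / 2 + 2" and u: "u \<in> Hs_space s \<Omega>" and v: "v \<in> Hs_space s \<Omega>"
  shows "(Hs_norm s \<Omega> (\<lambda>x. (u x + v x) / 2))\<^sup>2 + (Hs_norm s \<Omega> (\<lambda>x. u x - v x))\<^sup>2 / 4
     \<le> ((Hs_norm s \<Omega> u)\<^sup>2 + (Hs_norm s \<Omega> v)\<^sup>2) / 2"
proof -
  note uv = Hs_space_add[OF s u v]
  have mid: "(\<lambda>x. (u x + v x) / 2) \<in> Hs_space s \<Omega>"
    using Hs_space_lincomb[OF s u v, of "1/2" "1/2"] by (simp add: add_divide_distrib)
  have "Hs_norm s \<Omega> (\<lambda>x. (u x + v x) / 2) \<le> Hs_norm s \<Omega> (\<lambda>x. u x + v x) / 2"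
    using Hs_norm_scale_le[OF s uv, of "1/2"] by simp
  then have "(Hs_norm s \<Omega> (\<lambda>x. (u x + v x) / 2))\<^sup>2 \<le> (Hs_norm s \<Omega> (\<lambda>x. u x + v x) / 2)\<^sup>2"
    using Hs_norm_nonneg[OF mid] by (intro power_mono)
  then show ?thesis using Hs_norm_parallelogram[OF s u v] by (simp add: power_divide)
qed

section \<open>Sobolev embedding: pointwise bounds, linearity, continuity, completeness\<close>

lemma Hs_norm_sup_bounds:
  fixes \<Omega> :: "'a::euclidean_space set"
  assumes s: "s > real DIM('a) / 2 + 2"
  obtains K where "K \<ge> 0"
    "\<And>u x. \<lbrakk>u \<in> Hs_space s \<Omega>; x \<in> closure \<Omega>\<rbrakk> \<Longrightarrow> cmod (u x) \<le> K * Hs_norm s \<Omega> u"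
    "\<And>u x. \<lbrakk>u \<in> Hs_space s \<Omega>; open \<Omega>; x \<in> \<Omega>\<rbrakk> \<Longrightarrow> cmod (laplacian u x) \<le> K * Hs_norm s \<Omega> u"
    "\<And>u \<nu> x. \<lbrakk>u \<in> Hs_space s \<Omega>; outward_unit_normal \<Omega> \<nu>; x \<in> frontier \<Omega>\<rbrakk> \<Longrightarrow> cmod (normal_deriv \<nu> u x) \<le> K * Hs_norm s \<Omega> u"
proof -
  \<comment> \<open>The constant of \<open>weighted_L1\<close>. It depends on \<open>s\<close> and
    the dimension only, and one \<open>K\<close> serves for values, Laplacian and normal derivative
    because all three multipliers are bounded by \<open>1 + |\<xi>|^2\<close>.\<close>
  define K where "K = ((LINT \<xi>|lborel. jw (2 - s) (\<xi>::'a)) + 1) / 2"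
  have "(LINT \<xi>|lborel. jw (2 - s) (\<xi>::'a)) \<ge> 0" by (intro integral_nonneg_AE) (auto simp: jw_nonneg)
  then have K: "K \<ge> 0" by (simp add: K_def)
  have main: "cmod (inverse_fourier k x) \<le> K * sqrt (jsq s g)"
    if g: "jint s g" and k: "integrable lborel k" and le: "\<And>\<xi>. cmod (k \<xi>) \<le> (1 + (norm \<xi>)\<^sup>2) * cmod (g \<xi>)"
    for g k and x :: 'a
  proof -
    have "cmod (inverse_fourier k x) \<le> (LINT \<xi>|lborel. cmod (k \<xi>))" by (rule norm_inverse_fourier_le[OF k])
    also have "\<dots> \<le> (LINT \<xi>|lborel. jw 1 \<xi> * cmod (g \<xi>))"
      using k le weighted_L1(1)[OF s g] by (intro integral_mono) (auto simp: jw_1)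
    also have "\<dots> \<le> K * sqrt (jsq s g)" unfolding K_def by (rule weighted_L1(2)[OF s g])
    finally show ?thesis .
  qed
  show ?thesis
  proof (rule that[OF K])
    fix u :: "'a \<Rightarrow> complex" and x assume u: "u \<in> Hs_space s \<Omega>" and x: "x \<in> closure \<Omega>"
    show "cmod (u x) \<le> K * Hs_norm s \<Omega> u"
    proof (rule Hs_norm_greatest[OF u K])
      fix g assume "g \<in> Hs_lifts s \<Omega> u"
      then have g: "jint s g" and ux: "u x = inverse_fourier g x" using x unfolding Hs_lifts_iff by auto
      show "cmod (u x) \<le> K * sqrt (jsq s g)"
        unfolding ux
      proof (rule main[OF g weighted_integrable[OF s g]])
        show "cmod (g \<xi>) \<le> (1 + (norm \<xi>)\<^sup>2) * cmod (g \<xi>)" for \<xi>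
          using mult_right_mono[OF one_plus_sq_ge(1), of "cmod (g \<xi>)" "norm \<xi>"] by simp
      qed
    qed
  next
    fix u :: "'a \<Rightarrow> complex" and x assume u: "u \<in> Hs_space s \<Omega>" and \<Omega>: "open \<Omega>" "x \<in> \<Omega>"
    show "cmod (laplacian u x) \<le> K * Hs_norm s \<Omega> u"
    proof (rule Hs_norm_greatest[OF u K])
      fix g assume "g \<in> Hs_lifts s \<Omega> u"
      then have g: "jint s g" and ux: "\<And>y. y \<in> \<Omega> \<Longrightarrow> u y = inverse_fourier g y"
        using closure_subset[of \<Omega>] unfolding Hs_lifts_iff by auto
      have eq: "laplacian u x = inverse_fourier (\<lambda>\<xi>. - of_real ((norm \<xi>)\<^sup>2) * g \<xi>) x"
        by (rule laplacian_inverse_fourier[OF s g \<Omega>]) (rule ux)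
      show "cmod (laplacian u x) \<le> K * sqrt (jsq s g)"
        unfolding eq
        by (rule main[OF g weighted_integrable_laplacian[OF s g]])
           (auto simp: norm_mult norm_power intro!: mult_right_mono)
    qed
  next
    fix u :: "'a \<Rightarrow> complex" and \<nu> x assume u: "u \<in> Hs_space s \<Omega>" and \<nu>: "outward_unit_normal \<Omega> \<nu>" "x \<in> frontier \<Omega>"
    have n1: "norm (\<nu> x) = 1" using \<nu> unfolding outward_unit_normal_def by auto
    show "cmod (normal_deriv \<nu> u x) \<le> K * Hs_norm s \<Omega> u"
    proof (rule Hs_norm_greatest[OF u K])
      fix g assume "g \<in> Hs_lifts s \<Omega> u"
      then have g: "jint s g" and ux: "\<And>y. y \<in> closure \<Omega> \<Longrightarrow> u y = inverse_fourier g y"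
        unfolding Hs_lifts_iff by auto
      have eq: "normal_deriv \<nu> u x = inverse_fourier (\<lambda>\<xi>. \<i> * of_real (\<nu> x \<bullet> \<xi>) * g \<xi>) x"
        by (rule normal_deriv_inverse_fourier[OF s g \<nu>]) (rule ux)
      show "cmod (normal_deriv \<nu> u x) \<le> K * sqrt (jsq s g)"
        unfolding eq
      proof (rule main[OF g weighted_integrable_deriv[OF s g n1]])
        fix \<xi>
        have "\<bar>\<nu> x \<bullet> \<xi>\<bar> \<le> 1 + (norm \<xi>)\<^sup>2"
          using Cauchy_Schwarz_ineq2[of "\<nu> x" \<xi>] one_plus_sq_ge(2)[of "norm \<xi>"] n1 by simp
        then show "cmod (\<i> * of_real (\<nu> x \<bullet> \<xi>) * g \<xi>) \<le> (1 + (norm \<xi>)\<^sup>2) * cmod (g \<xi>)"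
          by (simp add: norm_mult mult_right_mono)
      qed
    qed
  qed
qed

text \<open>Linearity is not formal, since \<open>vector_derivative\<close> is unspecified where no
  derivative exists; it is read off from the multipliers applied to lifts of \<open>u\<close> and
  \<open>v\<close>.\<close>

lemma laplacian_lincomb:
  fixes \<Omega> :: "'a::euclidean_space set"
  assumes s: "s > real DIM('a) / 2 + 2" and u: "u \<in> Hs_space s \<Omega>" and v: "v \<in> Hs_space s \<Omega>"
    and \<Omega>: "open \<Omega>" "x \<in> \<Omega>"
  shows "laplacian (\<lambda>x. a * u x + b * v x) x = a * laplacian u x + b * laplacian v x"
proof -
  obtain g h where g: "g \<in> Hs_lifts s \<Omega> u" and h: "h \<in> Hs_lifts s \<Omega> v" using u v unfolding Hs_space_def by auto
  have \<Omega>c: "y \<in> closure \<Omega>" if "y \<in> \<Omega>" for y using that closure_subset[of \<Omega>] by auto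
  note lap = laplacian_inverse_fourier[OF s _ \<Omega>]
  let ?L = "\<lambda>g \<xi>. - of_real ((norm \<xi>)\<^sup>2) * g \<xi>"
  have "laplacian (\<lambda>x. a * u x + b * v x) x = inverse_fourier (?L (\<lambda>\<xi>. a * g \<xi> + b * h \<xi>)) x"
    using Hs_lifts_lincomb[OF s g h, of a b] \<Omega>c unfolding Hs_lifts_iff by (intro lap) auto
  also have "?L (\<lambda>\<xi>. a * g \<xi> + b * h \<xi>) = (\<lambda>\<xi>. a * ?L g \<xi> + b * ?L h \<xi>)" by (simp add: fun_eq_iff algebra_simps)
  also have "inverse_fourier (\<lambda>\<xi>. a * ?L g \<xi> + b * ?L h \<xi>) x = a * inverse_fourier (?L g) x + b * inverse_fourier (?L h) x"
    using g h unfolding Hs_lifts_iff by (intro inverse_fourier_lincomb weighted_integrable_laplacian[OF s]) auto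
  also have "inverse_fourier (?L g) x = laplacian u x"
    using g \<Omega>c unfolding Hs_lifts_iff by (intro lap[symmetric]) auto
  also have "inverse_fourier (?L h) x = laplacian v x"
    using h \<Omega>c unfolding Hs_lifts_iff by (intro lap[symmetric]) auto
  finally show ?thesis .
qed

lemma normal_deriv_lincomb:
  fixes \<Omega> :: "'a::euclidean_space set"
  assumes s: "s > real DIM('a) / 2 + 2" and u: "u \<in> Hs_space s \<Omega>" and v: "v \<in> Hs_space s \<Omega>"
    and \<nu>: "outward_unit_normal \<Omega> \<nu>" "x \<in> frontier \<Omega>"
  shows "normal_deriv \<nu> (\<lambda>x. a * u x + b * v x) x = a * normal_deriv \<nu> u x + b * normal_deriv \<nu> v x"
proof -
  obtain g h where g: "g \<in> Hs_lifts s \<Omega> u" and h: "h \<in> Hs_lifts s \<Omega> v" using u v unfolding Hs_space_def by auto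
  have n1: "norm (\<nu> x) = 1" using \<nu> unfolding outward_unit_normal_def by auto
  note nd = normal_deriv_inverse_fourier[OF s _ \<nu>]
  let ?L = "\<lambda>g \<xi>. \<i> * of_real (\<nu> x \<bullet> \<xi>) * g \<xi>"
  have "normal_deriv \<nu> (\<lambda>x. a * u x + b * v x) x = inverse_fourier (?L (\<lambda>\<xi>. a * g \<xi> + b * h \<xi>)) x"
    using Hs_lifts_lincomb[OF s g h, of a b] unfolding Hs_lifts_iff by (intro nd) auto
  also have "?L (\<lambda>\<xi>. a * g \<xi> + b * h \<xi>) = (\<lambda>\<xi>. a * ?L g \<xi> + b * ?L h \<xi>)" by (simp add: fun_eq_iff algebra_simps)
  also have "inverse_fourier (\<lambda>\<xi>. a * ?L g \<xi> + b * ?L h \<xi>) x = a * inverse_fourier (?L g) x + b * inverse_fourier (?L h) x"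
    using g h n1 unfolding Hs_lifts_iff by (intro inverse_fourier_lincomb weighted_integrable_deriv[OF s]) auto
  also have "inverse_fourier (?L g) x = normal_deriv \<nu> u x"
    using g unfolding Hs_lifts_iff by (intro nd[symmetric]) auto
  also have "inverse_fourier (?L h) x = normal_deriv \<nu> v x"
    using h unfolding Hs_lifts_iff by (intro nd[symmetric]) auto
  finally show ?thesis .
qed

lemma Hs_space_continuous:
  fixes \<Omega> :: "'a::euclidean_space set"
  assumes s: "s > real DIM('a) / 2 + 2" and u: "u \<in> Hs_space s \<Omega>"
  shows "continuous_on (closure \<Omega>) u"
    and "open \<Omega> \<Longrightarrow> continuous_on \<Omega> (laplacian u)"
    and "outward_unit_normal \<Omega> \<nu> \<Longrightarrow> continuous_on (frontier \<Omega>) (normal_deriv \<nu> u)"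
proof -
  obtain g where "g \<in> Hs_lifts s \<Omega> u" using u unfolding Hs_space_def by auto
  then have g: "jint s g" and ux: "\<And>x. x \<in> closure \<Omega> \<Longrightarrow> u x = inverse_fourier g x"
    unfolding Hs_lifts_iff by auto
  have \<Omega>c: "y \<in> closure \<Omega>" if "y \<in> \<Omega>" for y using that closure_subset[of \<Omega>] by auto
  have "continuous_on (closure \<Omega>) (inverse_fourier g)"
    by (rule continuous_inverse_fourier[OF weighted_integrable[OF s g]])
  then show "continuous_on (closure \<Omega>) u"
    by (rule continuous_on_eq) (simp add: ux)
  show "continuous_on \<Omega> (laplacian u)" if "open \<Omega>"
  proof (rule continuous_on_eq)
    show "continuous_on \<Omega> (inverse_fourier (\<lambda>\<xi>. - of_real ((norm \<xi>)\<^sup>2) * g \<xi>))"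
      by (rule continuous_inverse_fourier[OF weighted_integrable_laplacian[OF s g]])
    show "inverse_fourier (\<lambda>\<xi>. - of_real ((norm \<xi>)\<^sup>2) * g \<xi>) x = laplacian u x" if "x \<in> \<Omega>" for x
      by (rule laplacian_inverse_fourier[OF s g \<open>open \<Omega>\<close> that, symmetric]) (auto intro: ux \<Omega>c)
  qed
  show "continuous_on (frontier \<Omega>) (normal_deriv \<nu> u)" if \<nu>: "outward_unit_normal \<Omega> \<nu>"
  proof (rule continuous_on_eq)
    \<comment> \<open>The direction varies with \<open>x\<close>, so the normal derivative is
      expanded in coordinate derivatives: each is the inverse Fourier transform of a fixed function,
      and the coefficients \<open>\<nu> x \<bullet> b\<close> are continuous.\<close>
    let ?d = "\<lambda>b. inverse_fourier (\<lambda>\<xi>. \<i> * of_real (b \<bullet> \<xi>) * g \<xi>)"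
    have "continuous_on (frontier \<Omega>) \<nu>" using \<nu> unfolding outward_unit_normal_def by auto
    then show "continuous_on (frontier \<Omega>) (\<lambda>x. \<Sum>b\<in>Basis. of_real (\<nu> x \<bullet> b) * ?d b x)"
      by (intro continuous_intros continuous_inverse_fourier weighted_integrable_deriv[OF s g] norm_Basis)
    fix x assume x: "x \<in> frontier \<Omega>"
    have "normal_deriv \<nu> u x = inverse_fourier (\<lambda>\<xi>. \<i> * of_real (\<nu> x \<bullet> \<xi>) * g \<xi>) x"
      by (rule normal_deriv_inverse_fourier[OF s g \<nu> x ux])
    also have "(\<lambda>\<xi>. \<i> * of_real (\<nu> x \<bullet> \<xi>) * g \<xi>) = (\<lambda>\<xi>. \<Sum>b\<in>Basis. of_real (\<nu> x \<bullet> b) * (\<i> * of_real (b \<bullet> \<xi>) * g \<xi>))"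
      by (subst euclidean_inner) (simp add: inner_commute sum_distrib_left sum_distrib_right algebra_simps)
    also have "inverse_fourier \<dots> x = (\<Sum>b\<in>Basis. inverse_fourier (\<lambda>\<xi>. of_real (\<nu> x \<bullet> b) * (\<i> * of_real (b \<bullet> \<xi>) * g \<xi>)) x)"
      by (intro inverse_fourier_sum integrable_mult_right weighted_integrable_deriv[OF s g] norm_Basis)
    also have "\<dots> = (\<Sum>b\<in>Basis. of_real (\<nu> x \<bullet> b) * ?d b x)"
    proof (intro sum.cong refl)
      fix b :: 'a assume b: "b \<in> Basis"
      show "inverse_fourier (\<lambda>\<xi>. of_real (\<nu> x \<bullet> b) * (\<i> * of_real (b \<bullet> \<xi>) * g \<xi>)) x = of_real (\<nu> x \<bullet> b) * ?d b x"
        using inverse_fourier_lincomb[OF weighted_integrable_deriv[OF s g norm_Basis[OF b]] weighted_integrable_deriv[OF s g norm_Basis[OF b]], of "of_real (\<nu> x \<bullet> b)" 0]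
        by simp
    qed
    finally show "(\<Sum>b\<in>Basis. of_real (\<nu> x \<bullet> b) * ?d b x) = normal_deriv \<nu> u x" by simp
  qed
qed

text \<open>Lifts are not unique, so lifts of the \<open>u k\<close> need not be close to each
  other. Almost optimal lifts of the increments are summed instead: their partial sums lift the
  \<open>u k\<close> and are Cauchy in the weighted space. Geometric increments are the case that
  arises from minimizing sequences and from Picard iterates.\<close>

lemma Hs_space_complete:
  fixes u :: "nat \<Rightarrow> 'a::euclidean_space \<Rightarrow> complex"
  assumes s: "s > real DIM('a) / 2 + 2" and u: "\<And>k. u k \<in> Hs_space s \<Omega>"
    and \<theta>: "0 < \<theta>" "\<theta> < 1" and C: "C \<ge> 0"
    and step: "\<And>k. Hs_norm s \<Omega> (\<lambda>x. u (Suc k) x - u k x) \<le> C * \<theta> ^ k"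
  shows "\<exists>v\<in>Hs_space s \<Omega>. (\<lambda>k. Hs_norm s \<Omega> (\<lambda>x. u k x - v x)) \<longlonglongrightarrow> 0"
proof -
  let ?N = "\<lambda>g. sqrt (jsq s g)"
  obtain g0 where g0: "g0 \<in> Hs_lifts s \<Omega> (u 0)" using u[of 0] unfolding Hs_space_def by auto
  \<comment> \<open>The tolerance \<open>\<theta> ^ k\<close> keeps the norms of the chosen lifts
    geometric.\<close>
  have "\<exists>h. h \<in> Hs_lifts s \<Omega> (\<lambda>x. u (Suc k) x - u k x) \<and> ?N h < Hs_norm s \<Omega> (\<lambda>x. u (Suc k) x - u k x) + \<theta> ^ k" for k
    using Hs_lift_approx[OF Hs_space_diff[OF s u u], of "\<theta> ^ k"] \<theta> by (metis zero_less_power)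
  then obtain h where h: "\<And>k. h k \<in> Hs_lifts s \<Omega> (\<lambda>x. u (Suc k) x - u k x)"
    and h_lt: "\<And>k. ?N (h k) < Hs_norm s \<Omega> (\<lambda>x. u (Suc k) x - u k x) + \<theta> ^ k" by metis
  have hN: "?N (h k) \<le> (C + 1) * \<theta> ^ k" for k
    using h_lt[of k] step[of k] by (simp add: algebra_simps)
  have hsq: "jint s (h k)" for k using h unfolding Hs_lifts_iff by blast
  then have hm [measurable]: "h k \<in> borel_measurable borel" for k unfolding sq_int_def by simp
  have g0sq: "jint s g0" using g0 unfolding Hs_lifts_iff by blast
  then have g0m [measurable]: "g0 \<in> borel_measurable borel" unfolding sq_int_def by simp
  define G where "G n \<xi> = g0 \<xi> + (\<Sum>k<n. h k \<xi>)" for n \<xi>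
  have G: "G n \<in> Hs_lifts s \<Omega> (u n)" for n
  proof (induction n)
    case 0
    then show ?case using g0 by (simp add: G_def[abs_def])
  next
    case (Suc n)
    have "(\<lambda>\<xi>. 1 * G n \<xi> + 1 * h n \<xi>) \<in> Hs_lifts s \<Omega> (\<lambda>x. 1 * u n x + 1 * (u (Suc n) x - u n x))"
      by (rule Hs_lifts_lincomb[OF s Suc h])
    moreover have "G (Suc n) = (\<lambda>\<xi>. 1 * G n \<xi> + 1 * h n \<xi>)" by (simp add: G_def fun_eq_iff add.assoc)
    ultimately show ?case by simp
  qed
  \<comment> \<open>Where the series diverges the value is arbitrary; by \<open>ae\<close> below
    this concerns a null set.\<close>
  define Ginf where "Ginf \<xi> = g0 \<xi> + (\<Sum>k. h k \<xi>)" for \<xi>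
  have Gm [measurable]: "G n \<in> borel_measurable borel" for n unfolding G_def by measurable
  have Ginfm [measurable]: "Ginf \<in> borel_measurable borel" unfolding Ginf_def by measurable
  define K where "K = ((LINT \<xi>|lborel. jw (2 - s) (\<xi>::'a)) + 1) / 2"
  have "(LINT \<xi>|lborel. jw (2 - s) (\<xi>::'a)) \<ge> 0" by (intro integral_nonneg_AE) (auto simp: jw_nonneg)
  then have K: "K \<ge> 0" by (simp add: K_def)
  \<comment> \<open>By \<open>weighted_L1\<close> the \<open>L^1\<close> norms of the lifts are
    bounded by their weighted norms, hence summable; so the series converges absolutely almost
    everywhere.\<close>
  have ae: "AE \<xi> in lborel. summable (\<lambda>k. h k \<xi>)"
  proof -
    have "(\<integral>\<^sup>+\<xi>. (\<Sum>k. ennreal (cmod (h k \<xi>))) \<partial>lborel) = (\<Sum>k. \<integral>\<^sup>+\<xi>. ennreal (cmod (h k \<xi>)) \<partial>lborel)"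
      by (intro nn_integral_suminf) measurable
    also have "\<dots> \<le> (\<Sum>k. ennreal (K * (C + 1) * \<theta> ^ k))"
    proof (intro suminf_le summableI)
      fix k
      have "(\<integral>\<^sup>+\<xi>. ennreal (cmod (h k \<xi>)) \<partial>lborel) = ennreal (LINT \<xi>|lborel. cmod (h k \<xi>))"
        using weighted_integrable[OF s hsq] by (intro nn_integral_eq_integral) auto
      also have "(LINT \<xi>|lborel. cmod (h k \<xi>)) \<le> (LINT \<xi>|lborel. jw 1 \<xi> * cmod (h k \<xi>))"
      proof (intro integral_mono integrable_norm weighted_integrable[OF s hsq] weighted_L1(1)[OF s hsq])
        show "cmod (h k \<xi>) \<le> jw 1 \<xi> * cmod (h k \<xi>)" for \<xi>
          using mult_right_mono[OF one_plus_sq_ge(1), of "cmod (h k \<xi>)" "norm \<xi>"] by (simp add: jw_1)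
      qed
      also have "\<dots> \<le> K * ?N (h k)" unfolding K_def by (rule weighted_L1(2)[OF s hsq])
      also have "\<dots> \<le> K * ((C + 1) * \<theta> ^ k)" using hN K by (rule mult_left_mono)
      finally show "(\<integral>\<^sup>+\<xi>. ennreal (cmod (h k \<xi>)) \<partial>lborel) \<le> ennreal (K * (C + 1) * \<theta> ^ k)"
        by (simp add: mult.assoc ennreal_leI)
    qed
    also have "\<dots> < \<infinity>"
      using \<theta> K C by (subst suminf_ennreal2) (auto intro!: summable_mult summable_geometric)
    finally have "AE \<xi> in lborel. (\<Sum>k. ennreal (cmod (h k \<xi>))) \<noteq> \<infinity>"
      by (intro nn_integral_PInf_AE) auto
    then show ?thesis
    proof eventually_elim
      case (elim \<xi>)
      then have "summable (\<lambda>k. cmod (h k \<xi>))"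
        by (intro summable_suminf_not_top) auto
      then show ?case by (rule summable_norm_cancel)
    qed
  qed
  \<comment> \<open>The tail from \<open>m\<close> on of the geometric series that bounds the norms
    of the \<open>h k\<close>.\<close>
  define e where "e m = (C + 1) * \<theta> ^ m / (1 - \<theta>)" for m
  have e0: "e m \<ge> 0" for m using C \<theta> by (simp add: e_def)
  have diffG: "(\<lambda>\<xi>. G n \<xi> - G m \<xi>) = (\<lambda>\<xi>. \<Sum>k\<in>{m..<n}. h k \<xi>)" if "m \<le> n" for m n
  proof
    fix \<xi>
    have "(\<Sum>k<n. h k \<xi>) = (\<Sum>k<m. h k \<xi>) + (\<Sum>k\<in>{m..<n}. h k \<xi>)"
      using sum.atLeastLessThan_concat[of 0 m n "\<lambda>k. h k \<xi>"] that by (simp add: atLeast0LessThan)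
    then show "G n \<xi> - G m \<xi> = (\<Sum>k\<in>{m..<n}. h k \<xi>)" by (simp add: G_def)
  qed
  have cauchy: "jint s (\<lambda>\<xi>. G n \<xi> - G m \<xi>)" "?N (\<lambda>\<xi>. G n \<xi> - G m \<xi>) \<le> e m" if "m \<le> n" for m n
  proof -
    have T: "jint s (\<lambda>\<xi>. \<Sum>k\<in>{m..<n}. h k \<xi>) \<and> ?N (\<lambda>\<xi>. \<Sum>k\<in>{m..<n}. h k \<xi>) \<le> (\<Sum>k\<in>{m..<n}. ?N (h k))"
      by (rule sqn_sum_triangle) (auto simp: jw_nonneg hsq)
    have "(\<Sum>k\<in>{m..<n}. ?N (h k)) \<le> (\<Sum>k\<in>{m..<n}. (C + 1) * \<theta> ^ k)" by (intro sum_mono hN)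
    also have "\<dots> = (C + 1) * (\<Sum>k\<in>{m..<n}. \<theta> ^ k)" by (simp add: sum_distrib_left)
    also have "(\<Sum>k\<in>{m..<n}. \<theta> ^ k) = (\<theta> ^ m - \<theta> ^ n) / (1 - \<theta>)"
    proof -
      have "(1 - \<theta>) * (\<Sum>k\<in>{m..<n}. \<theta> ^ k) = \<theta> ^ m - \<theta> ^ n"
        using that
      proof (induction n rule: dec_induct)
        case (step n)
        then show ?case by (simp add: distrib_left) (simp add: algebra_simps)
      qed simp
      then show ?thesis using \<theta> by (simp add: field_simps)
    qed
    also have "\<dots> \<le> \<theta> ^ m / (1 - \<theta>)" using \<theta> by (intro divide_right_mono) auto
    finally have "(\<Sum>k\<in>{m..<n}. ?N (h k)) \<le> e m" using C unfolding e_def by (simp add: mult_left_mono)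
    then show "jint s (\<lambda>\<xi>. G n \<xi> - G m \<xi>)" "?N (\<lambda>\<xi>. G n \<xi> - G m \<xi>) \<le> e m"
      using T unfolding diffG[OF that] by auto
  qed
  \<comment> \<open>Fatou's lemma in \<open>n\<close> with \<open>m\<close> fixed gives square
    integrability of the limit difference and the error bound together.\<close>
  have limG: "jint s (\<lambda>\<xi>. Ginf \<xi> - G m \<xi>) \<and> ?N (\<lambda>\<xi>. Ginf \<xi> - G m \<xi>) \<le> e m" for m
  proof -
    let ?F = "\<lambda>n \<xi>. ennreal (jw s \<xi> * (cmod (G n \<xi> - G m \<xi>))\<^sup>2)"
    let ?f = "\<lambda>\<xi>. jw s \<xi> * (cmod (Ginf \<xi> - G m \<xi>))\<^sup>2"
    have "AE \<xi> in lborel. ennreal (?f \<xi>) = liminf (\<lambda>n. ?F n \<xi>)"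
      using ae
    proof eventually_elim
      case (elim \<xi>)
      have "(\<lambda>n. \<Sum>k<n. h k \<xi>) \<longlonglongrightarrow> (\<Sum>k. h k \<xi>)" using elim by (rule summable_LIMSEQ)
      then have "(\<lambda>n. G n \<xi>) \<longlonglongrightarrow> Ginf \<xi>" unfolding G_def Ginf_def by (intro tendsto_intros)
      then have "(\<lambda>n. ?F n \<xi>) \<longlonglongrightarrow> ennreal (?f \<xi>)" by (intro tendsto_intros)
      then show ?case by (intro lim_imp_Liminf[symmetric]) auto
    qed
    then have "(\<integral>\<^sup>+\<xi>. ennreal (?f \<xi>) \<partial>lborel) = (\<integral>\<^sup>+\<xi>. liminf (\<lambda>n. ?F n \<xi>) \<partial>lborel)"
      by (rule nn_integral_cong_AE)
    also have "\<dots> \<le> liminf (\<lambda>n. \<integral>\<^sup>+\<xi>. ?F n \<xi> \<partial>lborel)"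
      by (rule nn_integral_liminf) measurable
    also have "\<dots> \<le> liminf (\<lambda>n. ennreal ((e m)\<^sup>2))"
    proof (rule Liminf_mono)
      show "\<forall>\<^sub>F n in sequentially. (\<integral>\<^sup>+\<xi>. ?F n \<xi> \<partial>lborel) \<le> ennreal ((e m)\<^sup>2)"
        using eventually_ge_at_top[of m]
      proof eventually_elim
        case (elim n)
        have "(\<integral>\<^sup>+\<xi>. ?F n \<xi> \<partial>lborel) = ennreal (jsq s (\<lambda>\<xi>. G n \<xi> - G m \<xi>))"
          using cauchy(1)[OF elim] unfolding sqn_def sq_int_def by (intro nn_integral_eq_integral) (auto simp: jw_nonneg)
        moreover have "jsq s (\<lambda>\<xi>. G n \<xi> - G m \<xi>) \<le> (e m)\<^sup>2"
          using cauchy(2)[OF elim] by (rule sqrt_le_D)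
        ultimately show ?case by (simp add: ennreal_leI)
      qed
    qed
    finally have fin: "(\<integral>\<^sup>+\<xi>. ennreal (?f \<xi>) \<partial>lborel) \<le> ennreal ((e m)\<^sup>2)" by (simp add: Liminf_const)
    have int: "integrable lborel ?f"
      using fin by (intro integrableI_bounded) (auto simp: jw_nonneg abs_mult intro: le_less_trans)
    have "ennreal (jsq s (\<lambda>\<xi>. Ginf \<xi> - G m \<xi>)) \<le> ennreal ((e m)\<^sup>2)"
      using fin int unfolding sqn_def by (subst nn_integral_eq_integral[symmetric]) (auto simp: jw_nonneg)
    then have "jsq s (\<lambda>\<xi>. Ginf \<xi> - G m \<xi>) \<le> (e m)\<^sup>2" by simp
    then have "?N (\<lambda>\<xi>. Ginf \<xi> - G m \<xi>) \<le> e m" using e0 by (intro real_le_lsqrt)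
    with int show ?thesis unfolding sq_int_def by simp
  qed
  \<comment> \<open>The cut-off outside the closure follows the convention for representatives in
    \<open>Hs_space\<close>.\<close>
  define v where "v x = (if x \<in> closure \<Omega> then inverse_fourier Ginf x else 0)" for x
  have "jint s (\<lambda>\<xi>. (Ginf \<xi> - G 0 \<xi>) + G 0 \<xi>)"
    using limG[of 0] G[of 0] unfolding Hs_lifts_iff by (intro sq_int_add jw_nonneg) auto
  then have v_lift: "Ginf \<in> Hs_lifts s \<Omega> v" unfolding Hs_lifts_iff by (simp add: v_def)
  then have v: "v \<in> Hs_space s \<Omega>" unfolding Hs_space_def by (auto simp: v_def)
  have "Hs_norm s \<Omega> (\<lambda>x. u m x - v x) \<le> e m" for m
  proof -
    have "(\<lambda>\<xi>. 1 * G m \<xi> + (-1) * Ginf \<xi>) \<in> Hs_lifts s \<Omega> (\<lambda>x. 1 * u m x + (-1) * v x)"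
      by (rule Hs_lifts_lincomb[OF s G v_lift])
    then have "Hs_norm s \<Omega> (\<lambda>x. u m x - v x) \<le> ?N (\<lambda>\<xi>. G m \<xi> - Ginf \<xi>)" using Hs_norm_le_lift by fastforce
    also have "\<dots> = ?N (\<lambda>\<xi>. Ginf \<xi> - G m \<xi>)" unfolding sqn_def by (simp add: norm_minus_commute)
    finally show ?thesis using limG[of m] by linarith
  qed
  moreover have "e \<longlonglongrightarrow> 0"
    using tendsto_mult_right_zero[OF LIMSEQ_power_zero[of \<theta>], of "(C + 1) / (1 - \<theta>)"] \<theta>
    by (simp add: e_def[abs_def])
  ultimately have "(\<lambda>k. Hs_norm s \<Omega> (\<lambda>x. u k x - v x)) \<longlonglongrightarrow> 0"
    using Hs_norm_nonneg[OF Hs_space_diff[OF s u v]]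
    by (intro tendsto_sandwich[of "\<lambda>_. 0" "\<lambda>k. Hs_norm s \<Omega> (\<lambda>x. u k x - v x)" sequentially e]) auto
  with v show ?thesis by blast
qed

section \<open>Surface measure of a smooth bounded domain\<close>

text \<open>The finite cover becomes a sequence by appending empty sets, which cost nothing thanks
  to the special case in \<open>hausdorff_premeasure\<close>; this matters for \<open>k = 0\<close>,
  where every nonempty set has the same positive weight.\<close>

lemma hausdorff_premeasure_le_finite_cover:
  fixes A :: "'a::euclidean_space set" and D :: "'i \<Rightarrow> 'a set"
  assumes "finite I" and "A \<subseteq> (\<Union>i\<in>I. D i)" and "\<delta> \<ge> 0" and b: "\<And>i. i \<in> I \<Longrightarrow> bounded (D i)"
    and d: "\<And>i. i \<in> I \<Longrightarrow> diameter (D i) \<le> \<delta>"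
  shows "hausdorff_premeasure k \<delta> A \<le> ennreal (real (card I) * (unit_ball_vol (real k) * (\<delta> / 2) ^ k))"
proof -
  obtain f :: "nat \<Rightarrow> 'i" where f: "bij_betw f {..<card I} I"
    using \<open>finite I\<close> ex_bij_betw_nat_finite[of I] by (auto simp: atLeast0LessThan)
  define E where "E n = (if n < card I then D (f n) else {})" for n
  have fI: "f n \<in> I" if "n < card I" for n using f that by (auto simp: bij_betw_def)
  have cov: "A \<subseteq> (\<Union>n. E n)"
  proof
    fix x assume "x \<in> A"
    then obtain i where "i \<in> I" "x \<in> D i" using assms(2) by auto
    moreover from \<open>i \<in> I\<close> have "i \<in> f ` {..<card I}" using f by (simp add: bij_betw_def)
    then obtain n where "n < card I" "f n = i" by blast
    ultimately show "x \<in> (\<Union>n. E n)" by (auto simp: E_def intro!: exI[of _ n])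
  qed
  let ?t = "\<lambda>n. if E n = {} then 0 else ennreal (unit_ball_vol (real k) * (diameter (E n) / 2) ^ k)"
  have "hausdorff_premeasure k \<delta> A \<le> (\<Sum>n. ?t n)"
    unfolding hausdorff_premeasure_def
    by (rule INF_lower) (use cov b d fI \<open>\<delta> \<ge> 0\<close> in \<open>auto simp: E_def\<close>)
  also have "\<dots> = (\<Sum>n<card I. ?t n)"
    by (rule suminf_finite) (auto simp: E_def)
  also have "\<dots> \<le> (\<Sum>n<card I. ennreal (unit_ball_vol (real k) * (\<delta> / 2) ^ k))"
    using d fI by (intro sum_mono) (auto simp: E_def diameter_ge_0 b intro!: ennreal_leI mult_left_mono power_mono)
  also have "\<dots> = ennreal (real (card I) * (unit_ball_vol (real k) * (\<delta> / 2) ^ k))"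
    by (simp add: ennreal_mult ennreal_of_nat_eq_real_of_nat \<open>\<delta> \<ge> 0\<close>)
  finally show ?thesis .
qed

lemma hausdorff_premeasure_antimono:
  "\<delta>' \<le> \<delta> \<Longrightarrow> hausdorff_premeasure k \<delta> A \<le> hausdorff_premeasure k \<delta>' A"
  unfolding hausdorff_premeasure_def by (intro INF_superset_mono) (auto intro: order_trans)

text \<open>The total weight of a cover by \<open>B * m^k\<close> sets of diameter
  \<open>c / m\<close> is bounded independently of \<open>m\<close>, as the powers of
  \<open>m\<close> cancel. The bound is thus uniform in \<open>\<delta>\<close> and survives the
  supremum.\<close>

lemma hausdorff_outer_finite:
  fixes A :: "'a::euclidean_space set"
  assumes "c > 0"
    and cover: "\<And>m. m > 0 \<Longrightarrow> \<exists>(I :: 'i set) D. finite I \<and> real (card I) \<le> B * real m ^ k \<and> A \<subseteq> (\<Union>i\<in>I. D i) \<and>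
       (\<forall>i\<in>I. bounded (D i) \<and> diameter (D i) \<le> c / real m)"
  shows "hausdorff_outer k A < \<infinity>"
proof -
  define W where "W = ennreal (B * (unit_ball_vol (real k) * (c / 2) ^ k))"
  have "hausdorff_premeasure k \<delta> A \<le> W" if "\<delta> > 0" for \<delta>
  proof -
    obtain m :: nat where m: "m > 0" "c / real m \<le> \<delta>"
    proof -
      obtain n :: nat where n: "c / \<delta> < real n" using reals_Archimedean2 by auto
      then have "n > 0" using \<open>c > 0\<close> \<open>\<delta> > 0\<close> by (metis divide_pos_pos gr0I not_less_iff_gr_or_eq of_nat_0)
      moreover have "c / real n \<le> \<delta>" using n \<open>\<delta> > 0\<close> \<open>n > 0\<close> by (simp add: field_simps)
      ultimately show ?thesis using that by blast
    qed
    from cover[OF m(1)] obtain I :: "'i set" and D where I: "finite I" "real (card I) \<le> B * real m ^ k" "A \<subseteq> (\<Union>i\<in>I. D i)"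
      "\<And>i. i \<in> I \<Longrightarrow> bounded (D i)" "\<And>i. i \<in> I \<Longrightarrow> diameter (D i) \<le> c / real m" by blast
    have "hausdorff_premeasure k \<delta> A \<le> hausdorff_premeasure k (c / real m) A"
      by (rule hausdorff_premeasure_antimono[OF m(2)])
    also have "\<dots> \<le> ennreal (real (card I) * (unit_ball_vol (real k) * (c / real m / 2) ^ k))"
      using I \<open>c > 0\<close> by (intro hausdorff_premeasure_le_finite_cover) auto
    also have "\<dots> \<le> ennreal ((B * real m ^ k) * (unit_ball_vol (real k) * (c / real m / 2) ^ k))"
      using I(2) \<open>c > 0\<close> by (intro ennreal_leI mult_right_mono) auto
    also have "(B * real m ^ k) * (unit_ball_vol (real k) * (c / real m / 2) ^ k) = B * (unit_ball_vol (real k) * (c / 2) ^ k)"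
      using m(1) by (simp add: power_divide field_simps)
    finally show ?thesis unfolding W_def .
  qed
  then have "hausdorff_outer k A \<le> W" unfolding hausdorff_outer_def by (intro SUP_least) auto
  then show ?thesis unfolding W_def by (rule le_less_trans) simp
qed

text \<open>The partial derivatives are bounded on the compact ball, and the sum of their bounds
  dominates the operator norm of the derivative; the ball is convex, so the mean value inequality
  applies.\<close>

lemma C1_lipschitz_on_cball:
  fixes \<gamma> :: "'a::euclidean_space \<Rightarrow> real"
  assumes "Ck_closure 1 UNIV \<gamma>"
  obtains L where "L \<ge> 0" "\<And>y z. \<lbrakk>y \<in> cball x \<rho>; z \<in> cball x \<rho>\<rbrakk> \<Longrightarrow> \<bar>\<gamma> y - \<gamma> z\<bar> \<le> L * norm (y - z)"
proof -
  from assms have diff: "\<gamma> differentiable_on UNIV"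
    and part: "\<And>b. b \<in> Basis \<Longrightarrow> \<exists>v. continuous_on UNIV v \<and> (\<forall>x. v x = partial_deriv b \<gamma> x)"
    by (auto simp: One_nat_def)
  have cont: "continuous_on (cball x \<rho>) (partial_deriv b \<gamma>)" if b: "b \<in> Basis" for b
  proof -
    obtain v where v: "continuous_on UNIV v" "\<forall>x. v x = partial_deriv b \<gamma> x" using part[OF b] by blast
    then have "v = partial_deriv b \<gamma>" by auto
    with v show ?thesis by (auto intro: continuous_on_subset)
  qed
  have "\<exists>K. \<forall>y\<in>cball x \<rho>. \<bar>partial_deriv b \<gamma> y\<bar> \<le> K" if b: "b \<in> Basis" for b
    using compact_imp_bounded[OF compact_continuous_image[OF cont[OF b] compact_cball]]
    unfolding bounded_iff by auto
  then obtain K where K: "\<And>b y. b \<in> Basis \<Longrightarrow> y \<in> cball x \<rho> \<Longrightarrow> \<bar>partial_deriv b \<gamma> y\<bar> \<le> K b" by metis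
  define L where "L = (\<Sum>b\<in>(Basis :: 'a set). \<bar>K b\<bar>)"
  have deriv: "(\<gamma> has_derivative frechet_derivative \<gamma> (at y)) (at y)" for y
    using diff by (simp add: differentiable_on_def frechet_derivative_works)
  have partial: "partial_deriv b \<gamma> y = frechet_derivative \<gamma> (at y) b" for b y
    unfolding partial_deriv_def
  proof (rule vector_derivative_at)
    have "((\<lambda>t. y + t *\<^sub>R b) has_vector_derivative b) (at 0)"
      by (auto intro!: derivative_eq_intros)
    then have "((\<lambda>t. y + t *\<^sub>R b) has_derivative (\<lambda>t. t *\<^sub>R b)) (at 0)" unfolding has_vector_derivative_def .
    moreover have "(\<gamma> has_derivative frechet_derivative \<gamma> (at y)) (at (y + 0 *\<^sub>R b))" using deriv[of y] by simp
    ultimately have "((\<lambda>t. \<gamma> (y + t *\<^sub>R b)) has_derivative (\<lambda>t. frechet_derivative \<gamma> (at y) (t *\<^sub>R b))) (at 0)"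
      by (rule has_derivative_compose)
    moreover have "frechet_derivative \<gamma> (at y) (t *\<^sub>R b) = t *\<^sub>R frechet_derivative \<gamma> (at y) b" for t
      by (rule linear_cmul[OF has_derivative_linear[OF deriv]])
    ultimately show "((\<lambda>t. \<gamma> (y + t *\<^sub>R b)) has_vector_derivative frechet_derivative \<gamma> (at y) b) (at 0)"
      unfolding has_vector_derivative_def by simp
  qed
  have "onorm (frechet_derivative \<gamma> (at y)) \<le> L" if y: "y \<in> cball x \<rho>" for y
  proof (rule onorm_le)
    fix h :: 'a
    have lin: "linear (frechet_derivative \<gamma> (at y))" by (rule has_derivative_linear[OF deriv])
    have "frechet_derivative \<gamma> (at y) h = frechet_derivative \<gamma> (at y) (\<Sum>b\<in>Basis. (h \<bullet> b) *\<^sub>R b)"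
      by (simp only: euclidean_representation)
    also have "\<dots> = (\<Sum>b\<in>Basis. (h \<bullet> b) * partial_deriv b \<gamma> y)"
      by (simp add: linear_sum[OF lin] linear_cmul[OF lin] partial)
    finally have "norm (frechet_derivative \<gamma> (at y) h) \<le> (\<Sum>b\<in>Basis. \<bar>(h \<bullet> b) * partial_deriv b \<gamma> y\<bar>)"
      by (simp add: sum_abs)
    also have "\<dots> \<le> (\<Sum>b\<in>Basis. norm h * \<bar>K b\<bar>)"
      unfolding abs_mult using K[OF _ y] by (intro sum_mono mult_mono Basis_le_norm) (auto intro: order_trans[OF _ abs_ge_self])
    also have "\<dots> = L * norm h" by (simp add: L_def sum_distrib_right mult.commute flip: sum_distrib_left)
    finally show "norm (frechet_derivative \<gamma> (at y) h) \<le> L * norm h" .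
  qed
  then have "norm (\<gamma> y - \<gamma> z) \<le> L * norm (y - z)" if "y \<in> cball x \<rho>" "z \<in> cball x \<rho>" for y z
    using that deriv by (intro differentiable_bound[of "cball x \<rho>" \<gamma> "\<lambda>y. frechet_derivative \<gamma> (at y)"])
      (auto intro: has_derivative_at_withinI)
  moreover have "L \<ge> 0" by (simp add: L_def sum_nonneg)
  ultimately show ?thesis using that by auto
qed

text \<open>A frontier point is outside the open set, hence not above the graph; strictly below the
  graph it would have a neighbourhood that misses \<open>\<Omega>\<close>, although it lies in the
  closure.\<close>

lemma frontier_graph:
  fixes \<Omega> :: "'a::euclidean_space set"
  assumes \<gamma>: "continuous_on UNIV \<gamma>" and "open \<Omega>" and eq: "\<Omega> \<inter> ball x \<rho> = {y \<in> ball x \<rho>. \<gamma> y < y \<bullet> e}"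
    and y: "y \<in> frontier \<Omega>" "y \<in> ball x \<rho>"
  shows "\<gamma> y = y \<bullet> e"
proof (rule ccontr)
  assume ne: "\<gamma> y \<noteq> y \<bullet> e"
  have "y \<notin> \<Omega>" using y(1) \<open>open \<Omega>\<close> by (simp add: frontier_def interior_open)
  then have "\<not> \<gamma> y < y \<bullet> e" using eq y(2) by blast
  with ne have "y \<bullet> e < \<gamma> y" by simp
  define V where "V = ball x \<rho> \<inter> {y. y \<bullet> e < \<gamma> y}"
  have "open {y. y \<bullet> e < \<gamma> y}" by (intro open_Collect_less continuous_intros \<gamma>)
  then have "open V" unfolding V_def by (intro open_Int open_ball)
  moreover have "y \<in> V" using y(2) \<open>y \<bullet> e < \<gamma> y\<close> by (simp add: V_def)
  moreover have "y \<in> closure \<Omega>" using y(1) by (simp add: frontier_def)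
  ultimately obtain z where "z \<in> \<Omega>" "z \<in> V" by (meson closure_iff_nhds_not_empty disjoint_iff order_refl open_Int_closure_eq_empty)
  then have "z \<in> {y \<in> ball x \<rho>. \<gamma> y < y \<bullet> e}" "z \<bullet> e < \<gamma> z" using eq unfolding V_def by blast+
  then show False by simp
qed

text \<open>The set is an orthonormal basis containing \<open>e\<close>, with \<open>e\<close>
  removed; the bound is the triangle inequality for the expansion of \<open>z\<close> in this
  basis.\<close>

lemma orthonormal_hyperplane:
  fixes e :: "'a::euclidean_space"
  assumes "norm e = 1"
  obtains B where "finite B" "card B = DIM('a) - 1" "\<And>b. b \<in> B \<Longrightarrow> norm b = 1"
    "\<And>z. norm (z - (z \<bullet> e) *\<^sub>R e) \<le> (\<Sum>b\<in>B. \<bar>z \<bullet> b\<bar>)"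
proof -
  obtain S where S: "e \<in> S" "pairwise orthogonal S" "\<And>b. b \<in> S \<Longrightarrow> norm b = 1" "independent S" "card S = DIM('a)" "span S = UNIV"
    using vector_in_orthonormal_basis[OF assms] by metis
  have fin: "finite S" using S(4) by (rule independent_imp_finite)
  have "norm (z - (z \<bullet> e) *\<^sub>R e) \<le> (\<Sum>b\<in>S - {e}. \<bar>z \<bullet> b\<bar>)" for z
  proof -
    have "z = (\<Sum>b\<in>S. (z \<bullet> b) *\<^sub>R b)"
      using orthonormal_basis_expand[OF S(2) S(3) _ fin, of z] S(6) by simp
    also have "\<dots> = (z \<bullet> e) *\<^sub>R e + (\<Sum>b\<in>S - {e}. (z \<bullet> b) *\<^sub>R b)"
      using fin S(1) by (simp add: sum.remove)
    finally have "z - (z \<bullet> e) *\<^sub>R e = (\<Sum>b\<in>S - {e}. (z \<bullet> b) *\<^sub>R b)" by (simp add: algebra_simps)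
    then have "norm (z - (z \<bullet> e) *\<^sub>R e) \<le> (\<Sum>b\<in>S - {e}. norm ((z \<bullet> b) *\<^sub>R b))" by (simp only: norm_sum)
    also have "\<dots> = (\<Sum>b\<in>S - {e}. \<bar>z \<bullet> b\<bar>)" using S(3) by simp
    finally show ?thesis .
  qed
  then show ?thesis using S fin by (intro that[of "S - {e}"]) auto
qed

text \<open>\<open>A\<close> lies on a graph over the hyperplane orthogonal to \<open>e\<close>,
  Lipschitz on bounded sets, so distances in \<open>A\<close> are controlled by the
  \<open>d - 1\<close> coordinates along that hyperplane. A grid with \<open>m\<close> steps in each
  of them cuts \<open>A\<close> into at most \<open>m^(d-1)\<close> pieces of diameter of order
  \<open>1 / m\<close>.\<close>

lemma hausdorff_outer_graph_finite:
  fixes A :: "'a::euclidean_space set"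
  assumes e: "norm e = 1" and \<gamma>: "Ck_closure 1 UNIV \<gamma>" and inv: "\<And>y. \<gamma> (y - (y \<bullet> e) *\<^sub>R e) = \<gamma> y"
    and A: "A \<subseteq> ball x \<rho>" and graph: "\<And>y. y \<in> A \<Longrightarrow> \<gamma> y = y \<bullet> e" and \<rho>: "\<rho> > 0"
  shows "hausdorff_outer (DIM('a) - 1) A < \<infinity>"
proof -
  define P where "P y = y - (y \<bullet> e) *\<^sub>R e" for y :: 'a
  obtain B where B: "finite B" "card B = DIM('a) - 1" "\<And>b. b \<in> B \<Longrightarrow> norm b = 1"
    and PB: "\<And>z. norm (P z) \<le> (\<Sum>b\<in>B. \<bar>z \<bullet> b\<bar>)"
    unfolding P_def by (rule orthonormal_hyperplane[OF e]) blast
  \<comment> \<open>The doubled radius makes room for the projections of points of \<open>A\<close>,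
    as the norm of \<open>P y\<close> is at most twice that of \<open>y\<close>.\<close>
  obtain L where L: "L \<ge> 0" and lip: "\<And>y z. \<lbrakk>y \<in> cball 0 (2 * (norm x + \<rho>)); z \<in> cball 0 (2 * (norm x + \<rho>))\<rbrakk> \<Longrightarrow> \<bar>\<gamma> y - \<gamma> z\<bar> \<le> L * norm (y - z)"
    using C1_lipschitz_on_cball[OF \<gamma>] by blast
  have P_ball: "P y \<in> cball 0 (2 * (norm x + \<rho>))" if "y \<in> A" for y
  proof -
    have "norm y \<le> norm x + \<rho>" using A that norm_triangle_sub[of y x] by (auto simp: dist_norm norm_minus_commute)
    moreover have "\<bar>y \<bullet> e\<bar> \<le> norm y" using Cauchy_Schwarz_ineq2[of y e] e by simp
    moreover have "norm (P y) \<le> norm y + \<bar>y \<bullet> e\<bar>"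
      using norm_triangle_ineq4[of y "(y \<bullet> e) *\<^sub>R e"] e by (simp add: P_def)
    ultimately show ?thesis by simp
  qed
  have P_diff: "P y - P z = P (y - z)" for y z by (simp add: P_def inner_diff_left algebra_simps)
  have bound: "norm (y - z) \<le> (1 + L) * (\<Sum>b\<in>B. \<bar>(y - z) \<bullet> b\<bar>)" if "y \<in> A" "z \<in> A" for y z
  proof -
    have "y - z = P (y - z) + ((y - z) \<bullet> e) *\<^sub>R e" by (simp add: P_def)
    then have "norm (y - z) \<le> norm (P (y - z)) + norm (((y - z) \<bullet> e) *\<^sub>R e)" using norm_triangle_ineq by metis
    also have "norm (((y - z) \<bullet> e) *\<^sub>R e) = \<bar>\<gamma> (P y) - \<gamma> (P z)\<bar>"
      using graph[OF that(1)] graph[OF that(2)] inv[of y] inv[of z] e by (simp add: P_def inner_diff_left)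
    also have "\<dots> \<le> L * norm (P (y - z))" using lip[OF P_ball P_ball, OF that] by (simp add: P_diff)
    finally have "norm (y - z) \<le> (1 + L) * norm (P (y - z))" by (simp add: algebra_simps)
    also have "\<dots> \<le> (1 + L) * (\<Sum>b\<in>B. \<bar>(y - z) \<bullet> b\<bar>)" using PB L by (intro mult_left_mono) auto
    finally show ?thesis .
  qed
  \<comment> \<open>The extra 1 keeps \<open>c\<close> positive in dimension 1, where
    \<open>B\<close> is empty.\<close>
  define c where "c = (1 + L) * (real (card B) * (2 * \<rho>)) + 1"
  have c: "c > 0" unfolding c_def using L \<rho> by (intro add_nonneg_pos) auto
  show ?thesis
  proof (rule hausdorff_outer_finite[OF c, where B = 1])
    fix m :: nat assume m: "m > 0"
    define h where "h = 2 * \<rho> / real m"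
    have h: "h > 0" using \<rho> m by (simp add: h_def)
    \<comment> \<open>The coordinate along \<open>b\<close> stays within distance less than
      \<open>\<rho>\<close> of that of \<open>x\<close>; this range is divided into \<open>m\<close>
      intervals of length \<open>h\<close>, numbered from 0, and strictness keeps the number below
      \<open>m\<close>.\<close>
    define cell where "cell y b = nat \<lfloor>(y \<bullet> b - x \<bullet> b + \<rho>) / h\<rfloor>" for y b :: 'a
    define D where "D \<kappa> = {y \<in> A. \<forall>b\<in>B. cell y b = \<kappa> b}" for \<kappa>
    let ?I = "B \<rightarrow>\<^sub>E {..<m}"
    have rng: "0 \<le> (y \<bullet> b - x \<bullet> b + \<rho>) / h" "(y \<bullet> b - x \<bullet> b + \<rho>) / h < real m" if "y \<in> A" "b \<in> B" for y b
    proof -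
      have "\<bar>(y - x) \<bullet> b\<bar> \<le> norm (y - x)" using Cauchy_Schwarz_ineq2[of "y - x" b] B(3)[OF that(2)] by simp
      also have "\<dots> < \<rho>" using A that(1) by (auto simp: dist_norm norm_minus_commute)
      finally have "\<bar>y \<bullet> b - x \<bullet> b\<bar> < \<rho>" by (simp add: inner_diff_left)
      then have t: "0 \<le> y \<bullet> b - x \<bullet> b + \<rho>" "y \<bullet> b - x \<bullet> b + \<rho> < real m * h" using m by (auto simp: h_def)
      show "0 \<le> (y \<bullet> b - x \<bullet> b + \<rho>) / h" using t(1) h by (intro divide_nonneg_pos)
      show "(y \<bullet> b - x \<bullet> b + \<rho>) / h < real m" using t(2) h by (simp only: pos_divide_less_eq)
    qed
    have cell_lt: "cell y b < m" if "y \<in> A" "b \<in> B" for y b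
      using rng[OF that] unfolding cell_def by linarith
    have near: "\<bar>(y - z) \<bullet> b\<bar> \<le> h" if "y \<in> A" "z \<in> A" "b \<in> B" "cell y b = cell z b" for y z b
    proof -
      have "\<lfloor>(y \<bullet> b - x \<bullet> b + \<rho>) / h\<rfloor> = \<lfloor>(z \<bullet> b - x \<bullet> b + \<rho>) / h\<rfloor>"
        using rng(1)[OF that(1,3)] rng(1)[OF that(2,3)] that(4) unfolding cell_def by (simp add: nat_eq_iff)
      then have "\<bar>(y \<bullet> b - x \<bullet> b + \<rho>) / h - (z \<bullet> b - x \<bullet> b + \<rho>) / h\<bar> \<le> 1" by linarith
      then have "\<bar>((y - z) \<bullet> b) / h\<bar> \<le> 1" by (simp add: inner_diff_left diff_divide_distrib add_divide_distrib)
      then show ?thesis using h by (simp add: field_simps)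
    qed
    show "\<exists>(I :: ('a \<Rightarrow> nat) set) D. finite I \<and> real (card I) \<le> 1 * real m ^ (DIM('a) - 1) \<and> A \<subseteq> (\<Union>i\<in>I. D i) \<and>
       (\<forall>i\<in>I. bounded (D i) \<and> diameter (D i) \<le> c / real m)"
    proof (intro exI conjI ballI)
      show "finite ?I" using B(1) by (intro finite_PiE) auto
      show "real (card ?I) \<le> 1 * real m ^ (DIM('a) - 1)" using B(1,2) by (simp add: card_PiE)
      show "A \<subseteq> (\<Union>\<kappa>\<in>?I. D \<kappa>)"
      proof
        fix y assume y: "y \<in> A"
        have "restrict (cell y) B \<in> ?I" "y \<in> D (restrict (cell y) B)"
          using cell_lt[OF y] y by (auto simp: D_def)
        then show "y \<in> (\<Union>\<kappa>\<in>?I. D \<kappa>)" by blast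
      qed
      fix \<kappa> assume "\<kappa> \<in> ?I"
      show "bounded (D \<kappa>)" by (rule bounded_subset[OF bounded_ball[of x \<rho>]]) (use A in \<open>auto simp: D_def\<close>)
      show "diameter (D \<kappa>) \<le> c / real m"
      proof (rule diameter_le)
        show "D \<kappa> \<noteq> {} \<or> 0 \<le> c / real m" using c by simp
        fix y z assume yz: "y \<in> D \<kappa>" "z \<in> D \<kappa>"
        then have "norm (y - z) \<le> (1 + L) * (\<Sum>b\<in>B. \<bar>(y - z) \<bullet> b\<bar>)" by (intro bound) (auto simp: D_def)
        also have "\<dots> \<le> (1 + L) * (\<Sum>b\<in>B. h)" using yz L by (intro mult_left_mono sum_mono near) (auto simp: D_def)
        also have "\<dots> = (1 + L) * (real (card B) * (2 * \<rho>)) / real m" by (simp add: h_def)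
        also have "\<dots> \<le> c / real m" unfolding c_def by (intro divide_right_mono) auto
        finally show "norm (y - z) \<le> c / real m" .
      qed
    qed
  qed
qed

lemma sets_hausdorff_measure: "sets (hausdorff_measure k :: 'a::euclidean_space measure) = sets borel"
  and space_hausdorff_measure: "space (hausdorff_measure k :: 'a::euclidean_space measure) = UNIV"
proof -
  have "sigma_sets UNIV (sets borel) = sets (borel :: 'a measure)"
    using sets.sigma_sets_eq[of "borel :: 'a measure"] by simp
  then show "sets (hausdorff_measure k :: 'a measure) = sets borel"
    unfolding hausdorff_measure_def sets_measure_of_conv by simp
  show "space (hausdorff_measure k :: 'a measure) = UNIV"
    unfolding hausdorff_measure_def by (rule space_measure_of_conv)
qed

text \<open>Around each of its points the frontier lies on a smooth graph, which has finite outer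
  measure in a ball; finitely many such balls cover the compact frontier.\<close>

lemma finite_surface_measure:
  fixes \<Omega> :: "'a::euclidean_space set"
  assumes "smooth_bounded_domain \<Omega>"
  shows "finite_measure (surface_measure \<Omega>)"
proof
  define k where "k = DIM('a) - 1"
  have \<Omega>: "open \<Omega>" "bounded \<Omega>" "smooth_boundary \<Omega>" using assms unfolding smooth_bounded_domain_def by auto
  \<comment> \<open>By definition of \<open>measure_of\<close>, the left side is \<open>0\<close> should the outer measure fail to be countably additive,
    so that additivity need not be shown.\<close>
  have em: "emeasure (hausdorff_measure k) A \<le> hausdorff_outer k A" for A :: "'a set"
    unfolding hausdorff_measure_def emeasure_measure_of_conv
    by (simp only: order_refl zero_le simp_thms split: if_split)
  have local: "\<exists>\<rho>>0. emeasure (hausdorff_measure k) (frontier \<Omega> \<inter> ball x \<rho>) < \<infinity>" if x: "x \<in> frontier \<Omega>" for x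
  proof -
    obtain \<rho> e and \<gamma> :: "'a \<Rightarrow> real" where \<rho>: "\<rho> > 0" and e: "norm e = 1" and \<gamma>: "\<forall>k. Ck_closure k UNIV \<gamma>"
      and inv: "\<forall>y. \<gamma> (y - (y \<bullet> e) *\<^sub>R e) = \<gamma> y" and eq: "\<Omega> \<inter> ball x \<rho> = {y \<in> ball x \<rho>. \<gamma> y < y \<bullet> e}"
      using \<Omega>(3) x unfolding smooth_boundary_def by blast
    have "continuous_on UNIV \<gamma>" using \<gamma>[rule_format, of 0] by simp
    note graph = frontier_graph[OF this \<Omega>(1) eq]
    have "hausdorff_outer k (frontier \<Omega> \<inter> ball x \<rho>) < \<infinity>"
      unfolding k_def
    proof (rule hausdorff_outer_graph_finite[where \<gamma> = \<gamma> and e = e and x = x and \<rho> = \<rho>])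
      show "norm e = 1" "\<rho> > 0" by fact+
      show "Ck_closure 1 UNIV \<gamma>" using \<gamma> by blast
      show "\<gamma> (y - (y \<bullet> e) *\<^sub>R e) = \<gamma> y" for y using inv by (rule spec)
      show "frontier \<Omega> \<inter> ball x \<rho> \<subseteq> ball x \<rho>" by blast
      show "\<gamma> y = y \<bullet> e" if "y \<in> frontier \<Omega> \<inter> ball x \<rho>" for y
        using that by (elim IntE) (rule graph)
    qed
    then have "emeasure (hausdorff_measure k) (frontier \<Omega> \<inter> ball x \<rho>) < \<infinity>" by (rule le_less_trans[OF em])
    then show ?thesis using \<rho> by blast
  qed
  then obtain \<rho> where \<rho>: "\<And>x. x \<in> frontier \<Omega> \<Longrightarrow> \<rho> x > 0"
    and fin: "\<And>x. x \<in> frontier \<Omega> \<Longrightarrow> emeasure (hausdorff_measure k) (frontier \<Omega> \<inter> ball x (\<rho> x)) < \<infinity>" by metis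
  have "compact (frontier \<Omega>)" using \<Omega>(2) by (rule compact_frontier_bounded)
  then obtain F where F: "F \<subseteq> frontier \<Omega>" "finite F" "frontier \<Omega> \<subseteq> (\<Union>x\<in>F. ball x (\<rho> x))"
  proof (rule compactE_image[of "frontier \<Omega>" "frontier \<Omega>" "\<lambda>x. ball x (\<rho> x)"])
    show "frontier \<Omega> \<subseteq> (\<Union>x\<in>frontier \<Omega>. ball x (\<rho> x))" using \<rho> centre_in_ball by blast
  qed auto
  have fr: "frontier \<Omega> \<in> sets borel" by (intro borel_closed frontier_closed)
  have pieces: "frontier \<Omega> \<inter> ball x r \<in> sets (hausdorff_measure k)" for x r
    unfolding sets_hausdorff_measure by (intro sets.Int fr borel_open open_ball)
  have "emeasure (hausdorff_measure k) (frontier \<Omega>) \<le> emeasure (hausdorff_measure k) (\<Union>x\<in>F. frontier \<Omega> \<inter> ball x (\<rho> x))"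
  proof (rule emeasure_mono)
    show "frontier \<Omega> \<subseteq> (\<Union>x\<in>F. frontier \<Omega> \<inter> ball x (\<rho> x))" using F(3) by blast
    show "(\<Union>x\<in>F. frontier \<Omega> \<inter> ball x (\<rho> x)) \<in> sets (hausdorff_measure k)"
      by (intro sets.finite_UN F(2) pieces)
  qed
  also have "\<dots> \<le> (\<Sum>x\<in>F. emeasure (hausdorff_measure k) (frontier \<Omega> \<inter> ball x (\<rho> x)))"
    using F(2) pieces by (intro emeasure_subadditive_finite) auto
  also have "\<dots> < \<infinity>"
  proof -
    have "\<forall>x\<in>F. emeasure (hausdorff_measure k) (frontier \<Omega> \<inter> ball x (\<rho> x)) < top" using fin F(1) by auto
    then show ?thesis using F(2) by simp
  qed
  finally have total: "emeasure (hausdorff_measure k) (frontier \<Omega>) < \<infinity>" .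
  have "emeasure (surface_measure \<Omega>) (space (surface_measure \<Omega>)) = emeasure (hausdorff_measure k) (frontier \<Omega>)"
    using fr unfolding surface_measure_def k_def[symmetric]
    by (simp add: emeasure_restrict_space space_restrict_space space_hausdorff_measure sets_hausdorff_measure)
  with total show "emeasure (surface_measure \<Omega>) (space (surface_measure \<Omega>)) \<noteq> \<infinity>"
    by simp
qed

lemma sets_surface_measure: "sets (surface_measure \<Omega>) = sets (restrict_space borel (frontier \<Omega>))"
  unfolding surface_measure_def by (intro sets_restrict_space_cong sets_hausdorff_measure)

section \<open>The nonlinear coefficients\<close>

text \<open>Turns the iterated \<open>deriv\<close> of the Rodrigues formula into formal derivatives
  of a polynomial, from which continuity of the time basis is immediate.\<close>

lemma deriv_funpow_poly: "(deriv ^^ n) (poly p) = poly ((pderiv ^^ n) (p :: real poly))"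
proof (induction n)
  case (Suc n)
  have "deriv (poly r) = poly (pderiv r)" for r :: "real poly"
    by (intro ext DERIV_imp_deriv poly_DERIV)
  then show ?case using Suc by simp
qed simp

lemma continuous_Psi: "continuous_on S (Psi T n)"
proof -
  define P where "P = (pderiv ^^ n) ([:-1, 0, 1:] ^ n :: real poly)"
  have "poly ([:-1, 0, 1:] ^ n) = (\<lambda>y :: real. (y\<^sup>2 - 1) ^ n)"
    by (simp add: fun_eq_iff poly_power power2_eq_square)
  then have "legendre n = (\<lambda>x. poly P x / (2 ^ n * fact n))"
    unfolding P_def deriv_funpow_poly[symmetric] by (simp add: legendre_def[abs_def])
  then show ?thesis
    unfolding Psi_def[abs_def] divide_inverse by (auto intro!: continuous_intros)
qed

lemma measurable_Psi [measurable]: "Psi T n \<in> borel_measurable borel"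
  by (rule borel_measurable_continuous_onI[OF continuous_Psi])

lemma Psi_bounded:
  obtains K where "K \<ge> 0" "\<And>t. t \<in> {0<..<T} \<Longrightarrow> \<bar>Psi T n t\<bar> \<le> K"
proof -
  have "bounded (Psi T n ` {0..T})"
    by (intro compact_imp_bounded compact_continuous_image continuous_Psi compact_Icc)
  then obtain K where "\<forall>t\<in>{0..T}. norm (Psi T n t) \<le> K" unfolding bounded_iff by auto
  then show ?thesis using that[of "max K 0"] by (auto simp: le_max_iff_disj)
qed

text \<open>\<open>q\<close> is merely Lebesgue measurable on the product, which says nothing about
  a single section. A Borel function that agrees with it almost everywhere has Borel sections, and
  Fubini transfers the agreement to almost every \<open>t\<close> for almost every
  \<open>x\<close>.\<close>

lemma essentially_bounded_potential_borel:
  fixes \<Omega> :: "'a::euclidean_space set"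
  assumes "open \<Omega>" and q: "essentially_bounded_potential \<Omega> T q"
  obtains K and q' :: "'a \<times> real \<Rightarrow> real" where "K \<ge> 0" "q' \<in> borel_measurable borel" "\<And>z. \<bar>q' z\<bar> \<le> K"
    "AE x in lborel. AE t in lborel. x \<in> \<Omega> \<longrightarrow> t \<in> {0<..<T} \<longrightarrow> q x t = q' (x, t)"
proof -
  define Z where "Z = \<Omega> \<times> {0<..<T}"
  have "open Z" unfolding Z_def using \<open>open \<Omega>\<close> by (intro open_Times) auto
  then have Z: "Z \<in> sets lebesgue" by simp
  define q0 where "q0 z = (if z \<in> Z then case z of (x, t) \<Rightarrow> q x t else 0)" for z
  have "(\<lambda>(x, t). q x t) \<in> borel_measurable (lebesgue_on Z)"
    using q unfolding essentially_bounded_potential_def Z_def by simp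
  then have "q0 \<in> borel_measurable lebesgue"
    using borel_measurable_if[OF Z, of "\<lambda>(x, t). q x t"] by (simp add: q0_def[abs_def])
  then obtain q1 where q1 [measurable]: "q1 \<in> borel_measurable lborel" and q01: "AE z in lborel. q0 z = q1 z"
    using completion_ex_borel_measurable_real by blast
  obtain K where "AE z in lebesgue_on Z. \<bar>q (fst z) (snd z)\<bar> \<le> K"
    using q unfolding essentially_bounded_potential_def Z_def by auto
  then have "AE z in lebesgue. z \<in> Z \<longrightarrow> \<bar>q (fst z) (snd z)\<bar> \<le> K"
    using Z by (subst (asm) AE_restrict_space_iff) auto
  then have K: "AE z in lborel. z \<in> Z \<longrightarrow> \<bar>q (fst z) (snd z)\<bar> \<le> K"
    by (simp add: AE_completion_iff)
  \<comment> \<open>Truncation turns the almost everywhere bound into one that holds everywhere; the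
    absolute value makes this bound nonnegative whatever \<open>K\<close> is.\<close>
  define q' where "q' z = (if \<bar>q1 z\<bar> \<le> \<bar>K\<bar> then q1 z else 0)" for z
  have "AE z in lborel. z \<in> Z \<longrightarrow> q (fst z) (snd z) = q' z"
    using q01 K by eventually_elim (auto simp: q'_def q0_def split: prod.splits)
  then have "AE z in lborel \<Otimes>\<^sub>M lborel. z \<in> Z \<longrightarrow> q (fst z) (snd z) = q' z"
    unfolding lborel_prod .
  then have "AE x in lborel. AE t in lborel. (x, t) \<in> Z \<longrightarrow> q x t = q' (x, t)"
    using lborel_pair.AE_pair by fastforce
  then have "AE x in lborel. AE t in lborel. x \<in> \<Omega> \<longrightarrow> t \<in> {0<..<T} \<longrightarrow> q x t = q' (x, t)"
    unfolding Z_def by (simp only: mem_Times_iff fst_conv snd_conv imp_conjL)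
  moreover have "q' \<in> borel_measurable borel"
  proof -
    have [measurable]: "q1 \<in> borel_measurable borel" using q1 by simp
    show ?thesis unfolding q'_def by measurable
  qed
  ultimately show ?thesis by (intro that[of "\<bar>K\<bar>" q']) (auto simp: q'_def)
qed

text \<open>The coefficient is compared with \<open>b'\<close>, the time integral of a jointly Borel
  integrand built from the Borel version of \<open>q\<close>: \<open>b'\<close> is Borel by Fubini,
  agrees with the coefficient almost everywhere on \<open>\<Omega>\<close>, and has an explicit
  bound there.\<close>

lemma b_coeff_measurable_bounded:
  fixes \<Omega> :: "'a::euclidean_space set"
  assumes \<Omega>: "open \<Omega>" "bounded \<Omega>" and T: "T > 0" and p: "p > 1"
    and q: "essentially_bounded_potential \<Omega> T q"
    and \<phi>: "\<And>l. l \<le> N \<Longrightarrow> continuous_on (closure \<Omega>) (\<phi> l)"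
  shows "b_coeff T p q N \<phi> m n \<in> borel_measurable (lebesgue_on \<Omega>)"
    and "\<exists>B. AE x in lebesgue_on \<Omega>. \<bar>b_coeff T p q N \<phi> m n x\<bar> \<le> B"
proof -
  obtain K q' where K: "K \<ge> 0" and q' [measurable]: "q' \<in> borel_measurable borel" and q'K: "\<And>z. \<bar>q' z\<bar> \<le> K"
    and qq': "AE x in lborel. AE t in lborel. x \<in> \<Omega> \<longrightarrow> t \<in> {0<..<T} \<longrightarrow> q x t = q' (x, t)"
    by (rule essentially_bounded_potential_borel[OF \<Omega>(1) q]) blast
  \<comment> \<open>\<open>\<phi>\<close> is known to be continuous on the closure only; the cut-off
    makes it Borel on the whole space.\<close>
  define \<zeta> where "\<zeta> l x = indicator \<Omega> x *\<^sub>R \<phi> l x" for l x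
  have \<zeta> [measurable]: "\<zeta> l \<in> borel_measurable borel" if "l \<in> {..N}" for l
    unfolding \<zeta>_def using \<Omega>(1) continuous_on_subset[OF \<phi> closure_subset, of l] that
    by (intro borel_measurable_continuous_on_indicator) auto
  define k where "k x t = cmod (\<Sum>l\<le>N. \<zeta> l x * of_real (Psi T l t)) powr (p - 1) * Psi T n t * Psi T m t" for x t
  define F where "F x t = indicator {0<..<T} t *\<^sub>R (exp (- 2 * t) * q' (x, t) * k x t)" for x t
  define b' where "b' x = (LINT t|lborel. F x t)" for x
  have F_joint [measurable]: "(\<lambda>z. F (fst z) (snd z)) \<in> borel_measurable (borel \<Otimes>\<^sub>M borel)"
  proof -
    have [measurable]: "q' \<in> borel_measurable (borel \<Otimes>\<^sub>M borel)" using q' by (simp add: borel_prod)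
    show ?thesis unfolding F_def k_def by measurable
  qed
  have b'm: "b' \<in> borel_measurable borel"
  proof -
    have "case_prod F \<in> borel_measurable (borel \<Otimes>\<^sub>M lborel)" using F_joint by (simp add: case_prod_beta')
    then show ?thesis unfolding b'_def by (rule lborel.borel_measurable_lebesgue_integral)
  qed
  have F_t: "F x \<in> borel_measurable borel" for x
    using measurable_compose[OF measurable_Pair1' F_joint, of x] by simp
  have eq: "AE x in lborel. x \<in> \<Omega> \<longrightarrow> b' x = b_coeff T p q N \<phi> m n x"
    using qq'
  proof eventually_elim
    case (elim x)
    show ?case
    proof
      assume x: "x \<in> \<Omega>"
      let ?f = "\<lambda>t. exp (- 2 * t) * q x t * cmod (\<Sum>l\<le>N. \<phi> l x * of_real (Psi T l t)) powr (p - 1) * Psi T n t * Psi T m t"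
      have "AE t in lborel. F x t = indicator {0<..<T} t *\<^sub>R ?f t"
        using elim by eventually_elim (use x in \<open>auto simp: F_def k_def \<zeta>_def indicator_def\<close>)
      then have ae: "AE t in lebesgue. F x t = indicator {0<..<T} t *\<^sub>R ?f t" by (rule AE_completion)
      have Fl: "F x \<in> borel_measurable lebesgue" using F_t[of x] by (simp add: measurable_completion)
      \<comment> \<open>The original integrand is only known to agree with the Borel function
        \<open>F x\<close> almost everywhere; completeness of Lebesgue measure makes it
        measurable.\<close>
      then have fl: "(\<lambda>t. indicator {0<..<T} t *\<^sub>R ?f t) \<in> borel_measurable lebesgue"
        using ae by (rule borel_measurable_AE)
      have "b_coeff T p q N \<phi> m n x = (LINT t|lebesgue. indicator {0<..<T} t *\<^sub>R ?f t)"
        unfolding b_coeff_def by (subst integral_restrict_space) auto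
      also have "\<dots> = (LINT t|lebesgue. F x t)"
        using ae by (intro integral_cong_AE fl Fl) auto
      also have "\<dots> = b' x" unfolding b'_def using F_t[of x] by (intro integral_completion) simp
      finally show "b' x = b_coeff T p q N \<phi> m n x" by simp
    qed
  qed
  have \<Omega>l: "\<Omega> \<in> sets lebesgue" using \<Omega>(1) by simp
  have "(\<lambda>x. if x \<in> \<Omega> then b' x else 0) \<in> borel_measurable lebesgue"
    using b'm \<Omega>(1) by (intro measurable_completion) simp
  moreover have "AE x in lebesgue. (if x \<in> \<Omega> then b' x else 0) = (if x \<in> \<Omega> then b_coeff T p q N \<phi> m n x else 0)"
    using AE_completion[OF eq] by eventually_elim auto
  ultimately have "(\<lambda>x. if x \<in> \<Omega> then b_coeff T p q N \<phi> m n x else 0) \<in> borel_measurable lebesgue"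
    by (rule borel_measurable_AE)
  then show "b_coeff T p q N \<phi> m n \<in> borel_measurable (lebesgue_on \<Omega>)"
    by (simp add: borel_measurable_if[OF \<Omega>l])
  have "\<exists>c. c \<ge> 0 \<and> (\<forall>x\<in>\<Omega>. cmod (\<phi> l x) \<le> c)" if "l \<le> N" for l
  proof -
    have "bounded (\<phi> l ` closure \<Omega>)"
      using \<Omega>(2) \<phi>[OF that] by (intro compact_imp_bounded compact_continuous_image) (auto simp: compact_closure)
    then obtain c where "\<forall>x\<in>closure \<Omega>. cmod (\<phi> l x) \<le> c" unfolding bounded_iff by auto
    then show ?thesis using closure_subset[of \<Omega>] by (intro exI[of _ "max c 0"]) (auto simp: le_max_iff_disj)
  qed
  then obtain c where c: "\<And>l. l \<le> N \<Longrightarrow> c l \<ge> 0" "\<And>l x. l \<le> N \<Longrightarrow> x \<in> \<Omega> \<Longrightarrow> cmod (\<phi> l x) \<le> c l" by metis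
  have "\<exists>K. K \<ge> 0 \<and> (\<forall>t\<in>{0<..<T}. \<bar>Psi T l t\<bar> \<le> K)" for l
    using Psi_bounded[of T l] by metis
  then obtain P where P: "\<And>l. P l \<ge> 0" "\<And>l t. t \<in> {0<..<T} \<Longrightarrow> \<bar>Psi T l t\<bar> \<le> P l" by metis
  \<comment> \<open>Collects \<open>|q'| <= K\<close>, \<open>exp (- 2 * t) <= 1\<close> for
    positive \<open>t\<close>, the bounds for the time basis, and the monotonicity of
    \<open>powr\<close> with the positive exponent \<open>p - 1\<close>.\<close>
  define B where "B = K * ((\<Sum>l\<le>N. c l * P l) powr (p - 1) * P n * P m)"
  have B: "B \<ge> 0" unfolding B_def using K P by simp
  have Fb: "norm (F x t) \<le> B * indicator {0<..<T} t" if x: "x \<in> \<Omega>" for x t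
  proof (cases "t \<in> {0<..<T}")
    case True
    have "cmod (\<Sum>l\<le>N. \<zeta> l x * of_real (Psi T l t)) \<le> (\<Sum>l\<le>N. c l * P l)"
    proof (rule order_trans[OF norm_sum sum_mono])
      fix l assume "l \<in> {..N}"
      then show "cmod (\<zeta> l x * of_real (Psi T l t)) \<le> c l * P l"
        unfolding norm_mult using x c[of l] P(2)[OF True, of l] by (intro mult_mono) (auto simp: \<zeta>_def)
    qed
    then have "cmod (\<Sum>l\<le>N. \<zeta> l x * of_real (Psi T l t)) powr (p - 1) \<le> (\<Sum>l\<le>N. c l * P l) powr (p - 1)"
      using p by (intro powr_mono2) auto
    then have "\<bar>k x t\<bar> \<le> (\<Sum>l\<le>N. c l * P l) powr (p - 1) * P n * P m"
      unfolding k_def abs_mult using P(1) P(2)[OF True] by (intro mult_mono) auto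
    moreover have "\<bar>exp (- 2 * t) * q' (x, t)\<bar> \<le> 1 * K"
      unfolding abs_mult using True q'K by (intro mult_mono) auto
    ultimately have "\<bar>exp (- 2 * t) * q' (x, t)\<bar> * \<bar>k x t\<bar> \<le> B"
      unfolding B_def using K by (intro mult_mono) auto
    then show ?thesis using True by (simp add: F_def abs_mult)
  qed (simp add: F_def)
  have b'_le: "\<bar>b' x\<bar> \<le> B * T" if x: "x \<in> \<Omega>" for x
  proof -
    have "\<bar>b' x\<bar> \<le> (LINT t|lborel. norm (F x t))"
      unfolding b'_def using integral_norm_bound[of lborel "F x"] by simp
    also have "\<dots> \<le> (LINT t|lborel. B * indicator {0<..<T} t)"
      using Fb[OF x] B T by (intro integral_mono') (auto intro!: integrable_mult_right integrable_real_indicator)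
    also have "\<dots> = B * T" using T by simp
    finally show ?thesis .
  qed
  have "AE x in lebesgue. x \<in> \<Omega> \<longrightarrow> \<bar>b_coeff T p q N \<phi> m n x\<bar> \<le> B * T"
    using AE_completion[OF eq] by eventually_elim (use b'_le in force)
  then show "\<exists>B. AE x in lebesgue_on \<Omega>. \<bar>b_coeff T p q N \<phi> m n x\<bar> \<le> B"
    using \<Omega>l by (intro exI[of _ "B * T"], subst AE_restrict_space_iff) auto
qed

section \<open>The minimization problem\<close>

locale carleman_problem =
  fixes \<Omega> :: "'a::euclidean_space set" and \<nu> :: "'a \<Rightarrow> 'a"
    and T p :: real and q :: "'a \<Rightarrow> real \<Rightarrow> real" and N :: nat
    and x0 :: 'a and \<beta> s M \<epsilon> :: real
    and f :: "nat \<Rightarrow> 'a \<Rightarrow> complex"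
  assumes domain: "smooth_bounded_domain \<Omega>" "outward_unit_normal \<Omega> \<nu>"
    and params: "T > 0" "p > 1" "s > real DIM('a) / 2 + 2" "\<epsilon> > 0" "\<beta> > 0"
    and potential: "essentially_bounded_potential \<Omega> T q"
    and data: "\<And>m. m \<le> N \<Longrightarrow> f m \<in> borel_measurable (surface_measure \<Omega>)"
      "\<And>m. m \<le> N \<Longrightarrow> integrable (surface_measure \<Omega>) (\<lambda>x. (cmod (f m x))\<^sup>2)"
    and x0: "x0 \<notin> closure \<Omega>"
begin

abbreviation "\<sigma> \<equiv> surface_measure \<Omega>"
abbreviation "\<mu> \<equiv> lebesgue_on \<Omega>"
abbreviation "w \<equiv> carleman_weight x0 \<beta>"
abbreviation "H \<equiv> admissible s \<Omega> N M"
abbreviation "Hn \<equiv> Hs_norm s \<Omega>"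
abbreviation "J \<equiv> functional_J \<Omega> \<nu> T p q N x0 \<beta> s f \<epsilon>"
abbreviation "F \<equiv> solution_map \<Omega> \<nu> T p q N x0 \<beta> s M f \<epsilon>"
abbreviation "nrm \<equiv> carleman_norm \<Omega> \<nu> N x0 \<beta> s \<epsilon>"

abbreviation "nd u m \<equiv> normal_deriv \<nu> (u m)"
abbreviation "bdry_sq lam u m \<equiv> sqn \<sigma> (w lam) (\<lambda>x. normal_deriv \<nu> (u m) x - f m x)"

text \<open>Differences of admissible vectors can leave \<open>H\<close> because of the bound by
  \<open>M\<close>; \<open>V\<close> is the linear space in which they are estimated. Components
  with index above \<open>N\<close> stay free, as the norms and functionals in use do not see
  them.\<close>

definition V :: "(nat \<Rightarrow> 'a \<Rightarrow> complex) set" where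
  "V = {u. \<forall>n\<le>N. u n \<in> Hs_space s \<Omega>}"

definition nsq :: "(nat \<Rightarrow> 'a \<Rightarrow> complex) \<Rightarrow> real" where
  "nsq u = (\<Sum>n\<le>N. (Hn (u n))\<^sup>2)"

definition D :: "nat \<Rightarrow> (nat \<Rightarrow> 'a \<Rightarrow> complex) \<Rightarrow> 'a \<Rightarrow> complex" where
  "D m u x = \<i> * (\<Sum>n\<le>N. of_real (s_coeff T m n) * u n x) + laplacian (u m) x"

definition src :: "(nat \<Rightarrow> 'a \<Rightarrow> complex) \<Rightarrow> nat \<Rightarrow> 'a \<Rightarrow> complex" where
  "src \<phi> m x = (\<Sum>n\<le>N. of_real (b_coeff T p q N \<phi> m n x) * \<phi> n x)"

abbreviation "res_sq lam \<phi> u m \<equiv> sqn \<mu> (w lam) (\<lambda>x. D m u x + src \<phi> m x)"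

section \<open>The weight, measurability and pointwise estimates\<close>

lemma open_\<Omega>: "open \<Omega>" and bounded_\<Omega>: "bounded \<Omega>"
  using domain(1) unfolding smooth_bounded_domain_def by auto

lemma space_\<mu>: "space \<mu> = \<Omega>"
  using open_\<Omega> by simp

lemma space_\<sigma>: "space \<sigma> = frontier \<Omega>"
  unfolding surface_measure_def by (simp add: space_restrict_space space_hausdorff_measure)

lemma finite_\<mu>: "finite_measure \<mu>"
  using bounded_\<Omega> open_\<Omega> by (intro finite_measure_lebesgue_on bounded_set_imp_lmeasurable) auto

lemma finite_\<sigma>: "finite_measure \<sigma>"
  by (rule finite_surface_measure[OF domain(1)])

lemma measurable_\<sigma>I: "g \<in> borel_measurable (restrict_space borel (frontier \<Omega>)) \<Longrightarrow> g \<in> borel_measurable \<sigma>"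
  using measurable_cong_sets[OF sets_surface_measure[of \<Omega>] refl] by blast

lemma w_borel: "w lam \<in> borel_measurable borel"
  unfolding carleman_weight_def by measurable

lemma w_\<mu>: "w lam \<in> borel_measurable \<mu>"
  using measurable_restrict_space1[OF measurable_completion[of "w lam" lborel borel]] w_borel by simp

lemma w_\<sigma>: "w lam \<in> borel_measurable \<sigma>"
  by (intro measurable_\<sigma>I measurable_restrict_space1 w_borel)

lemma w_nonneg: "w lam x \<ge> 0"
  unfolding carleman_weight_def by simp

text \<open>\<open>x0\<close> has a positive distance \<open>\<delta>\<close> from the closure, so
  \<open>2 * \<delta> powr (- \<beta>)\<close> bounds the rate at which the exponent changes with
  the parameter. Taking \<open>b = 0\<close>, where the weight is 1, bounds the weight itself;
  taking \<open>b\<close> near \<open>a\<close> compares weights.\<close>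

lemma w_exponent_bound:
  obtains A where "A \<ge> 0" "\<And>a b x. x \<in> closure \<Omega> \<Longrightarrow> w a x \<le> exp (A * \<bar>a - b\<bar>) * w b x"
proof -
  obtain \<delta> where \<delta>: "\<delta> > 0" "\<And>x. x \<in> closure \<Omega> \<Longrightarrow> \<delta> \<le> dist x0 x"
    using separate_point_closed[OF closed_closure x0] by blast
  define A where "A = 2 * \<delta> powr (- \<beta>)"
  show ?thesis
  proof (rule that[of A])
    show "A \<ge> 0" by (simp add: A_def)
    fix a b x assume x: "x \<in> closure \<Omega>"
    have "2 * norm (x - x0) powr (- \<beta>) \<le> A"
      using \<delta>(1) \<delta>(2)[OF x] params(5) unfolding A_def
      by (intro mult_left_mono powr_mono2') (auto simp: dist_norm norm_minus_commute)
    then have "2 * norm (x - x0) powr (- \<beta>) * (a - b) \<le> A * \<bar>a - b\<bar>"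
      by (intro order_trans[OF mult_left_mono[of "a - b" "\<bar>a - b\<bar>"] mult_right_mono]) auto
    then show "w a x \<le> exp (A * \<bar>a - b\<bar>) * w b x"
      unfolding carleman_weight_def by (simp add: exp_add[symmetric] algebra_simps)
  qed
qed

lemma lambda0_nonneg: "lambda0 \<Omega> x0 \<beta> \<ge> 0"
  unfolding lambda0_def by simp

lemma V_D: "u \<in> V \<Longrightarrow> n \<le> N \<Longrightarrow> u n \<in> Hs_space s \<Omega>"
  unfolding V_def by simp

lemma V_diff: "\<lbrakk>u \<in> V; v \<in> V\<rbrakk> \<Longrightarrow> u - v \<in> V"
  unfolding V_def using Hs_space_diff[OF params(3)] by (simp add: fun_diff_def)

lemma V_mid: "\<lbrakk>u \<in> V; v \<in> V\<rbrakk> \<Longrightarrow> (\<lambda>n x. (u n x + v n x) / 2) \<in> V"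
  unfolding V_def using Hs_space_lincomb[OF params(3), of _ \<Omega> _ "1/2" "1/2"] by (simp add: add_divide_distrib)

lemma nsq_nonneg: "nsq u \<ge> 0"
  unfolding nsq_def by (intro sum_nonneg) auto

lemma Hn_le_nsq: "n \<le> N \<Longrightarrow> (Hn (u n))\<^sup>2 \<le> nsq u"
  unfolding nsq_def by (rule member_le_sum) auto

lemma nsq_minus_commute: "\<lbrakk>u \<in> V; v \<in> V\<rbrakk> \<Longrightarrow> nsq (u - v) = nsq (v - u)"
  unfolding nsq_def fun_diff_def
  by (intro sum.cong refl arg_cong[where f = "\<lambda>r. r\<^sup>2"] Hs_norm_minus_commute[OF params(3)] V_D) auto

lemma D_diff: "\<lbrakk>u \<in> V; v \<in> V; m \<le> N; x \<in> \<Omega>\<rbrakk> \<Longrightarrow> D m (u - v) x = D m u x - D m v x"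
  using laplacian_lincomb[OF params(3) V_D V_D open_\<Omega>, of u m v m x 1 "-1"]
  by (simp add: D_def fun_diff_def algebra_simps sum_subtractf)

lemma D_mid: "\<lbrakk>u \<in> V; v \<in> V; m \<le> N; x \<in> \<Omega>\<rbrakk> \<Longrightarrow> D m (\<lambda>n x. (u n x + v n x) / 2) x = (D m u x + D m v x) / 2"
  using laplacian_lincomb[OF params(3) V_D V_D open_\<Omega>, of u m v m x "1/2" "1/2"]
  by (simp add: D_def add_divide_distrib algebra_simps sum.distrib flip: sum_divide_distrib)

lemma nd_diff: "\<lbrakk>u \<in> V; v \<in> V; m \<le> N; x \<in> frontier \<Omega>\<rbrakk> \<Longrightarrow>
    nd (u - v) m x = nd u m x - nd v m x"
  using normal_deriv_lincomb[OF params(3) V_D V_D domain(2), of u m v m x 1 "-1"]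
  by (simp add: fun_diff_def)

lemma nd_mid: "\<lbrakk>u \<in> V; v \<in> V; m \<le> N; x \<in> frontier \<Omega>\<rbrakk> \<Longrightarrow>
    normal_deriv \<nu> (\<lambda>x. (u m x + v m x) / 2) x = (nd u m x + nd v m x) / 2"
  using normal_deriv_lincomb[OF params(3) V_D V_D domain(2), of u m v m x "1/2" "1/2"]
  by (simp add: add_divide_distrib)

lemma operator_bounds:
  obtains C where "C \<ge> 0"
    "\<And>u m x. \<lbrakk>u \<in> V; m \<le> N; x \<in> closure \<Omega>\<rbrakk> \<Longrightarrow> cmod (u m x) \<le> C * sqrt (nsq u)"
    "\<And>u m x. \<lbrakk>u \<in> V; m \<le> N; x \<in> \<Omega>\<rbrakk> \<Longrightarrow> cmod (D m u x) \<le> C * sqrt (nsq u)"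
    "\<And>u m x. \<lbrakk>u \<in> V; m \<le> N; x \<in> frontier \<Omega>\<rbrakk> \<Longrightarrow> cmod (nd u m x) \<le> C * sqrt (nsq u)"
proof -
  obtain K where K: "K \<ge> 0"
    and K1: "\<And>u x. \<lbrakk>u \<in> Hs_space s \<Omega>; x \<in> closure \<Omega>\<rbrakk> \<Longrightarrow> cmod (u x) \<le> K * Hn u"
    and K2: "\<And>u x. \<lbrakk>u \<in> Hs_space s \<Omega>; open \<Omega>; x \<in> \<Omega>\<rbrakk> \<Longrightarrow> cmod (laplacian u x) \<le> K * Hn u"
    and K3: "\<And>u \<nu> x. \<lbrakk>u \<in> Hs_space s \<Omega>; outward_unit_normal \<Omega> \<nu>; x \<in> frontier \<Omega>\<rbrakk> \<Longrightarrow> cmod (normal_deriv \<nu> u x) \<le> K * Hn u"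
    using Hs_norm_sup_bounds[OF params(3), of \<Omega>] by metis
  have Hn: "K * Hn (u m) \<le> K * sqrt (nsq u)" if "m \<le> N" for u m
    using Hn_le_nsq[OF that, of u] K by (intro mult_left_mono real_le_rsqrt)
  \<comment> \<open>\<open>S\<close> dominates the coefficients of the zero order part of
    \<open>D\<close>, the added 1 accounts for the Laplacian; \<open>(S + 1) * K\<close> then bounds
    all three quantities.\<close>
  define S where "S = (\<Sum>m\<le>N. \<Sum>n\<le>N. \<bar>s_coeff T m n\<bar>)"
  have S: "S \<ge> 0" unfolding S_def by (intro sum_nonneg) auto
  have KS: "K * sqrt (nsq u) \<le> (S + 1) * K * sqrt (nsq u)" for u
    using S K nsq_nonneg[of u] mult_right_mono[of 1 "S + 1" "K * sqrt (nsq u)"] by (simp add: mult.assoc)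
  show ?thesis
  proof (rule that[of "(S + 1) * K"])
    show "(S + 1) * K \<ge> 0" using S K by simp
  next
    fix u m x assume u: "u \<in> V" "m \<le> N" and x: "x \<in> closure \<Omega>"
    show "cmod (u m x) \<le> (S + 1) * K * sqrt (nsq u)"
      using K1[OF V_D[OF u] x] Hn[OF u(2), of u] KS[of u] by linarith
  next
    fix u m x assume u: "u \<in> V" "m \<le> N" and x: "x \<in> frontier \<Omega>"
    show "cmod (nd u m x) \<le> (S + 1) * K * sqrt (nsq u)"
      using K3[OF V_D[OF u] domain(2) x] Hn[OF u(2), of u] KS[of u] by linarith
  next
    fix u m x assume u: "u \<in> V" "m \<le> N" and x: "x \<in> \<Omega>"
    have xc: "x \<in> closure \<Omega>" using x closure_subset by auto
    have "cmod (\<Sum>n\<le>N. of_real (s_coeff T m n) * u n x) \<le> (\<Sum>n\<le>N. \<bar>s_coeff T m n\<bar> * (K * sqrt (nsq u)))"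
    proof (rule order_trans[OF norm_sum sum_mono])
      fix n assume n: "n \<in> {..N}"
      have "cmod (u n x) \<le> K * sqrt (nsq u)" using K1[OF V_D[OF u(1), of n] xc] Hn[of n u] n by simp
      then show "cmod (of_real (s_coeff T m n) * u n x) \<le> \<bar>s_coeff T m n\<bar> * (K * sqrt (nsq u))"
        by (simp add: norm_mult mult_left_mono)
    qed
    also have "\<dots> = (\<Sum>n\<le>N. \<bar>s_coeff T m n\<bar>) * (K * sqrt (nsq u))" by (simp add: sum_distrib_right)
    also have "\<dots> \<le> S * (K * sqrt (nsq u))"
      using K nsq_nonneg[of u] u(2) unfolding S_def by (intro mult_right_mono member_le_sum[of m "{..N}" "\<lambda>m. \<Sum>n\<le>N. \<bar>s_coeff T m n\<bar>"] sum_nonneg) auto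
    finally have "cmod (\<Sum>n\<le>N. of_real (s_coeff T m n) * u n x) \<le> S * (K * sqrt (nsq u))" .
    moreover have "cmod (laplacian (u m) x) \<le> K * sqrt (nsq u)"
      using K2[OF V_D[OF u] open_\<Omega> x] Hn[OF u(2), of u] by linarith
    moreover have "cmod (D m u x) \<le> cmod (\<Sum>n\<le>N. of_real (s_coeff T m n) * u n x) + cmod (laplacian (u m) x)"
      unfolding D_def by (rule order_trans[OF norm_triangle_ineq]) (simp add: norm_mult)
    ultimately show "cmod (D m u x) \<le> (S + 1) * K * sqrt (nsq u)" by (simp add: algebra_simps)
  qed
qed

lemma measurable_u: "\<lbrakk>u \<in> V; m \<le> N\<rbrakk> \<Longrightarrow> u m \<in> borel_measurable \<mu>"
  using continuous_on_subset[OF Hs_space_continuous(1)[OF params(3) V_D] closure_subset] open_\<Omega>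
  by (intro continuous_imp_measurable_on_sets_lebesgue) auto

lemma measurable_D: "\<lbrakk>u \<in> V; m \<le> N\<rbrakk> \<Longrightarrow> D m u \<in> borel_measurable \<mu>"
proof (rule continuous_imp_measurable_on_sets_lebesgue)
  assume u: "u \<in> V" "m \<le> N"
  have "continuous_on \<Omega> (u n)" if "n \<le> N" for n
    using Hs_space_continuous(1)[OF params(3) V_D[OF u(1) that]] closure_subset by (rule continuous_on_subset)
  then show "continuous_on \<Omega> (D m u)"
    unfolding D_def using Hs_space_continuous(2)[OF params(3) V_D[OF u] open_\<Omega>]
    by (intro continuous_intros) auto
qed (use open_\<Omega> in simp)

lemma measurable_nd: "\<lbrakk>u \<in> V; m \<le> N\<rbrakk> \<Longrightarrow> nd u m \<in> borel_measurable \<sigma>"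
  using Hs_space_continuous(3)[OF params(3) V_D domain(2)]
  by (intro measurable_\<sigma>I borel_measurable_continuous_on_restrict)

lemma w_bounded:
  obtains W where "W \<ge> 0" "\<And>x. x \<in> closure \<Omega> \<Longrightarrow> w lam x \<le> W"
proof -
  obtain A where "\<And>a b x. x \<in> closure \<Omega> \<Longrightarrow> w a x \<le> exp (A * \<bar>a - b\<bar>) * w b x"
    by (rule w_exponent_bound) blast
  moreover have "w 0 x = 1" for x by (simp add: carleman_weight_def)
  ultimately show ?thesis using that[of "exp (A * \<bar>lam - 0\<bar>)"] by (metis exp_ge_zero mult.right_neutral)
qed

lemma in_closure: "x \<in> \<Omega> \<Longrightarrow> x \<in> closure \<Omega>" "x \<in> frontier \<Omega> \<Longrightarrow> x \<in> closure \<Omega>"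
  using closure_subset by (auto simp: frontier_def)

lemma sq_int_\<mu>I:
  assumes "a \<in> borel_measurable \<mu>" "AE x in \<mu>. cmod (a x) \<le> B"
  shows "sq_int \<mu> (w lam) a"
proof -
  obtain W where W: "\<And>x. x \<in> closure \<Omega> \<Longrightarrow> w lam x \<le> W" using w_bounded by metis
  show ?thesis
    by (rule sq_int_bounded[OF finite_\<mu> w_\<mu> assms(1) _ assms(2), where W = W])
       (rule AE_I2, use W in_closure w_nonneg space_\<mu> in blast)
qed

lemma sq_int_\<sigma>I:
  assumes "a \<in> borel_measurable \<sigma>" "AE x in \<sigma>. cmod (a x) \<le> B"
  shows "sq_int \<sigma> (w lam) a"
proof -
  obtain W where W: "\<And>x. x \<in> closure \<Omega> \<Longrightarrow> w lam x \<le> W" using w_bounded by metis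
  show ?thesis
    by (rule sq_int_bounded[OF finite_\<sigma> w_\<sigma> assms(1) _ assms(2), where W = W])
       (rule AE_I2, use W in_closure w_nonneg space_\<sigma> in blast)
qed

lemma sq_int_u: "\<lbrakk>u \<in> V; m \<le> N\<rbrakk> \<Longrightarrow> sq_int \<mu> (w lam) (u m)"
  and sq_int_D: "\<lbrakk>u \<in> V; m \<le> N\<rbrakk> \<Longrightarrow> sq_int \<mu> (w lam) (D m u)"
  and sq_int_nd: "\<lbrakk>u \<in> V; m \<le> N\<rbrakk> \<Longrightarrow> sq_int \<sigma> (w lam) (nd u m)"
proof -
  assume a: "u \<in> V" "m \<le> N"
  obtain C where C: "\<And>u m x. \<lbrakk>u \<in> V; m \<le> N; x \<in> closure \<Omega>\<rbrakk> \<Longrightarrow> cmod (u m x) \<le> C * sqrt (nsq u)"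
    "\<And>u m x. \<lbrakk>u \<in> V; m \<le> N; x \<in> \<Omega>\<rbrakk> \<Longrightarrow> cmod (D m u x) \<le> C * sqrt (nsq u)"
    "\<And>u m x. \<lbrakk>u \<in> V; m \<le> N; x \<in> frontier \<Omega>\<rbrakk> \<Longrightarrow> cmod (nd u m x) \<le> C * sqrt (nsq u)"
    by (rule operator_bounds) blast
  have "AE x in \<mu>. cmod (u m x) \<le> C * sqrt (nsq u)"
    by (rule AE_I2) (use C(1)[OF a in_closure(1)] space_\<mu> in blast)
  then show "sq_int \<mu> (w lam) (u m)" by (rule sq_int_\<mu>I[OF measurable_u[OF a]])
  have "AE x in \<mu>. cmod (D m u x) \<le> C * sqrt (nsq u)"
    by (rule AE_I2) (use C(2)[OF a] space_\<mu> in blast)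
  then show "sq_int \<mu> (w lam) (D m u)" by (rule sq_int_\<mu>I[OF measurable_D[OF a]])
  have "AE x in \<sigma>. cmod (nd u m x) \<le> C * sqrt (nsq u)"
    by (rule AE_I2) (use C(3)[OF a] space_\<sigma> in blast)
  then show "sq_int \<sigma> (w lam) (nd u m)" by (rule sq_int_\<sigma>I[OF measurable_nd[OF a]])
qed

lemma sq_int_f:
  assumes m: "m \<le> N"
  shows "sq_int \<sigma> (w lam) (f m)"
proof -
  obtain W where W: "W \<ge> 0" "\<And>x. x \<in> closure \<Omega> \<Longrightarrow> w lam x \<le> W" using w_bounded by metis
  note [measurable] = data(1)[OF m] w_\<sigma>
  have "integrable \<sigma> (\<lambda>x. w lam x * (cmod (f m x))\<^sup>2)"
  proof (rule Bochner_Integration.integrable_bound[OF integrable_mult_right[OF data(2)[OF m], of W]])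
    show "AE x in \<sigma>. norm (w lam x * (cmod (f m x))\<^sup>2) \<le> norm (W * (cmod (f m x))\<^sup>2)"
    proof (rule AE_I2)
      fix x assume "x \<in> space \<sigma>"
      then have "w lam x \<le> W" using W(2) in_closure(2) by (simp add: space_\<sigma>)
      then show "norm (w lam x * (cmod (f m x))\<^sup>2) \<le> norm (W * (cmod (f m x))\<^sup>2)"
        using W(1) w_nonneg[of lam x] by (simp add: abs_mult mult_right_mono)
    qed
  qed measurable
  then show ?thesis using data(1)[OF m] unfolding sq_int_def by simp
qed

lemma sq_int_src:
  assumes \<phi>: "\<phi> \<in> V"
  shows "sq_int \<mu> (w lam) (src \<phi> m)"
proof -
  have cont: "continuous_on (closure \<Omega>) (\<phi> l)" if "l \<le> N" for l
    by (rule Hs_space_continuous(1)[OF params(3) V_D[OF \<phi> that]])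
  note b = b_coeff_measurable_bounded[OF open_\<Omega> bounded_\<Omega> params(1,2) potential, of N \<phi> m, OF cont]
  obtain C where C: "C \<ge> 0" "\<And>u m x. \<lbrakk>u \<in> V; m \<le> N; x \<in> closure \<Omega>\<rbrakk> \<Longrightarrow> cmod (u m x) \<le> C * sqrt (nsq u)"
    by (rule operator_bounds) blast
  obtain B where B: "\<And>n. AE x in \<mu>. \<bar>b_coeff T p q N \<phi> m n x\<bar> \<le> B n" using b(2) by metis
  have "AE x in \<mu>. \<forall>n. \<bar>b_coeff T p q N \<phi> m n x\<bar> \<le> B n" using B by (simp add: AE_all_countable)
  then have "AE x in \<mu>. cmod (src \<phi> m x) \<le> (\<Sum>n\<le>N. B n * (C * sqrt (nsq \<phi>)))"
  proof (rule AE_mp, intro AE_I2 impI)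
    fix x assume x: "x \<in> space \<mu>" and Bx: "\<forall>n. \<bar>b_coeff T p q N \<phi> m n x\<bar> \<le> B n"
    show "cmod (src \<phi> m x) \<le> (\<Sum>n\<le>N. B n * (C * sqrt (nsq \<phi>)))"
      unfolding src_def
    proof (rule order_trans[OF norm_sum sum_mono])
      fix n assume n: "n \<in> {..N}"
      have "0 \<le> B n" using Bx[rule_format, of n] by linarith
      moreover have "cmod (\<phi> n x) \<le> C * sqrt (nsq \<phi>)"
        using n x in_closure(1) by (intro C(2) \<phi>) (auto simp: space_\<mu>)
      ultimately show "cmod (of_real (b_coeff T p q N \<phi> m n x) * \<phi> n x) \<le> B n * (C * sqrt (nsq \<phi>))"
        using Bx unfolding norm_mult by (intro mult_mono) auto
    qed
  qed
  moreover have bm: "(\<lambda>x. complex_of_real (b_coeff T p q N \<phi> m n x)) \<in> borel_measurable \<mu>" for n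
    by (rule measurable_compose[OF b(1) borel_measurable_continuous_onI[OF continuous_on_of_real_id]])
  moreover have "src \<phi> m \<in> borel_measurable \<mu>"
    unfolding src_def
    by (intro borel_measurable_sum borel_measurable_times bm measurable_u[OF \<phi>]) auto
  ultimately show ?thesis by (intro sq_int_\<mu>I)
qed

text \<open>The pointwise bounds are integrated over measures of finite mass; the finiteness of the
  surface measure enters here.\<close>

lemma quadratic_bounds:
  obtains K where "K \<ge> 0"
    "\<And>u m. \<lbrakk>u \<in> V; m \<le> N\<rbrakk> \<Longrightarrow> sqn \<mu> (w lam) (u m) \<le> K * nsq u"
    "\<And>u m. \<lbrakk>u \<in> V; m \<le> N\<rbrakk> \<Longrightarrow> sqn \<mu> (w lam) (D m u) \<le> K * nsq u"
    "\<And>u m. \<lbrakk>u \<in> V; m \<le> N\<rbrakk> \<Longrightarrow> sqn \<sigma> (w lam) (nd u m) \<le> K * nsq u"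
proof -
  obtain W where W: "W \<ge> 0" "\<And>x. x \<in> closure \<Omega> \<Longrightarrow> w lam x \<le> W" using w_bounded by metis
  obtain C where C0: "C \<ge> 0" and C: "\<And>u m x. \<lbrakk>u \<in> V; m \<le> N; x \<in> closure \<Omega>\<rbrakk> \<Longrightarrow> cmod (u m x) \<le> C * sqrt (nsq u)"
    "\<And>u m x. \<lbrakk>u \<in> V; m \<le> N; x \<in> \<Omega>\<rbrakk> \<Longrightarrow> cmod (D m u x) \<le> C * sqrt (nsq u)"
    "\<And>u m x. \<lbrakk>u \<in> V; m \<le> N; x \<in> frontier \<Omega>\<rbrakk> \<Longrightarrow> cmod (nd u m x) \<le> C * sqrt (nsq u)"
    by (rule operator_bounds) blast
  define S where "S = measure \<mu> (space \<mu>) + measure \<sigma> (space \<sigma>)"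
  have le: "W * (C * sqrt (nsq u))\<^sup>2 * r \<le> W * C\<^sup>2 * S * nsq u" if "r \<le> S" for u r
  proof -
    have "W * (C * sqrt (nsq u))\<^sup>2 * r = W * C\<^sup>2 * nsq u * r" by (simp add: power_mult_distrib nsq_nonneg)
    also have "\<dots> \<le> W * C\<^sup>2 * nsq u * S" using that W(1) nsq_nonneg by (intro mult_left_mono) auto
    finally show ?thesis by (simp add: mult_ac)
  qed
  have mS: "measure \<mu> (space \<mu>) \<le> S" "measure \<sigma> (space \<sigma>) \<le> S" by (simp_all only: S_def) auto
  have w\<mu>: "0 \<le> w lam x \<and> w lam x \<le> W" if "x \<in> space \<mu>" for x
    using W(2)[OF in_closure(1)] w_nonneg that unfolding space_\<mu> by blast
  have w\<sigma>: "0 \<le> w lam x \<and> w lam x \<le> W" if "x \<in> space \<sigma>" for x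
    using W(2)[OF in_closure(2)] w_nonneg that unfolding space_\<sigma> by blast
  show ?thesis
  proof (rule that[of "W * C\<^sup>2 * S"])
    show "W * C\<^sup>2 * S \<ge> 0" unfolding S_def using W(1) by simp
    fix u m assume u: "u \<in> V" "m \<le> N"
    show "sqn \<mu> (w lam) (u m) \<le> W * C\<^sup>2 * S * nsq u"
      by (rule order_trans[OF sqn_bounded[OF finite_\<mu> w_\<mu> measurable_u[OF u] w\<mu>] le[OF mS(1)]])
         (use C(1)[OF u in_closure(1)] space_\<mu> in auto)
    show "sqn \<mu> (w lam) (D m u) \<le> W * C\<^sup>2 * S * nsq u"
      by (rule order_trans[OF sqn_bounded[OF finite_\<mu> w_\<mu> measurable_D[OF u] w\<mu>] le[OF mS(1)]])
         (use C(2)[OF u] space_\<mu> in auto)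
    show "sqn \<sigma> (w lam) (nd u m) \<le> W * C\<^sup>2 * S * nsq u"
      by (rule order_trans[OF sqn_bounded[OF finite_\<sigma> w_\<sigma> measurable_nd[OF u] w\<sigma>] le[OF mS(2)]])
         (use C(3)[OF u] space_\<sigma> in auto)
  qed
qed

section \<open>Strong convexity and continuity of the functional\<close>

lemma J_eq: "J lam \<phi> u = (\<Sum>m\<le>N. res_sq lam \<phi> u m
    + lam ^ 3 * bdry_sq lam u m + \<epsilon> * (Hn (u m))\<^sup>2)"
  unfolding functional_J_def sqn_def D_def src_def ..

lemma J_nonneg: "lam \<ge> 0 \<Longrightarrow> J lam \<phi> u \<ge> 0"
  unfolding J_eq using params(4) by (intro sum_nonneg add_nonneg_nonneg mult_nonneg_nonneg sqn_nonneg w_nonneg) auto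

lemma sq_int_res: "\<lbrakk>\<phi> \<in> V; u \<in> V; m \<le> N\<rbrakk> \<Longrightarrow> sq_int \<mu> (w lam) (\<lambda>x. D m u x + src \<phi> m x)"
  by (intro sq_int_add w_\<mu> w_nonneg sq_int_D sq_int_src)

lemma sq_int_bdry: "\<lbrakk>u \<in> V; m \<le> N\<rbrakk> \<Longrightarrow> sq_int \<sigma> (w lam) (\<lambda>x. nd u m x - f m x)"
  by (intro sq_int_diff w_\<sigma> w_nonneg sq_int_nd sq_int_f)

text \<open>Residual and boundary term are squared seminorms of expressions affine in
  \<open>u\<close>, hence convex; the gain with factor \<open>\<epsilon> / 4\<close> comes from the
  Sobolev term alone.\<close>

lemma J_midpoint:
  assumes lam: "lam \<ge> 0" and \<phi>: "\<phi> \<in> V" and u: "u \<in> V" and v: "v \<in> V"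
  shows "J lam \<phi> (\<lambda>n x. (u n x + v n x) / 2) + \<epsilon> / 4 * nsq (u - v) \<le> (J lam \<phi> u + J lam \<phi> v) / 2"
proof -
  let ?z = "\<lambda>n x. (u n x + v n x) / 2"
  let ?T = "\<lambda>u m. res_sq lam \<phi> u m
    + lam ^ 3 * bdry_sq lam u m + \<epsilon> * (Hn (u m))\<^sup>2"
  have "?T ?z m + \<epsilon> / 4 * (Hn ((u - v) m))\<^sup>2 \<le> (?T u m + ?T v m) / 2" if m: "m \<le> N" for m
  proof -
    have "res_sq lam \<phi> ?z m = sqn \<mu> (w lam) (\<lambda>x. ((D m u x + src \<phi> m x) + (D m v x + src \<phi> m x)) / 2)"
      by (rule sqn_cong) (simp only: space_\<mu> D_mid[OF u v m], simp add: field_simps)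
    also have "\<dots> \<le> (res_sq lam \<phi> u m + res_sq lam \<phi> v m) / 2"
      by (intro sqn_midpoint w_\<mu> w_nonneg sq_int_res lam \<phi> u v m)
    finally have A: "res_sq lam \<phi> ?z m \<le> \<dots>" .
    have "bdry_sq lam ?z m
      = sqn \<sigma> (w lam) (\<lambda>x. ((nd u m x - f m x) + (nd v m x - f m x)) / 2)"
      by (rule sqn_cong) (simp only: space_\<sigma> nd_mid[OF u v m], simp add: field_simps)
    also have "\<dots> \<le> (bdry_sq lam u m + bdry_sq lam v m) / 2"
      by (intro sqn_midpoint w_\<sigma> w_nonneg sq_int_bdry lam u v m)
    finally have B: "lam ^ 3 * bdry_sq lam ?z m \<le> lam ^ 3 * \<dots>"
      using lam by (intro mult_left_mono) auto
    have C: "\<epsilon> * ((Hn (?z m))\<^sup>2 + (Hn ((u - v) m))\<^sup>2 / 4) \<le> \<epsilon> * (((Hn (u m))\<^sup>2 + (Hn (v m))\<^sup>2) / 2)"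
      using Hs_norm_midpoint[OF params(3) V_D[OF u m] V_D[OF v m]] params(4) unfolding fun_diff_def
      by (intro mult_left_mono) auto
    show ?thesis using A B C by (simp add: field_simps)
  qed
  then have "(\<Sum>m\<le>N. ?T ?z m + \<epsilon> / 4 * (Hn ((u - v) m))\<^sup>2) \<le> (\<Sum>m\<le>N. (?T u m + ?T v m) / 2)"
    by (intro sum_mono) auto
  then show ?thesis
    unfolding J_eq nsq_def sum_distrib_left sum.distrib[symmetric] sum_divide_distrib .
qed

text \<open>Continuity of the functional in its argument. \<open>K\<close> does not depend on
  \<open>\<phi>\<close>, because the source cancels: the residuals of \<open>v\<close> and
  \<open>u\<close> differ by \<open>D m (v - u)\<close>. The boundary data cancel likewise.\<close>

lemma J_weak_triangle:
  assumes lam: "lam \<ge> 0"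
  obtains K where "K \<ge> 0" "\<And>\<phi> u v \<delta>. \<lbrakk>\<phi> \<in> V; u \<in> V; v \<in> V; \<delta> > 0\<rbrakk> \<Longrightarrow>
    J lam \<phi> v \<le> (1 + \<delta>) * J lam \<phi> u + (1 + 1 / \<delta>) * (K * nsq (v - u))"
proof -
  obtain K where K: "K \<ge> 0"
    and KD: "\<And>u m. \<lbrakk>u \<in> V; m \<le> N\<rbrakk> \<Longrightarrow> sqn \<mu> (w lam) (D m u) \<le> K * nsq u"
    and Kn: "\<And>u m. \<lbrakk>u \<in> V; m \<le> N\<rbrakk> \<Longrightarrow> sqn \<sigma> (w lam) (nd u m) \<le> K * nsq u"
    using quadratic_bounds[of lam] by metis
  show ?thesis
  \<comment> \<open>Residual, boundary and Sobolev term contribute \<open>K\<close>,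
    \<open>lam ^ 3 * K\<close> and \<open>\<epsilon>\<close> for each of the \<open>N + 1\<close>
    components.\<close>
  proof (rule that[of "real (Suc N) * (K + lam ^ 3 * K + \<epsilon>)"])
    show "real (Suc N) * (K + lam ^ 3 * K + \<epsilon>) \<ge> 0" using K lam params(4) by simp
    fix \<phi> u v and \<delta> :: real assume \<phi>: "\<phi> \<in> V" and u: "u \<in> V" and v: "v \<in> V" and \<delta>: "\<delta> > 0"
    let ?T = "\<lambda>u m. res_sq lam \<phi> u m
      + lam ^ 3 * bdry_sq lam u m + \<epsilon> * (Hn (u m))\<^sup>2"
    have "?T v m \<le> (1 + \<delta>) * ?T u m + (1 + 1 / \<delta>) * ((K + lam ^ 3 * K + \<epsilon>) * nsq (v - u))" if m: "m \<le> N" for m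
    proof -
      note vu = V_diff[OF v u]
      have \<delta>': "1 + 1 / \<delta> \<ge> 0" using \<delta> by simp
      have "res_sq lam \<phi> v m = sqn \<mu> (w lam) (\<lambda>x. (D m u x + src \<phi> m x) + D m (v - u) x)"
        by (rule sqn_cong) (simp only: space_\<mu> D_diff[OF v u m], simp)
      also have "\<dots> \<le> (1 + \<delta>) * res_sq lam \<phi> u m + (1 + 1 / \<delta>) * sqn \<mu> (w lam) (D m (v - u))"
        by (intro sqn_weak_triangle w_\<mu> w_nonneg sq_int_res sq_int_D vu lam \<phi> u m \<delta>)
      also have "\<dots> \<le> (1 + \<delta>) * res_sq lam \<phi> u m + (1 + 1 / \<delta>) * (K * nsq (v - u))"
        by (intro add_left_mono mult_left_mono KD vu m \<delta>')
      finally have A: "res_sq lam \<phi> v m \<le> \<dots>" .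
      have "bdry_sq lam v m = sqn \<sigma> (w lam) (\<lambda>x. (nd u m x - f m x) + nd (v - u) m x)"
        by (rule sqn_cong) (simp only: space_\<sigma> nd_diff[OF v u m], simp)
      also have "\<dots> \<le> (1 + \<delta>) * bdry_sq lam u m + (1 + 1 / \<delta>) * sqn \<sigma> (w lam) (nd (v - u) m)"
        by (intro sqn_weak_triangle w_\<sigma> w_nonneg sq_int_bdry sq_int_nd vu lam u m \<delta>)
      also have "\<dots> \<le> (1 + \<delta>) * bdry_sq lam u m + (1 + 1 / \<delta>) * (K * nsq (v - u))"
        by (intro add_left_mono mult_left_mono Kn vu m \<delta>')
      finally have "lam ^ 3 * bdry_sq lam v m \<le> lam ^ 3 * \<dots>"
        using lam by (intro mult_left_mono) auto
      then have B: "lam ^ 3 * bdry_sq lam v m \<le>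
         (1 + \<delta>) * (lam ^ 3 * bdry_sq lam u m) + (1 + 1 / \<delta>) * (lam ^ 3 * K * nsq (v - u))"
        by (simp only: distrib_left mult_ac)
      have "(Hn (\<lambda>x. u m x + (v - u) m x))\<^sup>2 \<le> (1 + \<delta>) * (Hn (u m))\<^sup>2 + (1 + 1 / \<delta>) * (Hn ((v - u) m))\<^sup>2"
        by (rule Hs_norm_weak_triangle[OF params(3) V_D[OF u m] V_D[OF vu m] \<delta>])
      also have "\<dots> \<le> (1 + \<delta>) * (Hn (u m))\<^sup>2 + (1 + 1 / \<delta>) * nsq (v - u)"
        by (intro add_left_mono mult_left_mono Hn_le_nsq m \<delta>')
      finally have "\<epsilon> * (Hn (v m))\<^sup>2 \<le> \<epsilon> * \<dots>" using params(4) by (intro mult_left_mono) (auto simp: fun_diff_def)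
      then have C: "\<epsilon> * (Hn (v m))\<^sup>2 \<le> (1 + \<delta>) * (\<epsilon> * (Hn (u m))\<^sup>2) + (1 + 1 / \<delta>) * (\<epsilon> * nsq (v - u))"
        by (simp only: distrib_left mult_ac)
      show ?thesis using add_mono[OF add_mono[OF A B] C] by (simp only: distrib_left distrib_right add_ac mult_ac)
    qed
    then have "(\<Sum>m\<le>N. ?T v m) \<le> (\<Sum>m\<le>N. (1 + \<delta>) * ?T u m + (1 + 1 / \<delta>) * ((K + lam ^ 3 * K + \<epsilon>) * nsq (v - u)))"
      by (intro sum_mono) auto
    also have "\<dots> = (1 + \<delta>) * (\<Sum>m\<le>N. ?T u m) + real (Suc N) * ((1 + 1 / \<delta>) * ((K + lam ^ 3 * K + \<epsilon>) * nsq (v - u)))"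
      by (subst sum.distrib, subst sum_distrib_left[symmetric]) simp
    also have "real (Suc N) * ((1 + 1 / \<delta>) * ((K + lam ^ 3 * K + \<epsilon>) * nsq (v - u)))
       = (1 + 1 / \<delta>) * (real (Suc N) * (K + lam ^ 3 * K + \<epsilon>) * nsq (v - u))" by (simp only: mult_ac)
    finally show "J lam \<phi> v \<le> (1 + \<delta>) * J lam \<phi> u + (1 + 1 / \<delta>) * (real (Suc N) * (K + lam ^ 3 * K + \<epsilon>) * nsq (v - u))"
      unfolding J_eq .
  qed
qed

section \<open>The weighted norm and its dependence on the parameter\<close>

definition NQ :: "real \<Rightarrow> (nat \<Rightarrow> 'a \<Rightarrow> complex) \<Rightarrow> real" where
  "NQ lam u = (\<Sum>n\<le>N. sqn \<mu> (w lam) (u n) + 2 * sqn \<sigma> (w lam) (nd u n) + 2 * \<epsilon> / lam ^ 3 * (Hn (u n))\<^sup>2)"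

text \<open>The sum over components is pulled out of the integrals by means of the integrability of
  each square, which membership in \<open>V\<close> provides.\<close>

lemma nrm_eq:
  assumes lam: "lam \<ge> 0" and u: "u \<in> V"
  shows "nrm lam u = sqrt (NQ lam u)"
proof -
  have "(LINT x|\<mu>. w lam x * (\<Sum>n\<le>N. (cmod (u n x))\<^sup>2)) = (\<Sum>n\<le>N. sqn \<mu> (w lam) (u n))"
    unfolding sqn_def sum_distrib_left using sq_int_u[OF u]
    by (intro Bochner_Integration.integral_sum) (auto simp: sq_int_def)
  moreover have "(LINT x|\<sigma>. w lam x * (\<Sum>n\<le>N. (cmod (nd u n x))\<^sup>2)) = (\<Sum>n\<le>N. sqn \<sigma> (w lam) (nd u n))"
    unfolding sqn_def sum_distrib_left using sq_int_nd[OF u]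
    by (intro Bochner_Integration.integral_sum) (auto simp: sq_int_def)
  ultimately show ?thesis
    unfolding carleman_norm_def NQ_def by (simp add: sum.distrib sum_distrib_left)
qed

lemma NQ_nonneg: "lam \<ge> 0 \<Longrightarrow> NQ lam u \<ge> 0"
  unfolding NQ_def using params(4) by (intro sum_nonneg add_nonneg_nonneg mult_nonneg_nonneg sqn_nonneg w_nonneg) auto

lemma nrm_nonneg: "lam \<ge> 0 \<Longrightarrow> u \<in> V \<Longrightarrow> nrm lam u \<ge> 0"
  by (simp add: nrm_eq NQ_nonneg)

text \<open>All terms obey the weak inequality with the same \<open>\<delta>\<close>, so it survives
  summation; the optimal \<open>\<delta>\<close> is chosen only for the total.\<close>

lemma nrm_triangle:
  assumes lam: "lam \<ge> 0" and u: "u \<in> V" and v: "v \<in> V"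
  shows "nrm lam u \<le> nrm lam v + nrm lam (u - v)"
proof -
  note uv = V_diff[OF u v]
  have "sqrt (NQ lam u) \<le> sqrt (NQ lam v) + sqrt (NQ lam (u - v))"
  proof (rule sqrt_triangle_from_weak[OF NQ_nonneg[OF lam] NQ_nonneg[OF lam]])
    fix \<delta> :: real assume \<delta>: "\<delta> > 0"
    let ?T = "\<lambda>u n. sqn \<mu> (w lam) (u n) + 2 * sqn \<sigma> (w lam) (nd u n) + 2 * \<epsilon> / lam ^ 3 * (Hn (u n))\<^sup>2"
    have "?T u m \<le> (1 + \<delta>) * ?T v m + (1 + 1 / \<delta>) * ?T (u - v) m" if m: "m \<le> N" for m
    proof -
      have eq: "(\<lambda>x. v m x + (u - v) m x) = u m" by (simp add: fun_eq_iff)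
      have A: "sqn \<mu> (w lam) (\<lambda>x. v m x + (u - v) m x) \<le> (1 + \<delta>) * sqn \<mu> (w lam) (v m) + (1 + 1 / \<delta>) * sqn \<mu> (w lam) ((u - v) m)"
        by (intro sqn_weak_triangle w_\<mu> w_nonneg sq_int_u uv lam v m \<delta>)
      have "sqn \<sigma> (w lam) (nd u m) = sqn \<sigma> (w lam) (\<lambda>x. nd v m x + nd (u - v) m x)"
        by (rule sqn_cong) (simp only: space_\<sigma> nd_diff[OF u v m], simp)
      also have "\<dots> \<le> (1 + \<delta>) * sqn \<sigma> (w lam) (nd v m) + (1 + 1 / \<delta>) * sqn \<sigma> (w lam) (nd (u - v) m)"
        by (intro sqn_weak_triangle w_\<sigma> w_nonneg sq_int_nd uv lam v m \<delta>)
      finally have "2 * sqn \<sigma> (w lam) (nd u m) \<le> 2 * \<dots>" by simp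
      then have B: "2 * sqn \<sigma> (w lam) (nd u m) \<le> (1 + \<delta>) * (2 * sqn \<sigma> (w lam) (nd v m)) + (1 + 1 / \<delta>) * (2 * sqn \<sigma> (w lam) (nd (u - v) m))"
        by (simp only: distrib_left mult_ac)
      have "2 * \<epsilon> / lam ^ 3 * (Hn (\<lambda>x. v m x + (u - v) m x))\<^sup>2 \<le> 2 * \<epsilon> / lam ^ 3 * ((1 + \<delta>) * (Hn (v m))\<^sup>2 + (1 + 1 / \<delta>) * (Hn ((u - v) m))\<^sup>2)"
        using params(4) lam by (intro mult_left_mono Hs_norm_weak_triangle[OF params(3) V_D[OF v m] V_D[OF uv m] \<delta>]) auto
      then have C: "2 * \<epsilon> / lam ^ 3 * (Hn (u m))\<^sup>2 \<le> (1 + \<delta>) * (2 * \<epsilon> / lam ^ 3 * (Hn (v m))\<^sup>2) + (1 + 1 / \<delta>) * (2 * \<epsilon> / lam ^ 3 * (Hn ((u - v) m))\<^sup>2)"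
        unfolding eq by (simp only: distrib_left mult.left_commute[of "2 * \<epsilon> / lam ^ 3"])
      show ?thesis using add_mono[OF add_mono[OF A B] C] unfolding eq by (simp only: distrib_left add_ac mult_ac)
    qed
    then have "(\<Sum>m\<le>N. ?T u m) \<le> (\<Sum>m\<le>N. (1 + \<delta>) * ?T v m + (1 + 1 / \<delta>) * ?T (u - v) m)" by (intro sum_mono) auto
    then show "NQ lam u \<le> (1 + \<delta>) * NQ lam v + (1 + 1 / \<delta>) * NQ lam (u - v)"
      unfolding NQ_def sum.distrib[of "\<lambda>m. (1 + \<delta>) * ?T v m"] sum_distrib_left[symmetric] .
  qed
  then show ?thesis using lam u v uv by (simp add: nrm_eq)
qed

text \<open>Passing from \<open>b\<close> to \<open>a\<close> costs an exponential factor in the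
  weight and a ratio of cubes in the coefficients. \<open>J\<close> carries \<open>lam ^ 3\<close>
  and \<open>NQ\<close> its inverse, hence the maximum of both ratios. The total factor is symmetric
  in \<open>a\<close> and \<open>b\<close> and tends to 1 as \<open>a\<close> approaches
  \<open>b\<close>.\<close>

lemma weight_comparison:
  obtains A where
    "\<And>a b \<phi> u. \<lbrakk>0 < a; 0 < b; \<phi> \<in> V; u \<in> V\<rbrakk> \<Longrightarrow> J a \<phi> u \<le> exp (A * \<bar>a - b\<bar>) * (max (a / b) (b / a)) ^ 3 * J b \<phi> u"
    "\<And>a b u. \<lbrakk>0 < a; 0 < b; u \<in> V\<rbrakk> \<Longrightarrow> NQ a u \<le> exp (A * \<bar>a - b\<bar>) * (max (a / b) (b / a)) ^ 3 * NQ b u"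
proof -
  obtain A where A: "A \<ge> 0" and w_le: "\<And>a b x. x \<in> closure \<Omega> \<Longrightarrow> w a x \<le> exp (A * \<bar>a - b\<bar>) * w b x"
    by (rule w_exponent_bound) blast
  have scaled: "sq_int \<kappa> (\<lambda>x. c * w b x) h" if "sq_int \<kappa> (w b) h" for \<kappa> c b h
    using that unfolding sq_int_def by (simp add: mult.assoc)
  have sqn_le: "sqn \<kappa> (w a) h \<le> exp (A * \<bar>a - b\<bar>) * sqn \<kappa> (w b) h"
    if "space \<kappa> \<subseteq> closure \<Omega>" "sq_int \<kappa> (w a) h" "sq_int \<kappa> (w b) h" for \<kappa> a b h
    unfolding sqn_scale_weight[symmetric]
    by (rule sqn_mono_weight[OF that(2) scaled[OF that(3)] w_le[OF subsetD[OF that(1)]]])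
  have sp: "space \<mu> \<subseteq> closure \<Omega>" "space \<sigma> \<subseteq> closure \<Omega>"
    unfolding space_\<mu> space_\<sigma> using in_closure by blast+
  \<comment> \<open>The common shape of both sums: the coefficients of \<open>Y\<close> and
    \<open>Z\<close> are \<open>lam ^ 3\<close> and \<open>\<epsilon>\<close> for \<open>J\<close>,
    and 2 and \<open>2 * \<epsilon> / lam ^ 3\<close> for \<open>NQ\<close>. The Sobolev terms
    \<open>Z\<close> carry no weight, so \<open>e >= 1\<close> is used for them.\<close>
  have main: "(\<Sum>n\<le>N. X n + p * Y n + p' * Z n) \<le> e * r * (\<Sum>n\<le>N. X' n + q * Y' n + q' * Z n)"
    if "e \<ge> 1" "r \<ge> 1" "p \<ge> 0" "p \<le> r * q" "p' \<le> r * q'" "q \<ge> 0" "q' \<ge> 0"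
      "\<And>n. n \<le> N \<Longrightarrow> X n \<le> e * X' n" "\<And>n. n \<le> N \<Longrightarrow> Y n \<le> e * Y' n" "\<And>n. X' n \<ge> 0" "\<And>n. Y' n \<ge> 0" "\<And>n. Z n \<ge> 0"
    for X Y Z X' Y' :: "nat \<Rightarrow> real" and p p' q q' e r :: real
    unfolding sum_distrib_left
  proof (rule sum_mono)
    fix n assume "n \<in> {..N}"
    then have n: "n \<le> N" by simp
    have "1 * (e * X' n) \<le> r * (e * X' n)" using that(1,2,10) by (intro mult_right_mono mult_nonneg_nonneg) auto
    then have a: "X n \<le> e * r * X' n" using that(8)[OF n] by (simp only: mult_ac mult_1_left)
    have "p * Y n \<le> p * (e * Y' n)" using that(3) that(9)[OF n] by (rule mult_left_mono[rotated])
    also have "\<dots> \<le> (r * q) * (e * Y' n)" using that(1,4,11) by (intro mult_right_mono mult_nonneg_nonneg) auto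
    finally have b: "p * Y n \<le> e * r * (q * Y' n)" by (simp only: mult_ac)
    have "p' * Z n \<le> (r * q') * Z n" using that(5,12) by (intro mult_right_mono) auto
    also have "\<dots> = 1 * ((r * q') * Z n)" by simp
    also have "\<dots> \<le> e * ((r * q') * Z n)" using that(1,2,7,12) by (intro mult_right_mono mult_nonneg_nonneg) auto
    finally have c: "p' * Z n \<le> e * r * (q' * Z n)" by (simp only: mult_ac)
    show "X n + p * Y n + p' * Z n \<le> e * r * (X' n + q * Y' n + q' * Z n)"
      using add_mono[OF add_mono[OF a b] c] by (simp only: distrib_left)
  qed
  have r: "1 \<le> (max (a / b) (b / a)) ^ 3" "a ^ 3 \<le> (max (a / b) (b / a)) ^ 3 * b ^ 3"
    "1 / a ^ 3 \<le> (max (a / b) (b / a)) ^ 3 * (1 / b ^ 3)" if "0 < a" "0 < b" for a b :: real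
  proof -
    let ?m = "max (a / b) (b / a)"
    have "1 \<le> ?m" using that by (cases "a \<le> b") (auto simp: le_max_iff_disj)
    then show "1 \<le> ?m ^ 3" by (rule one_le_power)
    have "(a / b) ^ 3 \<le> ?m ^ 3" "(b / a) ^ 3 \<le> ?m ^ 3" using that by (auto intro!: power_mono)
    then show "a ^ 3 \<le> ?m ^ 3 * b ^ 3" "1 / a ^ 3 \<le> ?m ^ 3 * (1 / b ^ 3)"
      using that by (simp_all add: power_divide field_simps)
  qed
  show ?thesis
  proof (rule that[of A])
    fix a b :: real and \<phi> u assume ab: "0 < a" "0 < b" and V: "\<phi> \<in> V" "u \<in> V"
    have nn: "a \<ge> 0" "b \<ge> 0" using ab by auto
    show "J a \<phi> u \<le> exp (A * \<bar>a - b\<bar>) * (max (a / b) (b / a)) ^ 3 * J b \<phi> u"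
      unfolding J_eq
    proof (rule main[OF _ r(1)[OF ab] _ r(2)[OF ab]])
      show "res_sq a \<phi> u m \<le> exp (A * \<bar>a - b\<bar>) * res_sq b \<phi> u m" if m: "m \<le> N" for m
        by (rule sqn_le[OF sp(1) sq_int_res[OF V m] sq_int_res[OF V m]])
      show "bdry_sq a u m \<le> exp (A * \<bar>a - b\<bar>) * bdry_sq b u m" if m: "m \<le> N" for m
        by (rule sqn_le[OF sp(2) sq_int_bdry[OF V(2) m] sq_int_bdry[OF V(2) m]])
      show "\<epsilon> \<le> (max (a / b) (b / a)) ^ 3 * \<epsilon>"
        using mult_right_mono[OF r(1)[OF ab], of \<epsilon>] params(4) by simp
    qed (use A nn params(4) w_nonneg in \<open>auto intro: sqn_nonneg\<close>)
  next
    fix a b :: real and u assume ab: "0 < a" "0 < b" and V: "u \<in> V"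
    have nn: "a \<ge> 0" "b \<ge> 0" using ab by auto
    show "NQ a u \<le> exp (A * \<bar>a - b\<bar>) * (max (a / b) (b / a)) ^ 3 * NQ b u"
      unfolding NQ_def
    proof (rule main[OF _ r(1)[OF ab]])
      show "sqn \<mu> (w a) (u n) \<le> exp (A * \<bar>a - b\<bar>) * sqn \<mu> (w b) (u n)" if n: "n \<le> N" for n
        by (rule sqn_le[OF sp(1) sq_int_u[OF V n] sq_int_u[OF V n]])
      show "sqn \<sigma> (w a) (nd u n) \<le> exp (A * \<bar>a - b\<bar>) * sqn \<sigma> (w b) (nd u n)" if n: "n \<le> N" for n
        by (rule sqn_le[OF sp(2) sq_int_nd[OF V n] sq_int_nd[OF V n]])
      show "2 \<le> (max (a / b) (b / a)) ^ 3 * 2" using r(1)[OF ab] by simp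
      show "2 * \<epsilon> / a ^ 3 \<le> (max (a / b) (b / a)) ^ 3 * (2 * \<epsilon> / b ^ 3)"
        using mult_left_mono[OF r(3)[OF ab], of "2 * \<epsilon>"] params(4) by (simp add: mult_ac)
    qed (use A nn params(4) w_nonneg in \<open>auto intro: sqn_nonneg\<close>)
  qed
qed

text \<open>The lower bound comes from the Sobolev term alone, with
  \<open>c = 2 * \<epsilon> / lam ^ 3\<close>; the upper bound is the embedding.\<close>

lemma NQ_nsq_equiv:
  assumes lam: "lam > 0"
  obtains c K where "c > 0" "K \<ge> 0" "\<And>u. u \<in> V \<Longrightarrow> c * nsq u \<le> NQ lam u" "\<And>u. u \<in> V \<Longrightarrow> NQ lam u \<le> K * nsq u"
proof -
  have nn: "lam \<ge> 0" using lam by simp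
  obtain K where K: "K \<ge> 0"
    and Ku: "\<And>u m. \<lbrakk>u \<in> V; m \<le> N\<rbrakk> \<Longrightarrow> sqn \<mu> (w lam) (u m) \<le> K * nsq u"
    and Kn: "\<And>u m. \<lbrakk>u \<in> V; m \<le> N\<rbrakk> \<Longrightarrow> sqn \<sigma> (w lam) (nd u m) \<le> K * nsq u"
    by (rule quadratic_bounds[of lam]) blast
  define c where "c = 2 * \<epsilon> / lam ^ 3"
  have c: "c > 0" using lam params(4) by (simp add: c_def)
  show ?thesis
  proof (rule that[OF c])
    show "real (Suc N) * (K + 2 * K + c) \<ge> 0" using K c by simp
    fix u assume u: "u \<in> V"
    have "(\<Sum>n\<le>N. c * (Hn (u n))\<^sup>2) \<le> NQ lam u"
      unfolding NQ_def c_def[symmetric]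
      using sqn_nonneg[of "w lam" \<mu>, OF w_nonneg] sqn_nonneg[of "w lam" \<sigma>, OF w_nonneg] by (intro sum_mono) simp
    then show "c * nsq u \<le> NQ lam u" unfolding nsq_def sum_distrib_left .
    have "NQ lam u \<le> (\<Sum>n\<le>N. (K + 2 * K + c) * nsq u)"
      unfolding NQ_def c_def[symmetric]
    proof (rule sum_mono)
      fix n assume "n \<in> {..N}"
      then have n: "n \<le> N" by simp
      have "c * (Hn (u n))\<^sup>2 \<le> c * nsq u" using Hn_le_nsq[OF n] c by simp
      then show "sqn \<mu> (w lam) (u n) + 2 * sqn \<sigma> (w lam) (nd u n) + c * (Hn (u n))\<^sup>2 \<le> (K + 2 * K + c) * nsq u"
        using Ku[OF u n] Kn[OF u n] by (simp add: distrib_right)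
    qed
    then show "NQ lam u \<le> real (Suc N) * (K + 2 * K + c) * nsq u" by simp
  qed
qed

section \<open>Convexity and completeness of the admissible set, existence of minimizers\<close>

lemma H_subset_V: "\<phi> \<in> H \<Longrightarrow> \<phi> \<in> V"
  unfolding admissible_def V_def by simp

text \<open>The sup bound settles the closure of \<open>\<Omega>\<close> for indices up to
  \<open>N\<close>; everywhere else both sides are 0 by the conventions on representatives.\<close>

lemma H_eqI:
  assumes u: "u \<in> H" and v: "v \<in> H" and "nsq (u - v) = 0"
  shows "u = v"
proof (intro ext)
  fix n x
  obtain C where C: "\<And>u m x. \<lbrakk>u \<in> V; m \<le> N; x \<in> closure \<Omega>\<rbrakk> \<Longrightarrow> cmod (u m x) \<le> C * sqrt (nsq u)"
    by (rule operator_bounds) blast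
  show "u n x = v n x"
  proof (cases "n \<le> N")
    case n: True
    show ?thesis
    proof (cases "x \<in> closure \<Omega>")
      case True
      then have "cmod ((u - v) n x) \<le> 0"
        using C[OF V_diff[OF H_subset_V[OF u] H_subset_V[OF v]] n True] assms(3) by simp
      then show ?thesis by simp
    next
      case False
      then show ?thesis using u v n unfolding admissible_def Hs_space_def by auto
    qed
  next
    case False
    then show ?thesis using u v unfolding admissible_def by auto
  qed
qed

text \<open>Minkowski's inequality in the component index makes the pointwise bound by
  \<open>M\<close> a convex constraint.\<close>

lemma H_midpoint:
  assumes u: "u \<in> H" and v: "v \<in> H"
  shows "(\<lambda>n x. (u n x + v n x) / 2) \<in> H"
proof -
  have le: "L2_set (\<lambda>n. cmod ((u n x + v n x) / 2)) {..N} \<le> M"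
    if "L2_set (\<lambda>n. cmod (u n x)) {..N} \<le> M" "L2_set (\<lambda>n. cmod (v n x)) {..N} \<le> M" for x
  proof -
    have "L2_set (\<lambda>n. cmod ((u n x + v n x) / 2)) {..N} \<le> L2_set (\<lambda>n. 1 / 2 * cmod (u n x) + 1 / 2 * cmod (v n x)) {..N}"
    proof (rule L2_set_mono)
      show "cmod ((u n x + v n x) / 2) \<le> 1 / 2 * cmod (u n x) + 1 / 2 * cmod (v n x)" for n
        using norm_triangle_ineq[of "u n x" "v n x"] by (simp add: norm_divide)
    qed simp
    also have "\<dots> \<le> L2_set (\<lambda>n. 1 / 2 * cmod (u n x)) {..N} + L2_set (\<lambda>n. 1 / 2 * cmod (v n x)) {..N}"
      by (rule L2_set_triangle_ineq)
    also have "\<dots> = 1 / 2 * L2_set (\<lambda>n. cmod (u n x)) {..N} + 1 / 2 * L2_set (\<lambda>n. cmod (v n x)) {..N}"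
    proof -
      have "1 / 2 * L2_set g {..N} = L2_set (\<lambda>n. 1 / 2 * g n) {..N}" for g :: "nat \<Rightarrow> real"
        by (rule L2_set_right_distrib) simp
      then show ?thesis by (simp only:)
    qed
    also have "\<dots> \<le> M" using that by simp
    finally show ?thesis .
  qed
  have "AE x in \<mu>. L2_set (\<lambda>n. cmod (u n x)) {..N} \<le> M" "AE x in \<mu>. L2_set (\<lambda>n. cmod (v n x)) {..N} \<le> M"
    using u v unfolding admissible_def by auto
  then have "AE x in \<mu>. L2_set (\<lambda>n. cmod ((u n x + v n x) / 2)) {..N} \<le> M"
    by eventually_elim (rule le)
  then show ?thesis
    using V_mid[OF H_subset_V[OF u] H_subset_V[OF v]] u v unfolding admissible_def V_def by simp
qed

text \<open>By the embedding, convergence in \<open>nsq\<close> implies pointwise convergence on the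
  closure, so the boundary condition and the bound by \<open>M\<close> pass to the limit.\<close>

lemma H_complete:
  assumes u: "\<And>k. u k \<in> H" and \<theta>: "0 < \<theta>" "\<theta> < 1" and C: "C \<ge> 0"
    and step: "\<And>k. nsq (u (Suc k) - u k) \<le> (C * \<theta> ^ k)\<^sup>2"
  shows "\<exists>v\<in>H. (\<lambda>k. nsq (u k - v)) \<longlonglongrightarrow> 0"
proof -
  have uV: "u k \<in> V" for k using u by (rule H_subset_V)
  have "\<exists>v\<in>Hs_space s \<Omega>. (\<lambda>k. Hn (\<lambda>x. u k n x - v x)) \<longlonglongrightarrow> 0" if n: "n \<le> N" for n
  proof (rule Hs_space_complete[OF params(3) V_D[OF uV n] \<theta> C])
    fix k
    have "(Hn ((u (Suc k) - u k) n))\<^sup>2 \<le> (C * \<theta> ^ k)\<^sup>2" by (rule order_trans[OF Hn_le_nsq[OF n] step])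
    then have "Hn ((u (Suc k) - u k) n) \<le> C * \<theta> ^ k" by (rule power2_le_imp_le) (use C \<theta> in simp)
    then show "Hn (\<lambda>x. u (Suc k) n x - u k n x) \<le> C * \<theta> ^ k" by (simp add: fun_diff_def)
  qed
  then obtain v0 where v0: "\<And>n. n \<le> N \<Longrightarrow> v0 n \<in> Hs_space s \<Omega>"
    and lim: "\<And>n. n \<le> N \<Longrightarrow> (\<lambda>k. Hn (\<lambda>x. u k n x - v0 n x)) \<longlonglongrightarrow> 0" by metis
  define v where "v n = (if n \<le> N then v0 n else (\<lambda>x. 0))" for n
  have vV: "v \<in> V" using v0 by (simp add: V_def v_def)
  have conv: "(\<lambda>k. nsq (u k - v)) \<longlonglongrightarrow> 0"
  proof -
    have "(\<lambda>k. (Hn ((u k - v) n))\<^sup>2) \<longlonglongrightarrow> 0\<^sup>2" if n: "n \<in> {..N}" for n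
    proof -
      have "(u k - v) n = (\<lambda>x. u k n x - v0 n x)" for k using n by (simp add: fun_eq_iff v_def)
      then show ?thesis using n by (simp only: atMost_iff) (rule tendsto_power[OF lim])
    qed
    then have "(\<lambda>k. \<Sum>n\<le>N. (Hn ((u k - v) n))\<^sup>2) \<longlonglongrightarrow> (\<Sum>n\<le>N. 0\<^sup>2)" by (rule tendsto_sum)
    then show ?thesis unfolding nsq_def by simp
  qed
  obtain K where K: "\<And>u m x. \<lbrakk>u \<in> V; m \<le> N; x \<in> closure \<Omega>\<rbrakk> \<Longrightarrow> cmod (u m x) \<le> K * sqrt (nsq u)"
    by (rule operator_bounds) blast
  have pt: "(\<lambda>k. u k n x) \<longlonglongrightarrow> v n x" if n: "n \<le> N" and x: "x \<in> closure \<Omega>" for n x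
  proof -
    have lim0: "(\<lambda>k. K * sqrt (nsq (u k - v))) \<longlonglongrightarrow> 0"
      using tendsto_mult[OF tendsto_const[of K] tendsto_real_sqrt[OF conv]] by simp
    have "norm (u k n x - v n x) \<le> K * sqrt (nsq (u k - v))" for k
      using K[OF V_diff[OF uV[of k] vV] n x] by simp
    then have "(\<lambda>k. u k n x - v n x) \<longlonglongrightarrow> 0"
      by (intro Lim_null_comparison[OF _ lim0] always_eventually allI)
    then show ?thesis by (simp add: LIM_zero_iff)
  qed
  have bdry: "v n x = 0" if "n \<le> N" "x \<in> frontier \<Omega>" for n x
  proof -
    have "u k n x = 0" for k using u[of k] that unfolding admissible_def by simp
    then show ?thesis using pt[OF that(1) in_closure(2)[OF that(2)]] by (simp add: LIMSEQ_const_iff)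
  qed
  \<comment> \<open>A single null set for all \<open>k\<close>, so that the bound can be followed
    along the sequence at a fixed point.\<close>
  have "AE x in \<mu>. \<forall>k. L2_set (\<lambda>n. cmod (u k n x)) {..N} \<le> M"
    unfolding AE_all_countable
  proof
    show "AE x in \<mu>. L2_set (\<lambda>n. cmod (u k n x)) {..N} \<le> M" for k
      using u[of k] unfolding admissible_def by simp
  qed
  moreover have "AE x in \<mu>. x \<in> \<Omega>" by (rule AE_I2) (simp only: space_\<mu>)
  ultimately have "AE x in \<mu>. L2_set (\<lambda>n. cmod (v n x)) {..N} \<le> M"
  proof eventually_elim
    case (elim x)
    have "(\<lambda>k. L2_set (\<lambda>n. cmod (u k n x)) {..N}) \<longlonglongrightarrow> L2_set (\<lambda>n. cmod (v n x)) {..N}"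
      unfolding L2_set_def by (intro tendsto_intros pt in_closure(1)[OF elim(2)]) simp
    then show ?case by (rule LIMSEQ_le_const2) (use elim(1) in blast)
  qed
  then have "v \<in> H" using v0 bdry unfolding admissible_def by (simp add: v_def)
  with conv show ?thesis by blast
qed

lemma ex1_minimizer:
  assumes lam: "lam \<ge> 0" and \<phi>: "\<phi> \<in> H" and ne: "H \<noteq> {}"
  shows "\<exists>!u. is_arg_min (J lam \<phi>) (\<lambda>u. u \<in> H) u"
proof -
  note \<phi>V = H_subset_V[OF \<phi>]
  define I where "I = (INF u\<in>H. J lam \<phi> u)"
  have bdd: "bdd_below (J lam \<phi> ` H)" using J_nonneg[OF lam] by (intro bdd_belowI[of _ 0]) auto
  have I_le: "I \<le> J lam \<phi> u" if "u \<in> H" for u unfolding I_def using bdd that by (rule cINF_lower)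
  \<comment> \<open>Two nearly minimal points are close to each other, since their midpoint lies in
    \<open>H\<close> and cannot fall below \<open>I\<close>.\<close>
  have close: "nsq (u - v) \<le> 4 / \<epsilon> * ((J lam \<phi> u + J lam \<phi> v) / 2 - I)" if "u \<in> H" "v \<in> H" for u v
  proof -
    have "I + \<epsilon> / 4 * nsq (u - v) \<le> (J lam \<phi> u + J lam \<phi> v) / 2"
      using J_midpoint[OF lam \<phi>V H_subset_V[OF that(1)] H_subset_V[OF that(2)]] I_le[OF H_midpoint[OF that]] by linarith
    then show ?thesis using params(4) by (simp add: field_simps)
  qed
  \<comment> \<open>The excess controls squared distances, so \<open>(1 / 4) ^ k\<close> yields
    increments that are geometric with ratio \<open>1 / 2\<close>; the factor
    \<open>4 / \<epsilon>\<close> becomes the constant \<open>2 / sqrt \<epsilon>\<close>.\<close>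
  have "\<exists>u\<in>H. J lam \<phi> u < I + (1 / 4) ^ k" for k :: nat
    using ne bdd unfolding I_def by (subst cINF_less_iff[symmetric]) auto
  then obtain u where u: "\<And>k. u k \<in> H" and Ju: "\<And>k. J lam \<phi> (u k) < I + (1 / 4) ^ k" by metis
  have "\<exists>v\<in>H. (\<lambda>k. nsq (u k - v)) \<longlonglongrightarrow> 0"
  proof (rule H_complete[OF u, of "1 / 2" "2 / sqrt \<epsilon>"])
    fix k
    have "(1 / 4 :: real) ^ Suc k \<le> (1 / 4) ^ k" by simp
    then have "(J lam \<phi> (u (Suc k)) + J lam \<phi> (u k)) / 2 - I \<le> (1 / 4) ^ k"
      using Ju[of k] Ju[of "Suc k"] by argo
    then have "4 / \<epsilon> * ((J lam \<phi> (u (Suc k)) + J lam \<phi> (u k)) / 2 - I) \<le> 4 / \<epsilon> * (1 / 4) ^ k"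
      using params(4) by (intro mult_left_mono) auto
    also have "\<dots> = (2 / sqrt \<epsilon> * (1 / 2) ^ k)\<^sup>2"
      using params(4) by (simp add: power_mult_distrib power_divide power_mult[symmetric] mult.commute[of k])
        (simp add: power_mult)
    finally show "nsq (u (Suc k) - u k) \<le> (2 / sqrt \<epsilon> * (1 / 2) ^ k)\<^sup>2"
      using close[OF u u, of "Suc k" k] by linarith
  qed (use params(4) in auto)
  then obtain v where v: "v \<in> H" and conv: "(\<lambda>k. nsq (u k - v)) \<longlonglongrightarrow> 0" by blast
  obtain K where K: "K \<ge> 0" and wt: "\<And>\<phi> u v \<delta>. \<lbrakk>\<phi> \<in> V; u \<in> V; v \<in> V; \<delta> > 0\<rbrakk> \<Longrightarrow>
    J lam \<phi> v \<le> (1 + \<delta>) * J lam \<phi> u + (1 + 1 / \<delta>) * (K * nsq (v - u))"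
    by (rule J_weak_triangle[OF lam]) blast
  \<comment> \<open>For fixed \<open>\<delta>\<close> the limit in \<open>k\<close> removes the term
    with \<open>1 / \<delta>\<close>; only afterwards does \<open>\<delta>\<close> tend to
    0.\<close>
  have Jv: "J lam \<phi> v \<le> (1 + \<delta>) * I" if \<delta>: "\<delta> > 0" for \<delta>
  proof (rule LIMSEQ_le_const)
    have "(\<lambda>k. (1 + \<delta>) * (I + (1 / 4) ^ k) + (1 + 1 / \<delta>) * (K * nsq (u k - v))) \<longlonglongrightarrow> (1 + \<delta>) * (I + 0) + (1 + 1 / \<delta>) * (K * 0)"
      by (intro tendsto_intros conv LIMSEQ_power_zero) auto
    then show "(\<lambda>k. (1 + \<delta>) * (I + (1 / 4) ^ k) + (1 + 1 / \<delta>) * (K * nsq (u k - v))) \<longlonglongrightarrow> (1 + \<delta>) * I" by simp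
    have "J lam \<phi> v \<le> (1 + \<delta>) * (I + (1 / 4) ^ k) + (1 + 1 / \<delta>) * (K * nsq (u k - v))" for k
    proof -
      have "(1 + \<delta>) * J lam \<phi> (u k) \<le> (1 + \<delta>) * (I + (1 / 4) ^ k)" using Ju[of k] \<delta> by (intro mult_left_mono) auto
      then show ?thesis
        using wt[OF \<phi>V H_subset_V[OF u] H_subset_V[OF v] \<delta>, of k] nsq_minus_commute[OF H_subset_V[OF u] H_subset_V[OF v], of k] by simp
    qed
    then show "\<exists>n. \<forall>k\<ge>n. J lam \<phi> v \<le> (1 + \<delta>) * (I + (1 / 4) ^ k) + (1 + 1 / \<delta>) * (K * nsq (u k - v))" by blast
  qed
  have "((\<lambda>\<delta>. (1 + \<delta>) * I) \<longlongrightarrow> (1 + 0) * I) (at_right 0)" by (intro tendsto_intros)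
  then have "J lam \<phi> v \<le> (1 + 0) * I"
    by (rule tendsto_lowerbound) (auto simp: eventually_at_right_less intro!: eventually_at_rightI[of 0 1] Jv)
  then have JvI: "J lam \<phi> v = I" using I_le[OF v] by simp
  show ?thesis
  proof (rule ex1I)
    show "is_arg_min (J lam \<phi>) (\<lambda>u. u \<in> H) v"
      unfolding is_arg_min_linorder using v JvI I_le by simp
    fix u assume "is_arg_min (J lam \<phi>) (\<lambda>u. u \<in> H) u"
    then have u: "u \<in> H" "J lam \<phi> u \<le> I" unfolding is_arg_min_linorder using v JvI by auto
    have "nsq (u - v) \<le> 4 / \<epsilon> * ((J lam \<phi> u + J lam \<phi> v) / 2 - I)" by (rule close[OF u(1) v])
    also have "\<dots> \<le> 0" using u(2) JvI params(4) by (intro mult_nonneg_nonpos) auto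
    finally show "u = v" using nsq_nonneg[of "u - v"] by (intro H_eqI u(1) v) simp
  qed
qed

text \<open>\<open>arg_min_on\<close> is a choice operator; its value is a minimizer once one
  exists.\<close>

lemma solution_map_minimizer:
  assumes "lam \<ge> 0" "\<phi> \<in> H"
  shows "is_arg_min (J lam \<phi>) (\<lambda>u. u \<in> H) (F lam \<phi>)"
  unfolding solution_map_def arg_min_on_def arg_min_def
  using ex1_minimizer[OF assms] assms(2) by (metis (no_types, lifting) empty_iff someI_ex)

lemma solution_map_H: "\<lbrakk>lam \<ge> 0; \<phi> \<in> H\<rbrakk> \<Longrightarrow> F lam \<phi> \<in> H"
  using solution_map_minimizer unfolding is_arg_min_def by blast

section \<open>Picard iteration\<close>

text \<open>A chain of comparisons: \<open>J lam\<close> at \<open>F lam'\<close> is at most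
  \<open>\<rho>\<close> times \<open>J lam'\<close> there, hence at most \<open>\<rho>\<close> times
  \<open>J lam'\<close> at \<open>F lam\<close>, hence at most \<open>\<rho>^2\<close> times the
  minimum of \<open>J lam\<close>. Strong convexity bounds the distance of such a nearly minimal
  point from the minimizer.\<close>

lemma F_parameter_stability:
  assumes lam: "0 \<le> lam" "0 \<le> lam'" and \<phi>: "\<phi> \<in> H" and "\<rho> \<ge> 0"
    and \<rho>: "J lam' \<phi> (F lam \<phi>) \<le> \<rho> * J lam \<phi> (F lam \<phi>)" "J lam \<phi> (F lam' \<phi>) \<le> \<rho> * J lam' \<phi> (F lam' \<phi>)"
  shows "nsq (F lam' \<phi> - F lam \<phi>) \<le> 2 / \<epsilon> * ((\<rho>\<^sup>2 - 1) * J lam \<phi> (F lam \<phi>))"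
proof -
  have H: "F lam \<phi> \<in> H" "F lam' \<phi> \<in> H" by (rule solution_map_H[OF lam(1) \<phi>], rule solution_map_H[OF lam(2) \<phi>])
  have min: "J lam \<phi> (F lam \<phi>) \<le> J lam \<phi> z" "J lam' \<phi> (F lam' \<phi>) \<le> J lam' \<phi> z" if "z \<in> H" for z
    using solution_map_minimizer[OF lam(1) \<phi>] solution_map_minimizer[OF lam(2) \<phi>] that
    unfolding is_arg_min_linorder by blast+
  have "J lam \<phi> (F lam \<phi>) + \<epsilon> / 4 * nsq (F lam' \<phi> - F lam \<phi>) \<le> (J lam \<phi> (F lam' \<phi>) + J lam \<phi> (F lam \<phi>)) / 2"
    using J_midpoint[OF lam(1) H_subset_V[OF \<phi>] H_subset_V[OF H(2)] H_subset_V[OF H(1)]] min(1)[OF H_midpoint[OF H(2) H(1)]]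
    by linarith
  moreover have "J lam \<phi> (F lam' \<phi>) \<le> \<rho>\<^sup>2 * J lam \<phi> (F lam \<phi>)"
  proof -
    have "\<rho> * J lam' \<phi> (F lam' \<phi>) \<le> \<rho> * (\<rho> * J lam \<phi> (F lam \<phi>))"
      using min(2)[OF H(1)] \<rho>(1) \<open>\<rho> \<ge> 0\<close> by (intro mult_left_mono) auto
    then show ?thesis using \<rho>(2) by (simp add: power2_eq_square mult.assoc)
  qed
  ultimately have "\<epsilon> / 4 * nsq (F lam' \<phi> - F lam \<phi>) \<le> (\<rho>\<^sup>2 - 1) * J lam \<phi> (F lam \<phi>) / 2"
    by (simp add: algebra_simps)
  then have "4 / \<epsilon> * (\<epsilon> / 4 * nsq (F lam' \<phi> - F lam \<phi>)) \<le> 4 / \<epsilon> * ((\<rho>\<^sup>2 - 1) * J lam \<phi> (F lam \<phi>) / 2)"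
    using params(4) by (intro mult_left_mono) auto
  then show ?thesis using params(4) by simp
qed

text \<open>The case \<open>lam = lambda1\<close>, where the hypothesis says nothing about \<open>lam\<close> itself, is the reason for
  letting the parameter decrease to \<open>lam\<close>.\<close>

lemma lipschitz_limit:
  assumes lam: "lam > lambda0 \<Omega> x0 \<beta>" "lam \<ge> lambda1"
    and lipschitz: "\<And>lam' \<phi> \<psi>. \<lbrakk>lam' > lambda1; lam' > lambda0 \<Omega> x0 \<beta>; \<phi> \<in> H; \<psi> \<in> H\<rbrakk> \<Longrightarrow>
      nrm lam' (F lam' \<phi> - F lam' \<psi>) \<le> sqrt (C / lam' ^ 3) * nrm lam' (\<phi> - \<psi>)"
    and \<phi>: "\<phi> \<in> H" and \<psi>: "\<psi> \<in> H"
  shows "nrm lam (F lam \<phi> - F lam \<psi>) \<le> sqrt (C / lam ^ 3) * nrm lam (\<phi> - \<psi>)"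
proof -
  have pos: "lam > 0" using lam(1) lambda0_nonneg by linarith
  then have nn: "lam \<ge> 0" by simp
  \<comment> \<open>Parameters strictly above \<open>lam\<close>, hence above
    \<open>lambda1\<close>, that decrease to \<open>lam\<close>.\<close>
  define L where "L k = lam + inverse (real (Suc k))" for k
  have L: "lam < L k" "0 < L k" "L k \<ge> 0" for k
  proof -
    have "inverse (real (Suc k)) > 0" by simp
    then show "lam < L k" "0 < L k" "L k \<ge> 0" using pos unfolding L_def by linarith+
  qed
  have L_lim: "L \<longlonglongrightarrow> lam"
    using tendsto_add[OF tendsto_const[of lam] LIMSEQ_inverse_real_of_nat] by (simp add: L_def[abs_def])
  obtain A where
    J_le: "\<And>a b \<phi> u. \<lbrakk>0 < a; 0 < b; \<phi> \<in> V; u \<in> V\<rbrakk> \<Longrightarrow> J a \<phi> u \<le> exp (A * \<bar>a - b\<bar>) * (max (a / b) (b / a)) ^ 3 * J b \<phi> u"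
    and NQ_ratio: "\<And>a b u. \<lbrakk>0 < a; 0 < b; u \<in> V\<rbrakk> \<Longrightarrow> NQ a u \<le> exp (A * \<bar>a - b\<bar>) * (max (a / b) (b / a)) ^ 3 * NQ b u"
    by (rule weight_comparison) blast
  \<comment> \<open>The factor of \<open>weight_comparison\<close> between \<open>L k\<close> and
    \<open>lam\<close>, in either direction.\<close>
  define \<rho> where "\<rho> k = exp (A * \<bar>L k - lam\<bar>) * (max (L k / lam) (lam / L k)) ^ 3" for k
  have \<rho>_sym: "exp (A * \<bar>lam - L k\<bar>) * (max (lam / L k) (L k / lam)) ^ 3 = \<rho> k" for k
    unfolding \<rho>_def by (simp only: abs_minus_commute max.commute)
  have "\<rho> \<longlonglongrightarrow> exp (A * \<bar>lam - lam\<bar>) * (max (lam / lam) (lam / lam)) ^ 3"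
    unfolding \<rho>_def using pos by (intro tendsto_intros L_lim) auto
  then have \<rho>_lim: "\<rho> \<longlonglongrightarrow> 1" using pos by simp
  have \<rho>_pos: "\<rho> k > 0" for k
    unfolding \<rho>_def using L(2)[of k] pos by (intro mult_pos_pos zero_less_power) (auto simp: less_max_iff_disj)
  obtain K where K: "K \<ge> 0" and NQ_le: "\<And>u. u \<in> V \<Longrightarrow> NQ lam u \<le> K * nsq u"
    by (rule NQ_nsq_equiv[OF pos]) blast
  note \<phi>V = H_subset_V[OF \<phi>] and \<psi>V = H_subset_V[OF \<psi>]
  have FH: "F lam \<zeta> \<in> V" "F (L k) \<zeta> \<in> V" if "\<zeta> \<in> H" for \<zeta> k
    by (rule H_subset_V[OF solution_map_H[OF nn that]], rule H_subset_V[OF solution_map_H[OF L(3) that]])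
  \<comment> \<open>Minimizers depend continuously on the parameter: the bound of
    \<open>F_parameter_stability\<close> has the factor \<open>(\<rho> k)^2 - 1\<close>, which tends
    to 0, times a fixed value of the functional.\<close>
  have F_lim: "(\<lambda>k. nsq (F (L k) \<zeta> - F lam \<zeta>)) \<longlonglongrightarrow> 0" if \<zeta>: "\<zeta> \<in> H" for \<zeta>
  proof (rule tendsto_sandwich[OF _ _ tendsto_const])
    show "\<forall>\<^sub>F k in sequentially. 0 \<le> nsq (F (L k) \<zeta> - F lam \<zeta>)" by (simp add: nsq_nonneg)
    show "\<forall>\<^sub>F k in sequentially. nsq (F (L k) \<zeta> - F lam \<zeta>) \<le> 2 / \<epsilon> * (((\<rho> k)\<^sup>2 - 1) * J lam \<zeta> (F lam \<zeta>))"
    proof (intro always_eventually allI)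
      show "nsq (F (L k) \<zeta> - F lam \<zeta>) \<le> 2 / \<epsilon> * (((\<rho> k)\<^sup>2 - 1) * J lam \<zeta> (F lam \<zeta>))" for k
        by (rule F_parameter_stability[OF nn L(3) \<zeta> less_imp_le[OF \<rho>_pos]
              J_le[OF L(2) pos H_subset_V[OF \<zeta>] FH(1)[OF \<zeta>], of k, folded \<rho>_def]
              J_le[OF pos L(2) H_subset_V[OF \<zeta>] FH(2)[OF \<zeta>], of k, unfolded \<rho>_sym]])
    qed
    have "(\<lambda>k. 2 / \<epsilon> * (((\<rho> k)\<^sup>2 - 1) * J lam \<zeta> (F lam \<zeta>))) \<longlonglongrightarrow> 2 / \<epsilon> * ((1\<^sup>2 - 1) * J lam \<zeta> (F lam \<zeta>))"
      by (intro tendsto_intros \<rho>_lim)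
    then show "(\<lambda>k. 2 / \<epsilon> * (((\<rho> k)\<^sup>2 - 1) * J lam \<zeta> (F lam \<zeta>))) \<longlonglongrightarrow> 0" by simp
  qed
  \<comment> \<open>The cost, in the norm for \<open>lam\<close>, of replacing both images under
    \<open>F lam\<close> by those under \<open>F (L k)\<close>.\<close>
  define err where "err k = sqrt (K * nsq (F (L k) \<phi> - F lam \<phi>)) + sqrt (K * nsq (F (L k) \<psi> - F lam \<psi>))" for k
  have "err \<longlonglongrightarrow> sqrt (K * 0) + sqrt (K * 0)"
    unfolding err_def by (intro tendsto_intros F_lim \<phi> \<psi>)
  then have err_lim: "err \<longlonglongrightarrow> 0" by simp
  have N_lim: "(\<lambda>k. nrm (L k) (\<phi> - \<psi>)) \<longlonglongrightarrow> nrm lam (\<phi> - \<psi>)"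
  proof -
    note w = V_diff[OF \<phi>V \<psi>V]
    have "(\<lambda>k. NQ (L k) (\<phi> - \<psi>)) \<longlonglongrightarrow> NQ lam (\<phi> - \<psi>)"
    proof (rule tendsto_sandwich)
      show "\<forall>\<^sub>F k in sequentially. NQ lam (\<phi> - \<psi>) / \<rho> k \<le> NQ (L k) (\<phi> - \<psi>)"
        using NQ_ratio[OF pos L(2) w, unfolded \<rho>_sym] \<rho>_pos
        by (intro always_eventually allI) (simp only: pos_divide_le_eq mult.commute)
      show "\<forall>\<^sub>F k in sequentially. NQ (L k) (\<phi> - \<psi>) \<le> \<rho> k * NQ lam (\<phi> - \<psi>)"
        by (intro always_eventually allI NQ_ratio[OF L(2) pos w, folded \<rho>_def])
      show "(\<lambda>k. NQ lam (\<phi> - \<psi>) / \<rho> k) \<longlonglongrightarrow> NQ lam (\<phi> - \<psi>)"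
        using tendsto_divide[OF tendsto_const[of "NQ lam (\<phi> - \<psi>)"] \<rho>_lim] by simp
      show "(\<lambda>k. \<rho> k * NQ lam (\<phi> - \<psi>)) \<longlonglongrightarrow> NQ lam (\<phi> - \<psi>)"
        using tendsto_mult[OF \<rho>_lim tendsto_const[of "NQ lam (\<phi> - \<psi>)"]] by simp
    qed
    then show ?thesis by (simp only: nrm_eq[OF L(3) w] nrm_eq[OF nn w]) (rule tendsto_real_sqrt)
  qed
  show ?thesis
  proof (rule LIMSEQ_le_const)
    have "(\<lambda>k. sqrt (\<rho> k) * (sqrt (C / L k ^ 3) * nrm (L k) (\<phi> - \<psi>)) + err k)
       \<longlonglongrightarrow> sqrt 1 * (sqrt (C / lam ^ 3) * nrm lam (\<phi> - \<psi>)) + 0"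
      using pos by (intro tendsto_intros \<rho>_lim L_lim N_lim err_lim) auto
    then show "(\<lambda>k. sqrt (\<rho> k) * (sqrt (C / L k ^ 3) * nrm (L k) (\<phi> - \<psi>)) + err k)
       \<longlonglongrightarrow> sqrt (C / lam ^ 3) * nrm lam (\<phi> - \<psi>)" by simp
    \<comment> \<open>From \<open>F lam\<close> to \<open>F (L k)\<close> at cost
      \<open>err k\<close>, then from the norm for \<open>lam\<close> to the one for
      \<open>L k\<close> at cost \<open>sqrt (\<rho> k)\<close>; there the hypothesis
      applies.\<close>
    have "nrm lam (F lam \<phi> - F lam \<psi>) \<le> sqrt (\<rho> k) * (sqrt (C / L k ^ 3) * nrm (L k) (\<phi> - \<psi>)) + err k" for k
    proof -
      define a b a' b' where "a = F lam \<phi>" and "b = F lam \<psi>" and "a' = F (L k) \<phi>" and "b' = F (L k) \<psi>"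
      have V: "a \<in> V" "b \<in> V" "a' \<in> V" "b' \<in> V"
        unfolding a_def b_def a'_def b'_def by (rule FH[OF \<phi>] FH[OF \<psi>])+
      have small: "nrm lam u \<le> sqrt (K * nsq u)" if "u \<in> V" for u
        unfolding nrm_eq[OF nn that] by (rule real_sqrt_le_mono[OF NQ_le[OF that]])
      have "nrm lam (a - b) \<le> nrm lam (a' - b') + nrm lam ((a - b) - (a' - b'))"
        by (rule nrm_triangle[OF nn V_diff[OF V(1,2)] V_diff[OF V(3,4)]])
      moreover have "nrm lam ((a - b) - (a' - b')) \<le> nrm lam (a - a') + nrm lam (b' - b)"
      proof -
        have "((a - b) - (a' - b')) - (a - a') = b' - b" by (simp add: fun_eq_iff)
        with nrm_triangle[OF nn V_diff[OF V_diff[OF V(1,2)] V_diff[OF V(3,4)]] V_diff[OF V(1,3)]]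
        show ?thesis by (simp only:)
      qed
      moreover have "nrm lam (a - a') \<le> sqrt (K * nsq (a' - a))"
        using small[OF V_diff[OF V(1,3)]] nsq_minus_commute[OF V(1,3)] by simp
      moreover have "nrm lam (b' - b) \<le> sqrt (K * nsq (b' - b))" by (rule small[OF V_diff[OF V(4,2)]])
      moreover have "nrm lam (a' - b') \<le> sqrt (\<rho> k) * (sqrt (C / L k ^ 3) * nrm (L k) (\<phi> - \<psi>))"
      proof -
        note ab = V_diff[OF V(3,4)]
        have "nrm lam (a' - b') \<le> sqrt (\<rho> k * NQ (L k) (a' - b'))"
          unfolding nrm_eq[OF nn ab] by (rule real_sqrt_le_mono[OF NQ_ratio[OF pos L(2) ab, unfolded \<rho>_sym]])
        also have "\<dots> = sqrt (\<rho> k) * nrm (L k) (a' - b')"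
          by (simp only: real_sqrt_mult nrm_eq[OF L(3) ab])
        also have "\<dots> \<le> sqrt (\<rho> k) * (sqrt (C / L k ^ 3) * nrm (L k) (\<phi> - \<psi>))"
        proof (rule mult_left_mono)
          show "nrm (L k) (a' - b') \<le> sqrt (C / L k ^ 3) * nrm (L k) (\<phi> - \<psi>)"
            unfolding a'_def b'_def using L(1)[of k] lam by (intro lipschitz \<phi> \<psi>) linarith+
        qed (use \<rho>_pos[of k] in simp)
        finally show ?thesis .
      qed
      ultimately show ?thesis unfolding err_def a_def b_def a'_def b'_def by linarith
    qed
    then show "\<exists>n. \<forall>k\<ge>n. nrm lam (F lam \<phi> - F lam \<psi>) \<le> sqrt (\<rho> k) * (sqrt (C / L k ^ 3) * nrm (L k) (\<phi> - \<psi>)) + err k"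
      by blast
  qed
qed

lemma nrm_le_zero_imp_eq:
  assumes lam: "lam > 0" and u: "u \<in> H" and v: "v \<in> H" and "nrm lam (u - v) \<le> 0"
  shows "u = v"
proof (rule H_eqI[OF u v])
  have nn: "lam \<ge> 0" using lam by simp
  note uv = V_diff[OF H_subset_V[OF u] H_subset_V[OF v]]
  obtain c where c: "c > 0" "\<And>u. u \<in> V \<Longrightarrow> c * nsq u \<le> NQ lam u"
    by (rule NQ_nsq_equiv[OF lam]) blast
  have "sqrt (NQ lam (u - v)) \<le> 0" using assms(4) unfolding nrm_eq[OF nn uv] .
  then have "c * nsq (u - v) \<le> 0" using c(2)[OF uv] by simp
  then show "nsq (u - v) = 0" using c(1) nsq_nonneg[of "u - v"] by (simp add: mult_le_0_iff)
qed

text \<open>Banach's argument with two norms: the contraction is given in the weighted norm,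
  completeness of \<open>H\<close> in the Sobolev norm. Their equivalence carries the geometric
  increments over to the Sobolev norm and the convergence back.\<close>

lemma picard_converges:
  assumes lam: "lam > 0" and \<kappa>: "0 < \<kappa>" "\<kappa> < 1"
    and contr: "\<And>\<phi> \<psi>. \<lbrakk>\<phi> \<in> H; \<psi> \<in> H\<rbrakk> \<Longrightarrow> nrm lam (F lam \<phi> - F lam \<psi>) \<le> \<kappa> * nrm lam (\<phi> - \<psi>)"
    and u: "\<And>k. u k \<in> H" and picard: "\<And>k. u (Suc k) = F lam (u k)"
  obtains v where "v \<in> H" "F lam v = v" "(\<lambda>k. nrm lam (u k - v)) \<longlonglongrightarrow> 0"
proof -
  have nn: "lam \<ge> 0" using lam by simp
  have uV: "u k \<in> V" for k by (rule H_subset_V[OF u])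
  obtain c K where c: "c > 0" and K: "K \<ge> 0" and cN: "\<And>u. u \<in> V \<Longrightarrow> c * nsq u \<le> NQ lam u"
    and NK: "\<And>u. u \<in> V \<Longrightarrow> NQ lam u \<le> K * nsq u"
    by (rule NQ_nsq_equiv[OF lam]) blast
  define d where "d = nrm lam (u 1 - u 0)"
  have d: "d \<ge> 0" unfolding d_def by (rule nrm_nonneg[OF nn V_diff[OF uV uV]])
  have incr: "nrm lam (u (Suc k) - u k) \<le> \<kappa> ^ k * d" for k
  proof (induction k)
    case 0
    show ?case by (simp only: d_def power_0 mult_1_left One_nat_def order_refl)
  next
    case (Suc k)
    have "nrm lam (u (Suc (Suc k)) - u (Suc k)) \<le> \<kappa> * nrm lam (u (Suc k) - u k)"
      using contr[OF u u, of "Suc k" k] by (simp only: picard)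
    also have "\<dots> \<le> \<kappa> * (\<kappa> ^ k * d)" by (rule mult_left_mono[OF Suc]) (use \<kappa> in simp)
    finally show ?case by (simp only: power_Suc mult.assoc)
  qed
  have "\<exists>v\<in>H. (\<lambda>k. nsq (u k - v)) \<longlonglongrightarrow> 0"
  \<comment> \<open>Since \<open>c * nsq\<close> is at most \<open>NQ\<close>, Sobolev increments
    are at most \<open>\<kappa> ^ k * d / sqrt c\<close>.\<close>
  proof (rule H_complete[OF u \<kappa>, of "d / sqrt c"])
    show "d / sqrt c \<ge> 0" using d c by simp
    fix k
    note uu = V_diff[OF uV[of "Suc k"] uV[of k]]
    have "NQ lam (u (Suc k) - u k) = (nrm lam (u (Suc k) - u k))\<^sup>2"
      unfolding nrm_eq[OF nn uu] by (simp add: NQ_nonneg[OF nn])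
    also have "\<dots> \<le> (\<kappa> ^ k * d)\<^sup>2" by (rule power_mono[OF incr nrm_nonneg[OF nn uu]])
    finally have "c * nsq (u (Suc k) - u k) \<le> (\<kappa> ^ k * d)\<^sup>2" using cN[OF uu] by linarith
    then have "nsq (u (Suc k) - u k) \<le> (\<kappa> ^ k * d)\<^sup>2 / c" using c by (simp add: pos_le_divide_eq mult.commute)
    also have "\<dots> = (d / sqrt c * \<kappa> ^ k)\<^sup>2" using c by (simp add: power_mult_distrib power_divide)
    finally show "nsq (u (Suc k) - u k) \<le> (d / sqrt c * \<kappa> ^ k)\<^sup>2" .
  qed
  then obtain v where v: "v \<in> H" and conv: "(\<lambda>k. nsq (u k - v)) \<longlonglongrightarrow> 0" by blast
  note vV = H_subset_V[OF v]
  have small: "nrm lam z \<le> sqrt (K * nsq z)" if "z \<in> V" for z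
    unfolding nrm_eq[OF nn that] by (rule real_sqrt_le_mono[OF NK[OF that]])
  have lim0: "(\<lambda>k. sqrt (K * nsq (u k - v))) \<longlonglongrightarrow> 0"
    using tendsto_real_sqrt[OF tendsto_mult[OF tendsto_const[of K] conv]] by simp
  have lim1: "(\<lambda>k. nrm lam (u k - v)) \<longlonglongrightarrow> 0"
    by (rule tendsto_sandwich[OF _ _ tendsto_const lim0])
       (intro always_eventually allI nrm_nonneg[OF nn] small V_diff uV vV)+
  have lim2: "(\<lambda>k. nrm lam (v - u k)) \<longlonglongrightarrow> 0"
  proof (rule tendsto_sandwich[OF _ _ tendsto_const lim0])
    show "\<forall>\<^sub>F k in sequentially. 0 \<le> nrm lam (v - u k)"
      by (intro always_eventually allI nrm_nonneg[OF nn] V_diff uV vV)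
    show "\<forall>\<^sub>F k in sequentially. nrm lam (v - u k) \<le> sqrt (K * nsq (u k - v))"
      using small[OF V_diff[OF vV uV]] nsq_minus_commute[OF vV uV] by (intro always_eventually allI) simp
  qed
  note FvH = solution_map_H[OF nn v]
  have "nrm lam (F lam v - v) \<le> 0"
  proof (rule LIMSEQ_le_const)
    show "(\<lambda>k. nrm lam (u (Suc k) - v) + \<kappa> * nrm lam (v - u k)) \<longlonglongrightarrow> 0"
      using tendsto_add[OF LIMSEQ_Suc[OF lim1] tendsto_mult[OF tendsto_const[of \<kappa>] lim2]] by simp
    \<comment> \<open>The distance splits at \<open>u (Suc k) = F lam (u k)\<close> into a shifted
      error and a contracted one, and both tend to 0.\<close>
    have "nrm lam (F lam v - v) \<le> nrm lam (u (Suc k) - v) + \<kappa> * nrm lam (v - u k)" for k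
    proof -
      have "(F lam v - v) - (u (Suc k) - v) = F lam v - F lam (u k)" by (simp add: fun_eq_iff picard)
      then show ?thesis
        using nrm_triangle[OF nn V_diff[OF H_subset_V[OF FvH] vV] V_diff[OF uV[of "Suc k"] vV]] contr[OF v u[of k]] by simp
    qed
    then show "\<exists>n. \<forall>k\<ge>n. nrm lam (F lam v - v) \<le> nrm lam (u (Suc k) - v) + \<kappa> * nrm lam (v - u k)" by blast
  qed
  then have "F lam v = v" by (rule nrm_le_zero_imp_eq[OF lam FvH v])
  with v lim1 show ?thesis using that by blast
qed

end

text \<open>The recalled estimate has the factor \<open>sqrt (C / lam ^ 3)\<close>, which is known
  to give a contraction where it is below 1. As \<open>lambda1\<close> and \<open>C\<close> enter
  only through that estimate, this is a hypothesis on \<open>lam\<close>. The decay is stated for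
  every contraction constant, as none is singled out.\<close>

theorem corollary4p1:
  fixes \<Omega> :: "'a::euclidean_space set" and \<nu> :: "'a \<Rightarrow> 'a"
    and T p :: real and q :: "'a \<Rightarrow> real \<Rightarrow> real" and N :: nat
    and x0 :: 'a and \<beta>0 \<beta> s M \<epsilon> lambda1 C lam :: real
    and f :: "nat \<Rightarrow> 'a \<Rightarrow> complex"
    and u :: "nat \<Rightarrow> nat \<Rightarrow> 'a \<Rightarrow> complex"
  defines "H \<equiv> admissible s \<Omega> N M"
    and "J \<equiv> functional_J \<Omega> \<nu> T p q N x0 \<beta> s f \<epsilon>"
    and "F \<equiv> solution_map \<Omega> \<nu> T p q N x0 \<beta> s M f \<epsilon>"
    and "nrm \<equiv> carleman_norm \<Omega> \<nu> N x0 \<beta> s \<epsilon>"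
  assumes domain: "smooth_bounded_domain \<Omega>" "outward_unit_normal \<Omega> \<nu>"
    and params: "T > 0" "p > 1" "s > real DIM('a) / 2 + 2" "M > 0" "\<epsilon> > 0"
    and potential: "essentially_bounded_potential \<Omega> T q"
    and data: "\<And>m. m \<le> N \<Longrightarrow> f m \<in> borel_measurable (surface_measure \<Omega>)"
      "\<And>m. m \<le> N \<Longrightarrow> integrable (surface_measure \<Omega>) (\<lambda>x. (cmod (f m x))\<^sup>2)"
    and weight: "x0 \<notin> closure \<Omega>" "carleman_threshold \<Omega> x0 \<beta>0" "\<beta> > \<beta>0"
    and lipschitz: "\<And>lam' \<phi> \<psi>. \<lbrakk>lam' > lambda1; lam' > lambda0 \<Omega> x0 \<beta>; \<phi> \<in> H; \<psi> \<in> H\<rbrakk> \<Longrightarrow>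
      nrm lam' (F lam' \<phi> - F lam' \<psi>) \<le> sqrt (C / lam' ^ 3) * nrm lam' (\<phi> - \<psi>)"
    and lam: "lam > lambda0 \<Omega> x0 \<beta>" "lam \<ge> lambda1" "sqrt (C / lam ^ 3) < 1"
    and picard: "u 0 \<in> H" "\<And>k. u (Suc k) = F lam (u k)"
  shows "\<exists>v\<in>H.
    F lam v = v \<and> (\<forall>w\<in>H. F lam w = w \<longrightarrow> w = v) \<and>
    (\<forall>k. u k \<in> H) \<and> (\<lambda>k. nrm lam (u k - v)) \<longlonglongrightarrow> 0 \<and>
    is_arg_min (J lam v) (\<lambda>w. w \<in> H) v \<and>
    (\<forall>w. is_arg_min (J lam v) (\<lambda>w. w \<in> H) w \<longrightarrow> w = v) \<and>
    (\<exists>\<mu>. 0 < \<mu> \<and> \<mu> < 1 \<and>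
       (\<forall>\<phi>\<in>H. \<forall>\<psi>\<in>H. nrm lam (F lam \<phi> - F lam \<psi>) \<le> \<mu> * nrm lam (\<phi> - \<psi>))) \<and>
    (\<forall>\<mu>. 0 < \<mu> \<and> \<mu> < 1 \<and>
       (\<forall>\<phi>\<in>H. \<forall>\<psi>\<in>H. nrm lam (F lam \<phi> - F lam \<psi>) \<le> \<mu> * nrm lam (\<phi> - \<psi>)) \<longrightarrow>
       (\<forall>k. nrm lam (u k - v) \<le> \<mu> ^ k * nrm lam (u 0 - v)))"
proof -
  have "\<beta> > 0" using weight unfolding carleman_threshold_def by linarith
  interpret P: carleman_problem \<Omega> \<nu> T p q N x0 \<beta> s M \<epsilon> f
    by unfold_locales (use assms \<open>\<beta> > 0\<close> in auto)
  have pos: "lam > 0" using lam(1) P.lambda0_nonneg by linarith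
  then have nn: "lam \<ge> 0" by simp
  have lip: "nrm lam (F lam \<phi> - F lam \<psi>) \<le> sqrt (C / lam ^ 3) * nrm lam (\<phi> - \<psi>)" if "\<phi> \<in> H" "\<psi> \<in> H" for \<phi> \<psi>
    using P.lipschitz_limit[OF lam(1,2) lipschitz[unfolded H_def F_def nrm_def]] that
    unfolding H_def F_def nrm_def by blast
  \<comment> \<open>\<open>C\<close> has no prescribed sign, and the real \<open>sqrt\<close> of a
    negative number is negative; the maximum with \<open>1 / 2\<close> secures a positive
    constant.\<close>
  define \<mu> where "\<mu> = max (sqrt (C / lam ^ 3)) (1 / 2)"
  have \<mu>: "0 < \<mu>" "\<mu> < 1" using lam(3) by (auto simp: \<mu>_def)
  have contr: "nrm lam (F lam \<phi> - F lam \<psi>) \<le> \<mu> * nrm lam (\<phi> - \<psi>)" if "\<phi> \<in> H" "\<psi> \<in> H" for \<phi> \<psi>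
  proof -
    have "nrm lam (\<phi> - \<psi>) \<ge> 0"
      unfolding nrm_def using that unfolding H_def by (intro P.nrm_nonneg[OF nn] P.V_diff P.H_subset_V)
    then have "sqrt (C / lam ^ 3) * nrm lam (\<phi> - \<psi>) \<le> \<mu> * nrm lam (\<phi> - \<psi>)"
      by (intro mult_right_mono) (auto simp: \<mu>_def)
    then show ?thesis using lip[OF that] by linarith
  qed
  have uH: "u k \<in> H" for k
  proof (induction k)
    case (Suc k)
    then show ?case unfolding picard(2) H_def F_def by (rule P.solution_map_H[OF nn])
  qed (rule picard(1))
  obtain v where v: "v \<in> H" "F lam v = v" "(\<lambda>k. nrm lam (u k - v)) \<longlonglongrightarrow> 0"
    unfolding H_def F_def nrm_def
    by (rule P.picard_converges[where lam = lam and \<kappa> = \<mu> and u = u,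
        OF pos \<mu> contr[unfolded H_def F_def nrm_def] uH[unfolded H_def] picard(2)[unfolded F_def]])
  have uniq: "w = v" if w: "w \<in> H" "F lam w = w" for w
  proof -
    have "nrm lam (w - v) \<le> \<mu> * nrm lam (w - v)" using contr[OF w(1) v(1)] w(2) v(2) by simp
    then have "(1 - \<mu>) * nrm lam (w - v) \<le> 0" by (simp add: algebra_simps)
    then have "nrm lam (w - v) \<le> 0" using \<mu>(2) by (simp add: mult_le_0_iff)
    then show ?thesis using w(1) v(1) unfolding H_def nrm_def by (intro P.nrm_le_zero_imp_eq[OF pos])
  qed
  have min: "is_arg_min (J lam v) (\<lambda>w. w \<in> H) v"
    using P.solution_map_minimizer[OF nn v(1)[unfolded H_def]] v(2) unfolding F_def H_def J_def by simp
  have min_uniq: "w = v" if "is_arg_min (J lam v) (\<lambda>w. w \<in> H) w" for w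
    using P.ex1_minimizer[OF nn v(1)[unfolded H_def]] v(1) min that unfolding H_def J_def by blast
  \<comment> \<open>Shown for an arbitrary contraction constant, not just for the
    \<open>\<mu>\<close> with which \<open>v\<close> was constructed; each step compares
    \<open>u (Suc k)\<close> with \<open>v = F lam v\<close>.\<close>
  have rate: "nrm lam (u k - v) \<le> \<kappa> ^ k * nrm lam (u 0 - v)"
    if \<kappa>: "0 < \<kappa>" "\<forall>\<phi>\<in>H. \<forall>\<psi>\<in>H. nrm lam (F lam \<phi> - F lam \<psi>) \<le> \<kappa> * nrm lam (\<phi> - \<psi>)" for \<kappa> k
  proof (induction k)
    case (Suc k)
    have "nrm lam (u (Suc k) - v) \<le> \<kappa> * nrm lam (u k - v)"
      using \<kappa>(2)[rule_format, OF uH[of k] v(1)] v(2) by (simp add: picard(2))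
    also have "\<dots> \<le> \<kappa> * (\<kappa> ^ k * nrm lam (u 0 - v))" by (rule mult_left_mono[OF Suc]) (use \<kappa>(1) in simp)
    finally show ?case by (simp only: power_Suc mult.assoc)
  qed simp
  show ?thesis
  proof (intro bexI[OF _ v(1)] conjI)
    show "\<exists>\<mu>. 0 < \<mu> \<and> \<mu> < 1 \<and> (\<forall>\<phi>\<in>H. \<forall>\<psi>\<in>H. nrm lam (F lam \<phi> - F lam \<psi>) \<le> \<mu> * nrm lam (\<phi> - \<psi>))"
      using \<mu> contr by blast
  qed (use v uniq uH min min_uniq rate in blast)+
qed

end
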